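(* Let $\phi\in L^2(\mathbb{R})$ and $\alpha,\beta>0$. The following two statements are equivalent. (a) The Gabor system $\mathcal{G}(\phi,\alpha,\beta)$ is a tight frame for $L^2(\mathbb{R})$ with frame bound $\beta^{-1}$, and for every $k\in\mathbb{Z}$, $$\Delta_k(\xi)=\sum_{m\in\mathbb{Z}}(-1)^m\hat\phi(\xi+\alpha m)\overline{\hat\phi(\xi+\beta^{-1}(k+1/2)-\alpha m)}=0\quad\text{for a.e. }\xi\in\mathbb{R}.$$ (b) The Wilson system $\mathcal{W}(\phi,\alpha,\beta)$ is a Parseval frame for $L^2(\mathbb{R})$.
   Context: The Fourier transform is $\hat f(w)=\int_{\mathbb{R}} f(t)e^{-2\pi i t w}\,dt$ (extended unitarily to $L^2(\mathbb{R})$). $\mathbb{N}=\{1,2,\dots\}$, $\mathbb{N}_0=\mathbb{N}\cup\{0\}$. For $\phi\in L^2(\mathbb{R})$ and $\alpha,\beta>0$, the Gabor system is $\mathcal{G}(\phi,\alpha,\beta)=\{\phi_{j,m}: j,m\in\mathbb{Z}\}$ with $\phi_{j,m}(x)=\phi(x-\beta j)e^{2\pi i\alpha m x}$. The (bimodal) Wilson system is $\mathcal{W}(\phi,\alpha,\beta)=\{\psi_{j,m}: j\in\mathbb{Z}, m\in\mathbb{N}_0\}$ with $$\psi_{j,0}(x)=\sqrt{2\beta}\,\phi_{2j,0}(x)=\sqrt{2\beta}\,\phi(x-2\beta j)\quad (j\in\mathbb{Z}),$$ $$\psi_{j,m}(x)=\sqrt{\beta}\left[e^{-2\pi i\beta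 j\alpha m}\phi_{j,m}(x)+(-1)^{j+m}e^{2\pi i\beta j\alpha m}\phi_{j,-m}(x)\right]\quad (j\in\mathbb{Z},\ m\in\mathbb{N}).$$ A countable indexed family $\{e_i\}$ in $L^2(\mathbb{R})$ is a tight frame with frame bound $A>0$ if $\sum_i|\langle f,e_i\rangle|^2=A\|f\|_{L^2}^2$ for all $f\in L^2(\mathbb{R})$; it is a Parseval frame if this holds with $A=1$. *)

theory Defs
  imports "HOL-Analysis.Analysis"
begin

text \<open>
  Elements of $L^2(R)$ are represented by Borel measurable functions (every class modulo null
  sets has such a representative), and equality in $L^2(R)$ is equality almost everywhere.
\<close>

definition L2 :: "(real \<Rightarrow> complex) set" where
  "L2 = {f. f \<in> borel_measurable lborel \<and> integrable lborel (\<lambda>x. (cmod (f x))\<^sup>2)}"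

definition L2_inner :: "(real \<Rightarrow> complex) \<Rightarrow> (real \<Rightarrow> complex) \<Rightarrow> complex" where
  "L2_inner f g = (LINT x|lborel. f x * cnj (g x))"

definition L2_norm :: "(real \<Rightarrow> complex) \<Rightarrow> real" where
  "L2_norm f = sqrt (LINT x|lborel. (cmod (f x))\<^sup>2)"

text \<open>
  The distance is measured by the nonnegative integral, so that a difference that is not
  square-integrable has infinite distance (the Bochner integral would give 0).
\<close>

definition L2_converges :: "(nat \<Rightarrow> real \<Rightarrow> complex) \<Rightarrow> (real \<Rightarrow> complex) \<Rightarrow> bool" where
  "L2_converges h f \<longleftrightarrow>
     ((\<lambda>n. \<integral>\<^sup>+ x. ennreal ((cmod (h n x - f x))\<^sup>2) \<partial>lborel) \<longlonglongrightarrow> 0)"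

definition fourier_L1 :: "(real \<Rightarrow> complex) \<Rightarrow> real \<Rightarrow> complex" where
  "fourier_L1 f w =
     (LINT t|lborel. f t * exp (- 2 * complex_of_real pi * \<i> * complex_of_real t * complex_of_real w))"

text \<open>
  The $L^2$ transform is the continuous extension of the integral transform from the dense
  subspace $L^1 \cap L^2$. By Plancherel's theorem the extension exists and is unique up to
  null sets; \<open>fourier_L2\<close> picks a representative.
\<close>

definition is_fourier_L2 :: "(real \<Rightarrow> complex) \<Rightarrow> (real \<Rightarrow> complex) \<Rightarrow> bool" where
  "is_fourier_L2 f F \<longleftrightarrow> F \<in> L2 \<and>
     (\<forall>h. (\<forall>n. h n \<in> L2 \<and> integrable lborel (h n)) \<and> L2_converges h f \<longrightarrow>
          L2_converges (\<lambda>n. fourier_L1 (h n)) F)"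

definition fourier_L2 :: "(real \<Rightarrow> complex) \<Rightarrow> real \<Rightarrow> complex" where
  "fourier_L2 f = (SOME F. is_fourier_L2 f F)"

definition tight_frame :: "real \<Rightarrow> 'i set \<Rightarrow> ('i \<Rightarrow> real \<Rightarrow> complex) \<Rightarrow> bool" where
  "tight_frame A I e \<longleftrightarrow> A > 0 \<and> countable I \<and> (\<forall>i\<in>I. e i \<in> L2) \<and>
     (\<forall>f\<in>L2. ((\<lambda>i. (cmod (L2_inner f (e i)))\<^sup>2) has_sum A * (L2_norm f)\<^sup>2) I)"

definition parseval_frame :: "'i set \<Rightarrow> ('i \<Rightarrow> real \<Rightarrow> complex) \<Rightarrow> bool" where
  "parseval_frame I e \<longleftrightarrow> tight_frame 1 I e"

definition gabor :: "(real \<Rightarrow> complex) \<Rightarrow> real \<Rightarrow> real \<Rightarrow> int \<times> int \<Rightarrow> real \<Rightarrow> complex" where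
  "gabor \<phi> \<alpha> \<beta> = (\<lambda>(j, m) x.
     \<phi> (x - \<beta> * of_int j) * exp (2 * complex_of_real pi * \<i> * complex_of_real (\<alpha> * of_int m * x)))"

definition wilson :: "(real \<Rightarrow> complex) \<Rightarrow> real \<Rightarrow> real \<Rightarrow> int \<times> nat \<Rightarrow> real \<Rightarrow> complex" where
  "wilson \<phi> \<alpha> \<beta> = (\<lambda>(j, m) x.
     if m = 0 then complex_of_real (sqrt (2 * \<beta>)) * gabor \<phi> \<alpha> \<beta> (2 * j, 0) x
     else complex_of_real (sqrt \<beta>) *
       (exp (- 2 * complex_of_real pi * \<i> * complex_of_real (\<beta> * of_int j * \<alpha> * of_nat m))
          * gabor \<phi> \<alpha> \<beta> (j, int m) x
        + (-1) powi (j + int m)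
          * exp (2 * complex_of_real pi * \<i> * complex_of_real (\<beta> * of_int j * \<alpha> * of_nat m))
          * gabor \<phi> \<alpha> \<beta> (j, - int m) x))"

text \<open>
  For \<open>\<phi> \<in> L2\<close> and \<open>\<alpha> > 0\<close> the series converges absolutely for almost every \<open>\<xi>\<close>, by
  Cauchy-Schwarz and the integrability over a period of the $\alpha$-periodization of
  $|\hat\phi|^2$; the value 0 of \<open>infsum\<close> for non-summable families thus
  matters only on a null set.
\<close>

definition Delta :: "(real \<Rightarrow> complex) \<Rightarrow> real \<Rightarrow> real \<Rightarrow> int \<Rightarrow> real \<Rightarrow> complex" where
  "Delta \<phi> \<alpha> \<beta> k \<xi> =
     (\<Sum>\<^sub>\<infinity>m\<in>(UNIV :: int set). (-1) powi m
        * fourier_L2 \<phi> (\<xi> + \<alpha> * of_int m)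
        * cnj (fourier_L2 \<phi> (\<xi> + inverse \<beta> * (of_int k + 1 / 2) - \<alpha> * of_int m)))"

end

theory Submission
  imports Defs "HOL-Probability.Probability"
begin

text \<open>
  With the Gabor coefficients normalized by a phase, the Wilson coefficients at \<open>(j, m)\<close> are
  \<open>c (j, m) + (-1) ^ (j + m) * c (j, -m)\<close> up to a constant. Their squares sum to \<open>\<beta> * (G f + Q f)\<close>, where
  \<open>G f\<close> is the sum of the squared Gabor coefficients and \<open>Q f\<close> collects the cross terms.
  Translating \<open>f\<close> by \<open>\<beta>\<close> fixes \<open>G\<close> and the norm but changes the sign of \<open>Q\<close>, so the Wilson system is
  a Parseval frame iff the Gabor system is tight with bound \<open>1 / \<beta>\<close> and \<open>Q\<close> vanishes. For inverse
  Fourier transforms of bounded \<open>h\<close> and \<open>g\<close> supported in suitable intervals of length \<open>1 / \<beta>\<close>,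
  Parseval's identity in \<open>j\<close> turns the polarized \<open>Q\<close> into
  \<open>1 / \<beta>\<close> times the integral of \<open>h w * cnj (g (w + (k + 1/2) / \<beta>)) * cnj (Delta_k w)\<close>, so \<open>Q = 0\<close> is
  equivalent to the vanishing of all \<open>Delta_k\<close>.
\<close>

section \<open>Square-integrable functions\<close>

text \<open>The half-integer shift in \<open>Delta\<close> is the sign \<open>(-1) ^ j\<close> seen
  on the frequency side. Sampled at the points \<open>\<beta> * j\<close>, this sign is a character
  whose frequency is determined only modulo \<open>1 / \<beta>\<close>, so a translation by
  \<open>(k + 1/2) / \<beta>\<close> absorbs it for every integer \<open>k\<close>. One form
  \<open>Q\<close> thus encodes all the \<open>Delta_k\<close>; which of them appears depends on the
  relative position of the supports of \<open>h\<close> and \<open>g\<close>. The length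
  \<open>1 / \<beta>\<close> is the one for which the samples at \<open>\<beta> * j\<close> are a
  complete set of Fourier coefficients, and cells of half that length can be paired so that an
  admissible shift always brings both into one such interval. The obstacle is convergence:
  \<open>Q\<close> is known to converge absolutely only when the squared Gabor coefficients are
  summable. From Wilson to Gabor the sign change is therefore applied to individual coefficients,
  before \<open>Q\<close> is available as a form. Once tightness holds, Cauchy-Schwarz bounds
  \<open>Q\<close> on L2, so that its vanishing extends from a dense class, and absolute convergence
  permits exchanging the sums over \<open>j\<close> and \<open>m\<close>.\<close>

lemma borel_measurable_cnj [measurable]: "cnj \<in> borel_measurable borel"
  by (intro borel_measurable_continuous_onI continuous_intros)

lemma L2_borel [measurable_dest]: "f \<in> L2 \<Longrightarrow> f \<in> borel_measurable borel"
  by (simp add: L2_def)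

lemma L2_integrable_sq: "f \<in> L2 \<Longrightarrow> integrable lborel (\<lambda>x. (cmod (f x))\<^sup>2)"
  by (simp add: L2_def)

lemma L2_norm_nonneg [simp]: "0 \<le> L2_norm f"
  by (simp add: L2_norm_def)

lemma L2_norm_sq: "(L2_norm f)\<^sup>2 = (LINT x|lborel. (cmod (f x))\<^sup>2)"
  by (simp add: L2_norm_def)

lemma L2_nn_integral:
  "f \<in> L2 \<Longrightarrow> (\<integral>\<^sup>+x. ennreal ((cmod (f x))\<^sup>2) \<partial>lborel) = ennreal ((L2_norm f)\<^sup>2)"
  by (simp add: L2_norm_sq L2_integrable_sq nn_integral_eq_integral)

lemma L2I_nn_integral:
  assumes "f \<in> borel_measurable borel" "(\<integral>\<^sup>+x. ennreal ((cmod (f x))\<^sup>2) \<partial>lborel) < \<infinity>"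
  shows "f \<in> L2"
  using assms by (auto simp: L2_def integrable_iff_bounded)

lemma L2_add:
  assumes "f \<in> L2" "g \<in> L2"
  shows "(\<lambda>x. f x + g x) \<in> L2"
proof -
  note [measurable] = L2_borel[OF assms(1)] L2_borel[OF assms(2)]
  have *: "(cmod (f x + g x))\<^sup>2 \<le> 2 * (cmod (f x))\<^sup>2 + 2 * (cmod (g x))\<^sup>2" for x
  proof -
    have "(cmod (f x + g x))\<^sup>2 \<le> (cmod (f x) + cmod (g x))\<^sup>2"
      by (intro power_mono norm_triangle_ineq) auto
    also have "\<dots> \<le> 2 * (cmod (f x))\<^sup>2 + 2 * (cmod (g x))\<^sup>2"
      using sum_squares_bound[of "cmod (f x)" "cmod (g x)"] by (simp add: power2_sum)
    finally show ?thesis .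
  qed
  have "integrable lborel (\<lambda>x. 2 * (cmod (f x))\<^sup>2 + 2 * (cmod (g x))\<^sup>2)"
    using assms by (simp add: L2_integrable_sq)
  then have "integrable lborel (\<lambda>x. (cmod (f x + g x))\<^sup>2)"
    by (rule Bochner_Integration.integrable_bound) (use * in auto)
  then show ?thesis
    by (simp add: L2_def)
qed

lemma L2_bounded_mult:
  assumes "f \<in> L2" "b \<in> borel_measurable borel" "\<And>x. cmod (b x) \<le> B"
  shows "(\<lambda>x. b x * f x) \<in> L2"
proof -
  note [measurable] = L2_borel[OF assms(1)] assms(2)
  have "integrable lborel (\<lambda>x. B\<^sup>2 * (cmod (f x))\<^sup>2)"
    using assms by (simp add: L2_integrable_sq)
  then have "integrable lborel (\<lambda>x. (cmod (b x * f x))\<^sup>2)"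
    by (rule Bochner_Integration.integrable_bound)
      (auto simp: norm_mult power_mult_distrib intro!: mult_right_mono power_mono assms(3))
  then show ?thesis
    by (simp add: L2_def)
qed

lemma L2_cmult: "f \<in> L2 \<Longrightarrow> (\<lambda>x. c * f x) \<in> L2"
  by (rule L2_bounded_mult[where B = "cmod c"]) auto

lemma L2_diff: "f \<in> L2 \<Longrightarrow> g \<in> L2 \<Longrightarrow> (\<lambda>x. f x - g x) \<in> L2"
  using L2_add[of f "\<lambda>x. (-1) * g x"] L2_cmult[of g "-1"] by simp

lemma L2_zero [simp]: "(\<lambda>x. 0) \<in> L2"
  by (simp add: L2_def)

lemma L2_cnj: "f \<in> L2 \<Longrightarrow> (\<lambda>x. cnj (f x)) \<in> L2"
  using measurable_compose[OF _ borel_measurable_cnj] by (auto simp: L2_def)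

lemma L2_sum: "finite A \<Longrightarrow> (\<And>a. a \<in> A \<Longrightarrow> f a \<in> L2) \<Longrightarrow> (\<lambda>x. \<Sum>a\<in>A. f a x) \<in> L2"
  by (induction A rule: finite_induct) (auto intro!: L2_add)

lemma L2_affine:
  assumes "f \<in> L2" "c \<noteq> 0"
  shows "(\<lambda>x. f (t + c * x)) \<in> L2"
proof -
  note [measurable] = L2_borel[OF assms(1)]
  show ?thesis
    using lborel_integrable_real_affine[OF L2_integrable_sq[OF assms(1)] assms(2), of t]
    by (simp add: L2_def)
qed

lemma L2_translate: "f \<in> L2 \<Longrightarrow> (\<lambda>x. f (x + t)) \<in> L2"
  using L2_affine[of f 1 t] by (simp add: add.commute)

lemma L2_bounded_support:
  assumes [measurable]: "h \<in> borel_measurable borel"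
    and "\<And>x. cmod (h x) \<le> M" "\<And>x. x \<notin> {a..b} \<Longrightarrow> h x = 0"
  shows "h \<in> L2" "integrable lborel h"
proof -
  have M: "0 \<le> M"
    using assms(2)[of 0] norm_ge_zero order_trans by blast
  have *: "integrable lborel (\<lambda>x. C * indicator {a..b} x :: real)" for C
    by (intro integrable_mult_right integrable_real_indicator) (auto simp: emeasure_lborel_Icc_eq)
  show "integrable lborel h"
    by (rule Bochner_Integration.integrable_bound[OF *[of M]])
      (use assms M in \<open>auto simp: indicator_def\<close>)
  have "integrable lborel (\<lambda>x. (cmod (h x))\<^sup>2)"
    by (rule Bochner_Integration.integrable_bound[OF *[of "M\<^sup>2"]])
      (use assms M in \<open>auto simp: indicator_def intro!: power_mono\<close>)
  then show "h \<in> L2"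
    by (simp add: L2_def)
qed

section \<open>Inner product, norm and convergence in L2\<close>

lemma L2_integrable_mult:
  assumes "f \<in> L2" "g \<in> L2"
  shows "integrable lborel (\<lambda>x. f x * g x)"
proof -
  note [measurable] = L2_borel[OF assms(1)] L2_borel[OF assms(2)]
  have "integrable lborel (\<lambda>x. (cmod (f x))\<^sup>2 + (cmod (g x))\<^sup>2)"
    using assms by (simp add: L2_integrable_sq)
  then show ?thesis
  proof (rule Bochner_Integration.integrable_bound)
    show "AE x in lborel. norm (f x * g x) \<le> norm ((cmod (f x))\<^sup>2 + (cmod (g x))\<^sup>2)"
    proof (rule AE_I2)
      fix x
      have "2 * (cmod (f x) * cmod (g x)) \<le> (cmod (f x))\<^sup>2 + (cmod (g x))\<^sup>2"
        using sum_squares_bound[of "cmod (f x)" "cmod (g x)"] by simp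
      moreover have "0 \<le> cmod (f x) * cmod (g x)"
        by simp
      ultimately show "norm (f x * g x) \<le> norm ((cmod (f x))\<^sup>2 + (cmod (g x))\<^sup>2)"
        unfolding norm_mult by (smt (verit) real_norm_def)
    qed
  qed measurable
qed

lemma L2_inner_integrable:
  "f \<in> L2 \<Longrightarrow> g \<in> L2 \<Longrightarrow> integrable lborel (\<lambda>x. f x * cnj (g x))"
  using L2_integrable_mult L2_cnj by blast

lemma L2_inner_add_left:
  "f \<in> L2 \<Longrightarrow> g \<in> L2 \<Longrightarrow> k \<in> L2 \<Longrightarrow>
    L2_inner (\<lambda>x. f x + g x) k = L2_inner f k + L2_inner g k"
  unfolding L2_inner_def distrib_right
  by (intro Bochner_Integration.integral_add L2_inner_integrable)

lemma L2_inner_diff_left: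
  "f \<in> L2 \<Longrightarrow> g \<in> L2 \<Longrightarrow> k \<in> L2 \<Longrightarrow>
    L2_inner (\<lambda>x. f x - g x) k = L2_inner f k - L2_inner g k"
  unfolding L2_inner_def left_diff_distrib
  by (intro Bochner_Integration.integral_diff L2_inner_integrable)

lemma L2_inner_add_right:
  "f \<in> L2 \<Longrightarrow> g \<in> L2 \<Longrightarrow> k \<in> L2 \<Longrightarrow>
    L2_inner k (\<lambda>x. f x + g x) = L2_inner k f + L2_inner k g"
  unfolding L2_inner_def complex_cnj_add distrib_left
  by (intro Bochner_Integration.integral_add L2_inner_integrable)

lemma L2_inner_cmult_left: "L2_inner (\<lambda>x. c * f x) g = c * L2_inner f g"
  by (simp add: L2_inner_def mult.assoc)

lemma L2_inner_cmult_right: "L2_inner f (\<lambda>x. c * g x) = cnj c * L2_inner f g"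
  by (simp add: L2_inner_def mult.left_commute)

lemma L2_inner_commute: "L2_inner g f = cnj (L2_inner f g)"
proof -
  have "cnj (LINT x|lborel. f x * cnj (g x)) = (LINT x|lborel. cnj (f x * cnj (g x)))"
    by (rule Bochner_Integration.integral_cnj[symmetric])
  then show ?thesis
    by (simp add: L2_inner_def mult.commute)
qed

lemma L2_inner_self: "L2_inner f f = of_real ((L2_norm f)\<^sup>2)"
  unfolding L2_inner_def L2_norm_sq integral_complex_of_real[symmetric]
  by (intro Bochner_Integration.integral_cong refl) (simp flip: complex_norm_square)

lemma L2_norm_add_sq:
  assumes "f \<in> L2" "g \<in> L2"
  shows "(L2_norm (\<lambda>x. f x + g x))\<^sup>2 = (L2_norm f)\<^sup>2 + (L2_norm g)\<^sup>2 + 2 * Re (L2_inner f g)"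
proof -
  have "complex_of_real ((L2_norm (\<lambda>x. f x + g x))\<^sup>2) = L2_inner (\<lambda>x. f x + g x) (\<lambda>x. f x + g x)"
    by (rule L2_inner_self[symmetric])
  also have "\<dots> = L2_inner f f + L2_inner g f + (L2_inner f g + L2_inner g g)"
    using assms L2_add[OF assms] by (simp add: L2_inner_add_left L2_inner_add_right)
  finally have "Re (complex_of_real ((L2_norm (\<lambda>x. f x + g x))\<^sup>2)) =
      Re (L2_inner f f + L2_inner g f + (L2_inner f g + L2_inner g g))"
    by simp
  then show ?thesis
    by (simp add: L2_inner_self L2_inner_commute[of g f])
qed

lemma L2_norm_cmult: "L2_norm (\<lambda>x. c * f x) = cmod c * L2_norm f"
  by (simp add: L2_norm_def norm_mult power_mult_distrib real_sqrt_mult)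

lemma L2_norm_diff_sq:
  assumes "f \<in> L2" "g \<in> L2"
  shows "(L2_norm (\<lambda>x. f x - g x))\<^sup>2 = (L2_norm f)\<^sup>2 + (L2_norm g)\<^sup>2 - 2 * Re (L2_inner f g)"
  using L2_norm_add_sq[OF assms(1) L2_cmult[OF assms(2), of "-1"]]
    L2_inner_cmult_right[of f "-1" g] L2_norm_cmult[of "-1" g] by simp

lemma L2_norm_minus: "L2_norm (\<lambda>x. f x - g x) = L2_norm (\<lambda>x. g x - f x)"
  by (simp add: L2_norm_def norm_minus_commute)

lemma L2_Cauchy_Schwarz:
  assumes "f \<in> L2" "g \<in> L2"
  shows "cmod (L2_inner f g) \<le> L2_norm f * L2_norm g"
proof -
  let ?c = "L2_inner f g" and ?a = "L2_norm f" and ?b = "L2_norm g"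
  have key: "0 \<le> ?a\<^sup>2 + t\<^sup>2 * (cmod ?c)\<^sup>2 * ?b\<^sup>2 - 2 * t * (cmod ?c)\<^sup>2" for t :: real
  proof -
    have "0 \<le> (L2_norm (\<lambda>x. f x - (t * ?c) * g x))\<^sup>2"
      by simp
    also have "\<dots> = ?a\<^sup>2 + (cmod (t * ?c) * ?b)\<^sup>2 - 2 * Re (cnj (t * ?c) * ?c)"
      using assms by (simp only: L2_norm_diff_sq L2_cmult L2_norm_cmult L2_inner_cmult_right)
    also have "cnj (t * ?c) * ?c = of_real (t * (cmod ?c)\<^sup>2)"
      unfolding of_real_mult complex_norm_square by (simp add: mult_ac)
    finally show ?thesis
      by (simp add: norm_mult power_mult_distrib)
  qed
  have "(cmod ?c)\<^sup>2 \<le> ?a\<^sup>2 * ?b\<^sup>2"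
  proof (cases "?b = 0")
    \<comment> \<open>The quadratic in \<open>key\<close> is minimal at
      \<open>t = 1 / (?b * ?b)\<close>.\<close>
    case False
    then have "0 < ?b\<^sup>2" by simp
    then have "(1 / ?b\<^sup>2)\<^sup>2 * (cmod ?c)\<^sup>2 * ?b\<^sup>2 = (cmod ?c)\<^sup>2 / ?b\<^sup>2"
      by (simp add: power2_eq_square)
    then have "(cmod ?c)\<^sup>2 / ?b\<^sup>2 \<le> ?a\<^sup>2"
      using key[of "1 / ?b\<^sup>2"] by simp
    then show ?thesis
      using \<open>0 < ?b\<^sup>2\<close> by (simp add: pos_divide_le_eq)
  next
    case True
    \<comment> \<open>For \<open>?b = 0\<close> the quadratic degenerates to an affine function of
      \<open>t\<close> with slope \<open>-2\<close> times the square of \<open>cmod ?c\<close>; a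
      nonzero slope would let a large \<open>t\<close> make it negative. The chosen \<open>t\<close>
      gives exactly \<open>s - 2 * (s + 1)\<close>, where \<open>s\<close> is the square of
      \<open>?a\<close>.\<close>
    have contra: False if "0 \<le> s - 2 * (s + 1)" "0 \<le> s" for s :: real
      using that by (simp add: algebra_simps)
    have "(cmod ?c)\<^sup>2 = 0"
    proof (rule ccontr)
      assume nz: "(cmod ?c)\<^sup>2 \<noteq> 0"
      have "(?a\<^sup>2 + 1) / (cmod ?c)\<^sup>2 * (cmod ?c)\<^sup>2 = ?a\<^sup>2 + 1"
        using nz by simp
      then have "0 \<le> ?a\<^sup>2 - 2 * (?a\<^sup>2 + 1)"
        using key[of "(?a\<^sup>2 + 1) / (cmod ?c)\<^sup>2"] True by (simp only: mult.assoc) (simp split: if_splits)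
      then show False
        using contra zero_le_power2[of ?a] by blast
    qed
    then show ?thesis by (simp add: True)
  qed
  then have "(cmod ?c)\<^sup>2 \<le> (?a * ?b)\<^sup>2"
    by (simp add: power_mult_distrib)
  then show ?thesis
    by (rule power2_le_imp_le) simp
qed

lemma L2_norm_triangle:
  assumes "f \<in> L2" "g \<in> L2"
  shows "L2_norm (\<lambda>x. f x + g x) \<le> L2_norm f + L2_norm g"
proof (rule power2_le_imp_le)
  have "Re (L2_inner f g) \<le> L2_norm f * L2_norm g"
    using L2_Cauchy_Schwarz[OF assms] complex_Re_le_cmod order_trans by blast
  then show "(L2_norm (\<lambda>x. f x + g x))\<^sup>2 \<le> (L2_norm f + L2_norm g)\<^sup>2"
    by (simp add: L2_norm_add_sq[OF assms] power2_sum)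
qed simp

lemma L2_norm_triangle_diff:
  assumes "f \<in> L2" "g \<in> L2" "k \<in> L2"
  shows "L2_norm (\<lambda>x. f x - k x) \<le> L2_norm (\<lambda>x. f x - g x) + L2_norm (\<lambda>x. g x - k x)"
  using L2_norm_triangle[OF L2_diff[OF assms(1,2)] L2_diff[OF assms(2,3)]] by simp

lemma L2_norm_diff_le:
  assumes "f \<in> L2" "g \<in> L2"
  shows "\<bar>L2_norm f - L2_norm g\<bar> \<le> L2_norm (\<lambda>x. f x - g x)"
  using L2_norm_triangle[OF assms(2) L2_diff[OF assms]] L2_norm_triangle[OF assms(1) L2_diff[OF assms(2,1)]]
    L2_norm_minus[of f g] by simp

lemma L2_converges_iff:
  assumes "\<And>n. h n \<in> L2" "f \<in> L2"
  shows "L2_converges h f \<longleftrightarrow> (\<lambda>n. L2_norm (\<lambda>x. h n x - f x)) \<longlonglongrightarrow> 0"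
proof -
  have "L2_converges h f \<longleftrightarrow> (\<lambda>n. ennreal ((L2_norm (\<lambda>x. h n x - f x))\<^sup>2)) \<longlonglongrightarrow> ennreal 0"
    unfolding L2_converges_def using assms by (simp add: L2_nn_integral L2_diff)
  also have "\<dots> \<longleftrightarrow> (\<lambda>n. (L2_norm (\<lambda>x. h n x - f x))\<^sup>2) \<longlonglongrightarrow> 0"
    by (subst tendsto_ennreal_iff) auto
  also have "\<dots> \<longleftrightarrow> (\<lambda>n. L2_norm (\<lambda>x. h n x - f x)) \<longlonglongrightarrow> 0"
  proof
    assume "(\<lambda>n. (L2_norm (\<lambda>x. h n x - f x))\<^sup>2) \<longlonglongrightarrow> 0"
    from tendsto_real_sqrt[OF this] show "(\<lambda>n. L2_norm (\<lambda>x. h n x - f x)) \<longlonglongrightarrow> 0"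
      by simp
  qed (use tendsto_power[of _ 0 _ 2] in fastforce)
  finally show ?thesis .
qed

lemma L2_converges_norm:
  assumes "\<And>n. h n \<in> L2" "f \<in> L2" "L2_converges h f"
  shows "(\<lambda>n. L2_norm (h n)) \<longlonglongrightarrow> L2_norm f"
proof (rule LIM_zero_cancel, rule tendsto_0_le[where K = 1])
  show "(\<lambda>n. L2_norm (\<lambda>x. h n x - f x)) \<longlonglongrightarrow> 0"
    using assms by (simp add: L2_converges_iff)
qed (use assms L2_norm_diff_le in auto)

lemma L2_converges_inner:
  assumes "\<And>n. h n \<in> L2" "f \<in> L2" "L2_converges h f" "g \<in> L2"
  shows "(\<lambda>n. L2_inner (h n) g) \<longlonglongrightarrow> L2_inner f g"
proof (rule LIM_zero_cancel, rule tendsto_0_le[where K = "L2_norm g"])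
  show "(\<lambda>n. L2_norm (\<lambda>x. h n x - f x)) \<longlonglongrightarrow> 0"
    using assms by (simp add: L2_converges_iff)
  show "\<forall>\<^sub>F n in sequentially. norm (L2_inner (h n) g - L2_inner f g)
      \<le> norm (L2_norm (\<lambda>x. h n x - f x)) * L2_norm g"
    using assms L2_Cauchy_Schwarz[OF L2_diff[OF assms(1,2)] assms(4)]
    by (simp add: L2_inner_diff_left)
qed

text \<open>Cutting height and support at once makes every truncation bounded with bounded support.
  It is then both integrable and square-integrable, and falls under the special case of Plancherel's
  theorem proved first.\<close>

definition L2_trunc :: "(real \<Rightarrow> complex) \<Rightarrow> nat \<Rightarrow> real \<Rightarrow> complex" where
  "L2_trunc f n x = (if cmod (f x) \<le> real n \<and> \<bar>x\<bar> \<le> real n then f x else 0)"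

lemma L2_truncation:
  assumes "f \<in> L2"
  shows "L2_trunc f n \<in> L2" "integrable lborel (L2_trunc f n)"
    "L2_trunc f n \<in> borel_measurable borel" "L2_converges (L2_trunc f) f"
proof -
  note [measurable] = L2_borel[OF assms(1)]
  show m: "L2_trunc f n \<in> borel_measurable borel" for n
    unfolding L2_trunc_def[abs_def] by measurable
  show i: "L2_trunc f n \<in> L2" "integrable lborel (L2_trunc f n)" for n
    by (rule L2_bounded_support[where M = n and a = "-n" and b = n, OF m]; auto simp: L2_trunc_def)+
  show "L2_converges (L2_trunc f) f"
  proof -
    have "(\<lambda>n. \<integral>\<^sup>+x. ennreal ((cmod (L2_trunc f n x - f x))\<^sup>2) \<partial>lborel) \<longlonglongrightarrow> (\<integral>\<^sup>+x. 0 \<partial>(lborel :: real measure))"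
    proof (rule nn_integral_dominated_convergence[where w = "\<lambda>x. ennreal ((cmod (f x))\<^sup>2)"])
      show "(\<integral>\<^sup>+x. ennreal ((cmod (f x))\<^sup>2) \<partial>lborel) < \<infinity>"
        by (simp add: L2_nn_integral assms)
      show "AE x in lborel. ennreal ((cmod (L2_trunc f n x - f x))\<^sup>2) \<le> ennreal ((cmod (f x))\<^sup>2)" for n
        by (auto simp: L2_trunc_def)
      show "AE x in lborel. (\<lambda>n. ennreal ((cmod (L2_trunc f n x - f x))\<^sup>2)) \<longlonglongrightarrow> 0"
      proof (rule AE_I2)
        fix x
        obtain N where N: "max (cmod (f x)) \<bar>x\<bar> \<le> real N"
          using real_arch_simple by blast
        have "\<forall>\<^sub>F n in sequentially. ennreal ((cmod (L2_trunc f n x - f x))\<^sup>2) = 0"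
          using eventually_ge_at_top[of N] by eventually_elim (use N in \<open>auto simp: L2_trunc_def\<close>)
        then show "(\<lambda>n. ennreal ((cmod (L2_trunc f n x - f x))\<^sup>2)) \<longlonglongrightarrow> 0"
          by (rule tendsto_eventually)
      qed
      show "(\<lambda>x. ennreal ((cmod (L2_trunc f n x - f x))\<^sup>2)) \<in> borel_measurable lborel" for n
        using m by simp
    qed simp_all
    then show ?thesis
      by (simp add: L2_converges_def)
  qed
qed

text \<open>The weights \<open>2 ^ k\<close> replace Minkowski's inequality for infinite sums.\<close>

lemma L2_complete_rapid:
  assumes g: "\<And>n. g n \<in> L2"
    and rapid: "\<And>n. (L2_norm (\<lambda>x. g (Suc n) x - g n x))\<^sup>2 \<le> (1/4) ^ n"
    and cauchy: "\<And>e. e > 0 \<Longrightarrow> \<exists>N. \<forall>m\<ge>N. \<forall>n\<ge>N. L2_norm (\<lambda>x. g m x - g n x) < e"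
  shows "\<exists>F\<in>L2. L2_converges g F"
proof -
  note [measurable] = L2_borel[OF g]
  define d where "d k x = cmod (g (Suc k) x - g k x)" for k x
  have d_meas [measurable]: "d k \<in> borel_measurable borel" for k
    unfolding d_def by measurable
  have "(\<integral>\<^sup>+x. (\<Sum>k. ennreal (2 ^ k * (d k x)\<^sup>2)) \<partial>lborel) = (\<Sum>k. \<integral>\<^sup>+x. ennreal (2 ^ k * (d k x)\<^sup>2) \<partial>lborel)"
    by (intro nn_integral_suminf) measurable
  also have "\<dots> = (\<Sum>k. ennreal (2 ^ k) * (\<integral>\<^sup>+x. ennreal ((d k x)\<^sup>2) \<partial>lborel))"
    by (simp add: ennreal_mult nn_integral_cmult)
  also have "\<dots> = (\<Sum>k. ennreal (2 ^ k) * ennreal ((L2_norm (\<lambda>x. g (Suc k) x - g k x))\<^sup>2))"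
    unfolding d_def by (subst L2_nn_integral) (auto intro!: L2_diff g)
  also have "\<dots> \<le> (\<Sum>k. ennreal ((1/2) ^ k))"
  proof (intro suminf_le allI)
    fix k
    have "2 ^ k * (L2_norm (\<lambda>x. g (Suc k) x - g k x))\<^sup>2 \<le> 2 ^ k * (1/4::real) ^ k"
      by (intro mult_left_mono rapid) auto
    also have "\<dots> = (1/2) ^ k"
      by (simp add: power_mult_distrib[symmetric])
    finally show "ennreal (2 ^ k) * ennreal ((L2_norm (\<lambda>x. g (Suc k) x - g k x))\<^sup>2) \<le> ennreal ((1/2) ^ k)"
      by (simp add: ennreal_mult[symmetric] ennreal_leI)
  qed auto
  also have "\<dots> = ennreal (\<Sum>k. (1/2) ^ k)"
    by (intro suminf_ennreal2) (auto intro!: summable_geometric)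
  also have "\<dots> < \<infinity>"
    by simp
  finally have fin: "(\<integral>\<^sup>+x. (\<Sum>k. ennreal (2 ^ k * (d k x)\<^sup>2)) \<partial>lborel) < \<infinity>" .
  have "AE x in lborel. (\<Sum>k. ennreal (2 ^ k * (d k x)\<^sup>2)) \<noteq> \<infinity>"
    by (rule nn_integral_PInf_AE) (use fin in auto)
  then have conv: "AE x in lborel. convergent (\<lambda>n. g n x)"
  proof (rule AE_mp, intro AE_I2 impI)
    fix x assume "(\<Sum>k. ennreal (2 ^ k * (d k x)\<^sup>2)) \<noteq> \<infinity>"
    then have s1: "summable (\<lambda>k. 2 ^ k * (d k x)\<^sup>2)"
      by (intro summable_suminf_not_top) (auto simp: top_unique)
    have s2: "summable (\<lambda>k. (1/2::real) ^ k)"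
      by (intro summable_geometric) auto
    have "summable (\<lambda>k. 2 ^ k * (d k x)\<^sup>2 + (1/2) ^ k)"
      by (intro summable_add s1 s2)
    then have "summable (\<lambda>k. g (Suc k) x - g k x)"
    proof (rule summable_comparison_test')
      fix k
      have nn: "0 \<le> d k x" by (simp add: d_def)
      \<comment> \<open>Splitting \<open>d k x\<close> with the factors \<open>sqrt (2 ^ k)\<close>
        and \<open>sqrt ((1/2) ^ k)\<close>, whose product is 1, trades the first power for the
        weighted square plus a geometric term.\<close>
      have am: "2 * (sqrt (2 ^ k) * d k x) * sqrt ((1/2) ^ k) \<le> (sqrt (2 ^ k) * d k x)\<^sup>2 + (sqrt ((1/2) ^ k))\<^sup>2"
        by (rule sum_squares_bound)
      have "sqrt (2 ^ k) * sqrt ((1/2) ^ k) = 1"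
        by (simp add: real_sqrt_mult[symmetric] power_mult_distrib[symmetric])
      then have "2 * d k x = 2 * d k x * (sqrt (2 ^ k) * sqrt ((1/2) ^ k))"
        by simp
      also have "\<dots> = 2 * (sqrt (2 ^ k) * d k x) * sqrt ((1/2) ^ k)"
        by (simp only: mult_ac)
      also note am
      also have "(sqrt (2 ^ k) * d k x)\<^sup>2 + (sqrt ((1/2) ^ k))\<^sup>2 = 2 ^ k * (d k x)\<^sup>2 + (1/2) ^ k"
        by (simp add: power_mult_distrib)
      finally have "d k x \<le> 2 ^ k * (d k x)\<^sup>2 + (1/2) ^ k"
        using nn by simp
      then show "norm (g (Suc k) x - g k x) \<le> 2 ^ k * (d k x)\<^sup>2 + (1/2) ^ k"
        by (simp add: d_def)
    qed
    then have "convergent (\<lambda>n. \<Sum>k<n. g (Suc k) x - g k x)"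
      by (simp add: summable_iff_convergent)
    then have "convergent (\<lambda>n. g n x - g 0 x)"
      using sum_lessThan_telescope[of "\<lambda>n. g n x"] by simp
    from convergent_add[OF this convergent_const[of "g 0 x"]] show "convergent (\<lambda>n. g n x)"
      by simp
  qed
  define F where "F x = lim (\<lambda>n. g n x)" for x
  have F_meas [measurable]: "F \<in> borel_measurable borel"
    unfolding F_def by (rule borel_measurable_lim_metric) measurable
  have limF: "AE x in lborel. (\<lambda>n. g n x) \<longlonglongrightarrow> F x"
    using conv by eventually_elim (simp add: F_def convergent_LIMSEQ_iff)
  \<comment> \<open>Letting \<open>m\<close> tend to infinity under the integral serves twice: a
    single \<open>n\<close> with bound 1 puts \<open>F\<close> into L2, and small bounds give
    convergence.\<close>
  have fatou: "(\<integral>\<^sup>+x. ennreal ((cmod (g n x - F x))\<^sup>2) \<partial>lborel) \<le> ennreal e"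
    if "\<And>m. m \<ge> N \<Longrightarrow> (L2_norm (\<lambda>x. g n x - g m x))\<^sup>2 \<le> e" for n N e
  proof -
    have "(\<integral>\<^sup>+x. ennreal ((cmod (g n x - F x))\<^sup>2) \<partial>lborel)
        = (\<integral>\<^sup>+x. liminf (\<lambda>m. ennreal ((cmod (g n x - g m x))\<^sup>2)) \<partial>lborel)"
    proof (rule nn_integral_cong_AE)
      show "AE x in lborel. ennreal ((cmod (g n x - F x))\<^sup>2) = liminf (\<lambda>m. ennreal ((cmod (g n x - g m x))\<^sup>2))"
        using limF
      proof eventually_elim
        case (elim x)
        have "(\<lambda>m. ennreal ((cmod (g n x - g m x))\<^sup>2)) \<longlonglongrightarrow> ennreal ((cmod (g n x - F x))\<^sup>2)"
          by (intro tendsto_intros elim)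
        then show ?case
          by (rule lim_imp_Liminf[OF trivial_limit_sequentially, symmetric])
      qed
    qed
    also have "\<dots> \<le> liminf (\<lambda>m. \<integral>\<^sup>+x. ennreal ((cmod (g n x - g m x))\<^sup>2) \<partial>lborel)"
      by (rule nn_integral_liminf) measurable
    also have "\<dots> \<le> ennreal e"
    proof (rule Liminf_le)
      show "\<forall>\<^sub>F m in sequentially. (\<integral>\<^sup>+x. ennreal ((cmod (g n x - g m x))\<^sup>2) \<partial>lborel) \<le> ennreal e"
        using eventually_ge_at_top[of N]
        by eventually_elim (use that in \<open>simp add: L2_nn_integral L2_diff g ennreal_leI\<close>)
    qed auto
    finally show ?thesis .
  qed
  obtain N1 where N1: "\<And>m n. m \<ge> N1 \<Longrightarrow> n \<ge> N1 \<Longrightarrow> L2_norm (\<lambda>x. g m x - g n x) < 1"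
    using cauchy[of 1] by auto
  have "(\<integral>\<^sup>+x. ennreal ((cmod (g N1 x - F x))\<^sup>2) \<partial>lborel) \<le> ennreal 1"
    by (rule fatou[of N1]) (simp add: N1 less_imp_le power_le_one)
  then have "(\<lambda>x. g N1 x - F x) \<in> L2"
    by (intro L2I_nn_integral) (auto simp: le_less_trans)
  from L2_diff[OF g[of N1] this] have F: "F \<in> L2"
    by simp
  have "L2_converges g F"
    unfolding L2_converges_iff[OF g F]
  proof (rule LIMSEQ_I)
    fix e :: real assume e: "0 < e"
    obtain N where N: "\<And>m n. m \<ge> N \<Longrightarrow> n \<ge> N \<Longrightarrow> L2_norm (\<lambda>x. g m x - g n x) < e / 2"
      using cauchy[of "e / 2"] e by auto
    have "L2_norm (\<lambda>x. g n x - F x) < e" if "n \<ge> N" for n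
    proof -
      have "(\<integral>\<^sup>+x. ennreal ((cmod (g n x - F x))\<^sup>2) \<partial>lborel) \<le> ennreal ((e / 2)\<^sup>2)"
        by (rule fatou[of N]) (intro power_mono less_imp_le[OF N] that L2_norm_nonneg, assumption)
      then have "(L2_norm (\<lambda>x. g n x - F x))\<^sup>2 \<le> (e / 2)\<^sup>2"
        by (simp add: L2_nn_integral L2_diff g F)
      then have "L2_norm (\<lambda>x. g n x - F x) \<le> e / 2"
        by (rule power2_le_imp_le) (use e in auto)
      then show ?thesis
        using e by simp
    qed
    then show "\<exists>no. \<forall>n\<ge>no. norm (L2_norm (\<lambda>x. g n x - F x) - 0) < e"
      by auto
  qed
  with F show ?thesis
    by blast
qed

text \<open>A rapidly converging subsequence has a limit, and a Cauchy sequence follows its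
  subsequence. Completeness is what provides a value for the transform of an arbitrary L2
  function.\<close>

lemma L2_complete:
  assumes g: "\<And>n. g n \<in> L2"
    and cauchy: "\<And>e. e > 0 \<Longrightarrow> \<exists>N. \<forall>m\<ge>N. \<forall>n\<ge>N. L2_norm (\<lambda>x. g m x - g n x) < e"
  shows "\<exists>F\<in>L2. L2_converges g F"
proof -
  have "\<exists>N. \<forall>m\<ge>N. \<forall>n\<ge>N. L2_norm (\<lambda>x. g m x - g n x) < (1/2) ^ k" for k :: nat
    by (rule cauchy) simp
  then obtain N where N: "\<And>k m n. m \<ge> N k \<Longrightarrow> n \<ge> N k \<Longrightarrow> L2_norm (\<lambda>x. g m x - g n x) < (1/2) ^ k"
    by metis
  \<comment> \<open>The partial sums give an index that is monotone, dominates \<open>N k\<close>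
    and tends to infinity, so consecutive terms of the subsequence both lie beyond
    \<open>N k\<close>.\<close>
  define r where "r k = k + (\<Sum>i\<le>k. N i)" for k
  have rN: "N k \<le> r k" for k
    unfolding r_def by (intro trans_le_add2 member_le_sum) auto
  have r_mono: "r k \<le> r l" if "k \<le> l" for k l
    unfolding r_def using that by (intro add_mono sum_mono2) auto
  have rk: "k \<le> r k" for k
    by (simp add: r_def)
  have "\<exists>F\<in>L2. L2_converges (\<lambda>k. g (r k)) F"
  proof (rule L2_complete_rapid)
    fix k
    have "(L2_norm (\<lambda>x. g (r (Suc k)) x - g (r k) x))\<^sup>2 \<le> ((1/2) ^ k)\<^sup>2"
      using rN[of k] r_mono[of k "Suc k"] by (intro power_mono less_imp_le[OF N]) auto
    then show "(L2_norm (\<lambda>x. g (r (Suc k)) x - g (r k) x))\<^sup>2 \<le> (1/4) ^ k"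
      by (simp add: power2_eq_square power_mult_distrib[symmetric])
  next
    fix e :: real assume "e > 0"
    then obtain M where "\<forall>m\<ge>M. \<forall>n\<ge>M. L2_norm (\<lambda>x. g m x - g n x) < e"
      using cauchy by blast
    then show "\<exists>M. \<forall>m\<ge>M. \<forall>n\<ge>M. L2_norm (\<lambda>x. g (r m) x - g (r n) x) < e"
      by (meson order_trans rk)
  qed (rule g)
  then obtain F where F: "F \<in> L2" "L2_converges (\<lambda>k. g (r k)) F"
    by blast
  have "L2_converges g F"
    unfolding L2_converges_iff[OF g F(1)]
  proof (rule LIMSEQ_I)
    fix e :: real assume e: "0 < e"
    obtain M where M: "\<And>m n. m \<ge> M \<Longrightarrow> n \<ge> M \<Longrightarrow> L2_norm (\<lambda>x. g m x - g n x) < e / 2"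
      using cauchy[of "e / 2"] e by auto
    have "(\<lambda>k. L2_norm (\<lambda>x. g (r k) x - F x)) \<longlonglongrightarrow> 0"
      using F g by (simp add: L2_converges_iff)
    from LIMSEQ_D[OF this, of "e / 2"] e obtain K where
      K: "\<And>k. k \<ge> K \<Longrightarrow> L2_norm (\<lambda>x. g (r k) x - F x) < e / 2" by auto
    have "L2_norm (\<lambda>x. g n x - F x) < e" if "n \<ge> M" for n
      using L2_norm_triangle_diff[OF g[of n] g[of "r (max K M)"] F(1)]
        M[OF that, of "r (max K M)"] K[of "max K M"] rk[of "max K M"] by simp
    then show "\<exists>no. \<forall>n\<ge>no. norm (L2_norm (\<lambda>x. g n x - F x) - 0) < e"
      by auto
  qed
  with F show ?thesis
    by blast
qed

section \<open>The Fourier integral and autocorrelations\<close>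

definition unit_exp :: "real \<Rightarrow> complex" where
  "unit_exp t = cis (2 * pi * t)"

lemma norm_unit_exp [simp]: "cmod (unit_exp t) = 1"
  by (simp add: unit_exp_def)

lemma unit_exp_add: "unit_exp (s + t) = unit_exp s * unit_exp t"
  by (simp add: unit_exp_def cis_mult distrib_left)

lemma unit_exp_0 [simp]: "unit_exp 0 = 1"
  by (simp add: unit_exp_def)

lemma unit_exp_int [simp]: "unit_exp (of_int n) = 1"
  by (simp add: unit_exp_def cis_multiple_2pi)

lemma cnj_unit_exp: "cnj (unit_exp t) = unit_exp (- t)"
  by (simp add: unit_exp_def cis_cnj)

lemma exp_conv_unit_exp: "exp (2 * complex_of_real pi * \<i> * complex_of_real t) = unit_exp t"
  by (simp add: unit_exp_def cis_conv_exp mult_ac)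

lemma continuous_on_unit_exp [continuous_intros]:
  "continuous_on S f \<Longrightarrow> continuous_on S (\<lambda>x. unit_exp (f x))"
  unfolding unit_exp_def by (intro continuous_intros)

lemma borel_measurable_unit_exp [measurable]: "unit_exp \<in> borel_measurable borel"
  by (intro borel_measurable_continuous_onI continuous_intros)

lemma fourier_L1_unit_exp: "fourier_L1 f w = (LINT t|lborel. f t * unit_exp (- (t * w)))"
proof -
  have "exp (- 2 * complex_of_real pi * \<i> * complex_of_real t * complex_of_real w) = unit_exp (- (t * w))" for t
    using exp_conv_unit_exp[of "- (t * w)"] by (simp add: mult_ac)
  then show ?thesis
    by (simp add: fourier_L1_def)
qed

lemma integrable_mult_unit_exp:
  assumes "integrable lborel f" "g \<in> borel_measurable borel"
  shows "integrable lborel (\<lambda>x. f x * unit_exp (g x))"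
proof -
  note [measurable] = borel_measurable_integrable[OF assms(1)] assms(2)
  show ?thesis
    by (rule Bochner_Integration.integrable_bound[OF assms(1)]) (auto simp: norm_mult)
qed

lemma fourier_L1_measurable [measurable]:
  assumes [measurable]: "f \<in> borel_measurable borel"
  shows "fourier_L1 f \<in> borel_measurable borel"
  unfolding fourier_L1_unit_exp[abs_def] by measurable

lemma norm_fourier_L1_le: "cmod (fourier_L1 f w) \<le> (LINT x|lborel. cmod (f x))"
  unfolding fourier_L1_unit_exp
  using integral_norm_bound[of lborel "\<lambda>t. f t * unit_exp (- (t * w))"] by (simp add: norm_mult)

lemma fourier_L1_diff:
  assumes "integrable lborel f" "integrable lborel g"
  shows "fourier_L1 (\<lambda>x. f x - g x) w = fourier_L1 f w - fourier_L1 g w"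
  unfolding fourier_L1_unit_exp left_diff_distrib
  using assms by (intro Bochner_Integration.integral_diff integrable_mult_unit_exp) auto

lemma integrable_pair_mult:
  fixes f g :: "real \<Rightarrow> complex"
  assumes "integrable lborel f" "integrable lborel g" "u \<in> borel_measurable (borel \<Otimes>\<^sub>M borel)"
    and "\<And>z. cmod (u z) \<le> 1"
  shows "integrable (lborel \<Otimes>\<^sub>M lborel) (\<lambda>(x, y). f x * g y * u (x, y))"
proof -
  note [measurable] = borel_measurable_integrable[OF assms(1)] borel_measurable_integrable[OF assms(2)] assms(3)
  have i: "integrable (lborel \<Otimes>\<^sub>M lborel) (\<lambda>(x, y). f x * g y)"
  proof (rule lborel_pair.Fubini_integrable)
    show "integrable lborel (\<lambda>x. LINT y|lborel. cmod (case (x, y) of (x, y) \<Rightarrow> f x * g y))"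
      using assms(1) by (simp add: norm_mult)
    show "AE x in lborel. integrable lborel (\<lambda>y. case (x, y) of (x, y) \<Rightarrow> f x * g y)"
      using assms(2) by simp
  qed measurable
  show ?thesis
  proof (rule Bochner_Integration.integrable_bound[OF i])
    show "AE z in lborel \<Otimes>\<^sub>M lborel. cmod (case z of (x, y) \<Rightarrow> f x * g y * u (x, y)) \<le> cmod (case z of (x, y) \<Rightarrow> f x * g y)"
      using assms(4) by (auto simp: norm_mult split: prod.split intro!: AE_I2 mult_left_le)
  qed measurable
qed

text \<open>Fubini, since the kernel is symmetric in time and frequency. It is the only source of
  duality: both the Gaussian summation and the adjoint relation rest on it.\<close>

lemma fourier_L1_exchange:
  assumes f: "integrable lborel f" and g: "integrable lborel g"
  shows "(LINT w|lborel. fourier_L1 f w * g w) = (LINT t|lborel. f t * fourier_L1 g t)"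
proof -
  let ?F = "\<lambda>(t, w). f t * g w * (\<lambda>z. unit_exp (- (fst z * snd z))) (t, w)"
  have i: "integrable (lborel \<Otimes>\<^sub>M lborel) ?F"
    by (rule integrable_pair_mult[OF f g]) auto
  have "fourier_L1 f w * g w = (LINT t|lborel. ?F (t, w))" for w
    unfolding fourier_L1_unit_exp by (subst integral_mult_left_zero[symmetric]) (simp add: mult_ac)
  then have "(LINT w|lborel. fourier_L1 f w * g w) = (LINT w|lborel. LINT t|lborel. ?F (t, w))"
    by simp
  also have "\<dots> = (LINT t|lborel. LINT w|lborel. ?F (t, w))"
    using lborel_pair.Fubini_integral[of "\<lambda>t w. ?F (t, w)"] i by (simp add: split_def)
  also have "\<dots> = (LINT t|lborel. f t * fourier_L1 g t)"
  proof -
    have "(LINT w|lborel. ?F (t, w)) = f t * fourier_L1 g t" for t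
      unfolding fourier_L1_unit_exp by (subst integral_mult_right_zero[symmetric]) (simp add: mult_ac)
    then show ?thesis
      by simp
  qed
  finally show ?thesis .
qed

text \<open>Read off from the characteristic function of the normal distribution. The right-hand
  side is a probability density in \<open>t\<close> that concentrates at 0 as \<open>c\<close>
  grows, that is, an approximate identity.\<close>

lemma fourier_L1_gaussian:
  assumes "c > 0"
  shows "integrable lborel (\<lambda>w. complex_of_real (exp (- (w / c)\<^sup>2 / 2)))"
    "fourier_L1 (\<lambda>w. complex_of_real (exp (- (w / c)\<^sup>2 / 2))) t
      = complex_of_real (2 * pi * c * std_normal_density (2 * pi * c * t))"
proof -
  have nd: "exp (- x\<^sup>2 / 2) = sqrt (2 * pi) * std_normal_density x" for x
    by (simp add: std_normal_density_def)
  have i0: "integrable lborel (\<lambda>x. complex_of_real (std_normal_density x))"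
    by (intro integrable_of_real integrable_normal_density) auto
  have i1: "integrable lborel (\<lambda>x. complex_of_real (exp (- x\<^sup>2 / 2)))"
    unfolding nd of_real_mult by (intro integrable_mult_right i0)
  have "integrable lborel (\<lambda>w. complex_of_real (exp (- (0 + 1 / c * w)\<^sup>2 / 2)))"
    by (rule lborel_integrable_real_affine[OF i1]) (use assms in auto)
  then show "integrable lborel (\<lambda>w. complex_of_real (exp (- (w / c)\<^sup>2 / 2)))"
    by (simp add: mult.commute)
  have "fourier_L1 (\<lambda>w. complex_of_real (exp (- (w / c)\<^sup>2 / 2))) t
      = c * (LINT x|lborel. complex_of_real (exp (- x\<^sup>2 / 2)) * unit_exp (- (c * x * t)))"
    unfolding fourier_L1_unit_exp
    by (subst lborel_integral_real_affine[of c _ 0]) (use assms in \<open>auto simp: scaleR_conv_of_real\<close>)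
  also have "(LINT x|lborel. complex_of_real (exp (- x\<^sup>2 / 2)) * unit_exp (- (c * x * t)))
      = sqrt (2 * pi) * (LINT x|lborel. std_normal_density x *\<^sub>R unit_exp (- (c * x * t)))"
    unfolding nd of_real_mult by (simp add: scaleR_conv_of_real mult.assoc)
  also have "(LINT x|lborel. std_normal_density x *\<^sub>R unit_exp (- (c * x * t)))
      = char std_normal_distribution (- (2 * pi * c * t))"
    unfolding char_def by (subst integral_density) (auto simp: unit_exp_def cis_conv_exp mult_ac)
  also have "\<dots> = exp (- (2 * pi * c * t)\<^sup>2 / 2)"
    by (simp add: char_std_normal_distribution)
  also have "c * (sqrt (2 * pi) * complex_of_real (exp (- (2 * pi * c * t)\<^sup>2 / 2)))
      = complex_of_real (2 * pi * c * std_normal_density (2 * pi * c * t))"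
  proof -
    have "c * (sqrt (2 * pi) * (sqrt (2 * pi) * x)) = 2 * pi * c * x" for x
      using real_sqrt_mult_self[of "2 * pi"] by (simp add: mult.assoc[symmetric])
    then show ?thesis
      unfolding nd of_real_mult[symmetric] by (rule arg_cong)
  qed
  finally show "fourier_L1 (\<lambda>w. complex_of_real (exp (- (w / c)\<^sup>2 / 2))) t
      = complex_of_real (2 * pi * c * std_normal_density (2 * pi * c * t))" .
qed

text \<open>The convolution of \<open>h\<close> with its reflected conjugate. Its transform is the
  squared modulus of the transform of \<open>h\<close> and its value at 0 is the squared norm of
  \<open>h\<close>, so Plancherel's identity becomes Fourier inversion at the single point
  0.\<close>

definition autocorr :: "(real \<Rightarrow> complex) \<Rightarrow> real \<Rightarrow> complex" where
  "autocorr h t = (LINT x|lborel. h (x + t) * cnj (h x))"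

lemma autocorr_measurable [measurable]:
  assumes [measurable]: "h \<in> borel_measurable borel"
  shows "autocorr h \<in> borel_measurable borel"
  unfolding autocorr_def[abs_def] by measurable

lemma norm_autocorr_le:
  assumes "integrable lborel h" "\<And>x. cmod (h x) \<le> M"
  shows "cmod (autocorr h t) \<le> M * (LINT x|lborel. cmod (h x))"
proof -
  note [measurable] = borel_measurable_integrable[OF assms(1)]
  have "cmod (autocorr h t) \<le> (LINT x|lborel. cmod (h (x + t) * cnj (h x)))"
    unfolding autocorr_def by (rule integral_norm_bound)
  also have "\<dots> \<le> (LINT x|lborel. M * cmod (h x))"
  proof (rule integral_mono)
    show i: "integrable lborel (\<lambda>x. M * cmod (h x))"
      using assms by simp
    show "cmod (h (x + t) * cnj (h x)) \<le> M * cmod (h x)" for x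
      by (simp add: norm_mult mult_right_mono assms)
    then show "integrable lborel (\<lambda>x. cmod (h (x + t) * cnj (h x)))"
      by (intro Bochner_Integration.integrable_bound[OF i]) (auto simp: norm_mult intro!: AE_I2 order_trans[OF _ abs_ge_self])
  qed
  finally show ?thesis
    by simp
qed

lemma fourier_L1_autocorr:
  assumes h: "integrable lborel h"
  shows "integrable lborel (autocorr h)"
    "fourier_L1 (autocorr h) w = complex_of_real ((cmod (fourier_L1 h w))\<^sup>2)"
proof -
  note [measurable] = borel_measurable_integrable[OF h]
  have i: "integrable (lborel \<Otimes>\<^sub>M lborel) (\<lambda>(t, x). h (x + t) * cnj (h x))"
  proof -
    have "integrable (lborel \<Otimes>\<^sub>M lborel) (\<lambda>(x, t). h (x + t) * cnj (h x))"
    proof (rule lborel_pair.Fubini_integrable)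
      have "(LINT t|lborel. cmod (h (x + t))) = (LINT t|lborel. cmod (h t))" for x
        using lborel_integral_real_affine[of 1 "\<lambda>t. cmod (h t)" x] by simp
      then show "integrable lborel (\<lambda>x. LINT t|lborel. cmod (case (x, t) of (x, t) \<Rightarrow> h (x + t) * cnj (h x)))"
        using h by (simp add: norm_mult)
      have "integrable lborel (\<lambda>t. h (x + t))" for x
        using lborel_integrable_real_affine[OF h, of 1 x] by simp
      then show "AE x in lborel. integrable lborel (\<lambda>t. case (x, t) of (x, t) \<Rightarrow> h (x + t) * cnj (h x))"
        by simp
    qed measurable
    from lborel_pair.integrable_product_swap[OF this] show ?thesis
      by (simp add: split_def)
  qed
  show "integrable lborel (autocorr h)"
    unfolding autocorr_def[abs_def] using lborel_pair.integrable_fst'[OF i] by simp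
  let ?F = "\<lambda>t x. h (x + t) * cnj (h x) * unit_exp (- (t * w))"
  have i': "integrable (lborel \<Otimes>\<^sub>M lborel) (\<lambda>(t, x). ?F t x)"
    by (rule Bochner_Integration.integrable_bound[OF i]) (auto simp: norm_mult split_def)
  have "fourier_L1 (autocorr h) w = (LINT t|lborel. LINT x|lborel. ?F t x)"
    unfolding fourier_L1_unit_exp autocorr_def by simp
  also have "\<dots> = (LINT x|lborel. LINT t|lborel. ?F t x)"
    using lborel_pair.Fubini_integral[OF i'] by simp
  also have "\<dots> = (LINT x|lborel. fourier_L1 h w * cnj (h x * unit_exp (- (x * w))))"
  proof (rule Bochner_Integration.integral_cong[OF refl])
    fix x
    have "(LINT t|lborel. ?F t x) = (LINT t|lborel. h (x + t) * unit_exp (- ((x + t) * w)) * cnj (h x * unit_exp (- (x * w))))"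
    proof (rule Bochner_Integration.integral_cong[OF refl])
      fix t
      \<comment> \<open>Splitting the phase at \<open>x + t\<close> makes the integral over
        \<open>t\<close> a translate, hence independent of \<open>x\<close>.\<close>
      have "unit_exp (- (t * w)) = unit_exp (- ((x + t) * w)) * unit_exp (x * w)"
        unfolding unit_exp_add[symmetric] by (simp add: algebra_simps)
      then show "?F t x = h (x + t) * unit_exp (- ((x + t) * w)) * cnj (h x * unit_exp (- (x * w)))"
        by (simp add: cnj_unit_exp)
    qed
    also have "\<dots> = (LINT t|lborel. h (x + t) * unit_exp (- ((x + t) * w))) * cnj (h x * unit_exp (- (x * w)))"
      by simp
    also have "(LINT t|lborel. h (x + t) * unit_exp (- ((x + t) * w))) = fourier_L1 h w"
      unfolding fourier_L1_unit_exp
      using lborel_integral_real_affine[of 1 "\<lambda>t. h t * unit_exp (- (t * w))" x] by simp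
    finally show "(LINT t|lborel. ?F t x) = fourier_L1 h w * cnj (h x * unit_exp (- (x * w)))" .
  qed
  also have "\<dots> = fourier_L1 h w * (LINT x|lborel. cnj (h x * unit_exp (- (x * w))))"
    by (rule integral_mult_right_zero)
  also have "\<dots> = fourier_L1 h w * cnj (fourier_L1 h w)"
    unfolding Bochner_Integration.integral_cnj fourier_L1_unit_exp ..
  finally show "fourier_L1 (autocorr h) w = complex_of_real ((cmod (fourier_L1 h w))\<^sup>2)"
    by (simp flip: complex_norm_square)
qed

text \<open>Measurability supplies continuous functions that converge to \<open>h\<close> off a null
  set; projecting their values and cutting off their supports makes dominated convergence
  applicable.\<close>

lemma L1_approx_continuous:
  fixes h :: "real \<Rightarrow> complex"
  assumes [measurable]: "h \<in> borel_measurable borel" and bd: "\<And>x. cmod (h x) \<le> M"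
    and supp: "\<And>x. \<bar>x\<bar> > N \<Longrightarrow> h x = 0" and e: "e > 0"
  shows "\<exists>g. continuous_on UNIV g \<and> (\<forall>x. cmod (g x) \<le> M) \<and> integrable lborel (\<lambda>x. g x - h x)
    \<and> (LINT x|lborel. cmod (g x - h x)) < e"
proof -
  have M: "0 \<le> M"
    using bd[of 0] norm_ge_zero order_trans by blast
  have "h \<in> borel_measurable lebesgue"
    using assms(1) by (simp add: measurable_completion)
  then have "h measurable_on UNIV"
    using lebesgue_measurable_imp_measurable_on[of h UNIV] by simp
  then obtain Z g where Z: "negligible Z" and g: "\<And>n. continuous_on UNIV (g n)"
      and lim: "\<And>x. x \<notin> Z \<Longrightarrow> (\<lambda>n. g n x) \<longlonglongrightarrow> h x"
    by (auto simp: measurable_on_def)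
  \<comment> \<open>\<open>cut\<close> is 1 wherever \<open>\<bar>x\<bar> \<le> N\<close>, and the
    projection onto the ball of radius \<open>M\<close> fixes the values of \<open>h\<close>, so
    neither operation disturbs the limit.\<close>
  define cut :: "real \<Rightarrow> real" where "cut x = max 0 (min 1 (N + 1 - \<bar>x\<bar>))" for x
  define k where "k n x = cut x *\<^sub>R closest_point (cball 0 M) (g n x)" for n x
  have cp: "cmod (closest_point (cball 0 M) z) \<le> M" for z :: complex
    using closest_point_in_set[of "cball (0::complex) M" z] M by simp
  have k_cont: "continuous_on UNIV (k n)" for n
    unfolding k_def cut_def
    by (intro continuous_intros continuous_on_compose2[OF continuous_on_closest_point[of "cball 0 M" UNIV] g])
      (use M in auto)
  have k_bd: "cmod (k n x) \<le> M" for n x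
    using mult_mono[of "\<bar>cut x\<bar>" 1 _ M, OF _ cp[of "g n x"]] by (simp add: k_def cut_def)
  have k_supp: "k n x = 0" if "\<bar>x\<bar> > N + 1" for n x
    using that by (simp add: k_def cut_def)
  have k_lim: "(\<lambda>n. k n x) \<longlonglongrightarrow> h x" if "x \<notin> Z" for x
  proof -
    have "isCont (closest_point (cball 0 M)) (h x)"
      using continuous_at_closest_point[of "cball (0::complex) M"] M by auto
    from isCont_tendsto_compose[OF this lim[OF that]]
    have "(\<lambda>n. closest_point (cball 0 M) (g n x)) \<longlonglongrightarrow> h x"
      using bd[of x] by (simp add: closest_point_self)
    from tendsto_scaleR[OF tendsto_const this] have "(\<lambda>n. k n x) \<longlonglongrightarrow> cut x *\<^sub>R h x"
      by (simp add: k_def)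
    moreover have "cut x *\<^sub>R h x = h x"
      using supp[of x] by (cases "\<bar>x\<bar> > N") (auto simp: cut_def)
    ultimately show ?thesis by simp
  qed
  have [measurable]: "k n \<in> borel_measurable borel" for n
    by (rule borel_measurable_continuous_onI[OF k_cont])
  have Z_AE: "AE x in lborel. x \<notin> Z"
    using Z AE_not_in[of Z lebesgue] unfolding negligible_iff_null_sets
    by (simp add: AE_completion_iff)
  let ?w = "\<lambda>x. (2 * M) * indicator {-(\<bar>N\<bar>+1)..\<bar>N\<bar>+1} x :: real"
  have w: "integrable lborel ?w"
    by (intro integrable_mult_right integrable_real_indicator) (auto simp: emeasure_lborel_Icc_eq)
  have kw: "cmod (k n x - h x) \<le> ?w x" for n x
  proof (cases "\<bar>x\<bar> \<le> \<bar>N\<bar> + 1")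
    case True
    then show ?thesis
      using norm_triangle_ineq4[of "k n x" "h x"] k_bd[of n x] bd[of x] by (simp add: indicator_def abs_le_iff)
  next
    case False
    then show ?thesis
      using k_supp[of x n] supp[of x] by (simp add: indicator_def M)
  qed
  have "(\<lambda>n. LINT x|lborel. cmod (k n x - h x)) \<longlonglongrightarrow> (LINT x|(lborel::real measure). 0)"
  proof (rule integral_dominated_convergence[OF _ _ w])
    show "AE x in lborel. (\<lambda>n. cmod (k n x - h x)) \<longlonglongrightarrow> 0"
      using Z_AE by eventually_elim (use k_lim in \<open>auto intro!: tendsto_norm_zero LIM_zero\<close>)
    show "AE x in lborel. norm (cmod (k n x - h x)) \<le> ?w x" for n
      using kw by simp
  qed measurable
  then have "\<forall>\<^sub>F n in sequentially. (LINT x|lborel. cmod (k n x - h x)) < e"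
    using e by (intro order_tendstoD(2)) auto
  then obtain n where n: "(LINT x|lborel. cmod (k n x - h x)) < e"
    by (auto simp: eventually_sequentially)
  have "integrable lborel (\<lambda>x. k n x - h x)"
    by (rule Bochner_Integration.integrable_bound[OF w]) (use kw in \<open>auto intro!: AE_I2 order_trans[OF _ abs_ge_self]\<close>)
  with n k_cont k_bd show ?thesis
    by blast
qed

text \<open>Only the translated factor is replaced by a continuous function. By translation
  invariance the L1 error is the same for every shift, so the approximation is uniform and
  continuity at 0 is inherited.\<close>

lemma autocorr_tendsto:
  assumes [measurable]: "h \<in> borel_measurable borel" and bd: "\<And>x. cmod (h x) \<le> M"
    and supp: "\<And>x. \<bar>x\<bar> > N \<Longrightarrow> h x = 0" and t: "t \<longlonglongrightarrow> 0"
  shows "(\<lambda>n. autocorr h (t n)) \<longlonglongrightarrow> autocorr h 0"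
proof (rule LIMSEQ_I)
  fix e :: real assume e: "0 < e"
  have h: "integrable lborel h"
    by (rule L2_bounded_support[of h M "-\<bar>N\<bar>" "\<bar>N\<bar>"]) (use bd supp in auto)
  have M: "0 \<le> M"
    using bd[of 0] norm_ge_zero order_trans by blast
  \<comment> \<open>The untouched factor contributes at most \<open>M\<close>; writing
    \<open>M + 1\<close> covers \<open>M = 0\<close>. The quarters leave room for two approximation
    errors and one limit error.\<close>
  have e': "e / (4 * (M + 1)) > 0"
    using e M by simp
  obtain g where g: "continuous_on UNIV g" "\<And>x. cmod (g x) \<le> M" "integrable lborel (\<lambda>x. g x - h x)"
      and gh: "(LINT x|lborel. cmod (g x - h x)) < e / (4 * (M + 1))"
    using L1_approx_continuous[OF assms(1) bd supp e'] by blast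
  have [measurable]: "g \<in> borel_measurable borel"
    by (rule borel_measurable_continuous_onI[OF g(1)])
  define B where "B s = (LINT x|lborel. g (x + s) * cnj (h x))" for s
  have ig: "integrable lborel (\<lambda>x. g (x + s) * cnj (h x))" for s
    by (rule Bochner_Integration.integrable_bound[of _ "\<lambda>x. M * cmod (h x)"])
      (use h g(2) M in \<open>auto simp: norm_mult intro!: mult_right_mono\<close>)
  have ih: "integrable lborel (\<lambda>x. h (x + s) * cnj (h x))" for s
    by (rule Bochner_Integration.integrable_bound[of _ "\<lambda>x. M * cmod (h x)"])
      (use h bd M in \<open>auto simp: norm_mult intro!: mult_right_mono\<close>)
  have close: "cmod (B s - autocorr h s) \<le> e / 4" for s
  proof -
    have "B s - autocorr h s = (LINT x|lborel. (g (x + s) - h (x + s)) * cnj (h x))"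
      unfolding B_def autocorr_def left_diff_distrib by (rule Bochner_Integration.integral_diff[symmetric, OF ig ih])
    also have "cmod \<dots> \<le> (LINT x|lborel. cmod ((g (x + s) - h (x + s)) * cnj (h x)))"
      by (rule integral_norm_bound)
    also have "\<dots> \<le> (LINT x|lborel. M * cmod (g (x + s) - h (x + s)))"
    proof (rule integral_mono)
      have "integrable lborel (\<lambda>x. g (s + 1 * x) - h (s + 1 * x))"
        by (rule lborel_integrable_real_affine[OF g(3)]) simp
      then show i: "integrable lborel (\<lambda>x. M * cmod (g (x + s) - h (x + s)))"
        by (simp add: add.commute)
      show "cmod ((g (x + s) - h (x + s)) * cnj (h x)) \<le> M * cmod (g (x + s) - h (x + s))" for x
        using bd[of x] by (simp add: norm_mult mult.commute mult_right_mono)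
      show "integrable lborel (\<lambda>x. cmod ((g (x + s) - h (x + s)) * cnj (h x)))"
        using Bochner_Integration.integrable_diff[OF ig[of s] ih[of s]] by (intro integrable_norm) (simp add: left_diff_distrib)
    qed
    also have "\<dots> = M * (LINT x|lborel. cmod (g x - h x))"
      using lborel_integral_real_affine[of 1 "\<lambda>x. cmod (g x - h x)" s] by (simp add: add.commute)
    also have "\<dots> \<le> M * (e / (4 * (M + 1)))"
      using gh M by (intro mult_left_mono) auto
    also have "\<dots> \<le> e / 4"
      using e M by (simp add: field_simps)
    finally show ?thesis .
  qed
  have "(\<lambda>n. B (t n)) \<longlonglongrightarrow> B 0"
    unfolding B_def
  proof (rule integral_dominated_convergence[where w = "\<lambda>x. M * cmod (h x)"])
    have "(\<lambda>n. g (x + t n)) \<longlonglongrightarrow> g (x + 0)" for x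
      by (rule continuous_on_tendsto_compose[OF g(1) tendsto_add[OF tendsto_const t]]) auto
    then show "AE x in lborel. (\<lambda>n. g (x + t n) * cnj (h x)) \<longlonglongrightarrow> g (x + 0) * cnj (h x)"
      by (auto intro!: tendsto_intros)
  qed (use h g(2) in \<open>auto simp: norm_mult intro!: mult_right_mono\<close>)
  from LIMSEQ_D[OF this, of "e / 4"] e obtain n0 where n0: "\<And>n. n \<ge> n0 \<Longrightarrow> cmod (B (t n) - B 0) < e / 4"
    by auto
  have "cmod (autocorr h (t n) - autocorr h 0) < e" if "n \<ge> n0" for n
  proof -
    have "cmod (autocorr h (t n) - autocorr h 0)
        \<le> cmod (B (t n) - B 0) + cmod (B (t n) - autocorr h (t n)) + cmod (B 0 - autocorr h 0)"
      using norm_triangle_ineq[of "B (t n) - B 0 - (B (t n) - autocorr h (t n))" "B 0 - autocorr h 0"]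
        norm_triangle_ineq4[of "B (t n) - B 0" "B (t n) - autocorr h (t n)"] by simp
    then show ?thesis
      using n0[OF that] close[of "t n"] close[of 0] e by linarith
  qed
  then show "\<exists>no. \<forall>n\<ge>no. cmod (autocorr h (t n) - autocorr h 0) < e"
    by blast
qed

section \<open>Plancherel's theorem\<close>

text \<open>The integral of the squared transform against a widening Gaussian is computed in two
  ways: as an average of \<open>autocorr h\<close> over a shrinking neighbourhood of 0, and by
  monotone convergence.\<close>

lemma plancherel_bounded:
  assumes [measurable]: "h \<in> borel_measurable borel" and bd: "\<And>x. cmod (h x) \<le> M"
    and supp: "\<And>x. \<bar>x\<bar> > N \<Longrightarrow> h x = 0"
  shows "fourier_L1 h \<in> L2 \<and> L2_norm (fourier_L1 h) = L2_norm h"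
proof -
  have h: "integrable lborel h" and hL2: "h \<in> L2"
    by (rule L2_bounded_support[of h M "-\<bar>N\<bar>" "\<bar>N\<bar>"]; use bd supp in auto)+
  define \<gamma> where "\<gamma> n w = exp (- (w / real (Suc n))\<^sup>2 / 2)" for n w
  define J where "J n = (LINT w|lborel. (cmod (fourier_L1 h w))\<^sup>2 * \<gamma> n w)" for n
  have \<gamma>_int: "integrable lborel (\<lambda>w. complex_of_real (\<gamma> n w))" for n
    unfolding \<gamma>_def by (rule fourier_L1_gaussian) simp
  have \<gamma>_int': "integrable lborel (\<gamma> n)" for n
    using integrable_Re[OF \<gamma>_int[of n]] by simp
  let ?B = "LINT x|lborel. cmod (h x)"
  have bound: "cmod (fourier_L1 h w) \<le> ?B" for w
    by (rule norm_fourier_L1_le)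
  have int: "integrable lborel (\<lambda>w. (cmod (fourier_L1 h w))\<^sup>2 * \<gamma> n w)" for n
  proof (rule Bochner_Integration.integrable_bound[of _ "\<lambda>w. ?B\<^sup>2 * \<gamma> n w"])
    show "integrable lborel (\<lambda>w. ?B\<^sup>2 * \<gamma> n w)"
      by (intro integrable_mult_right \<gamma>_int')
    show "AE w in lborel. norm ((cmod (fourier_L1 h w))\<^sup>2 * \<gamma> n w) \<le> norm (?B\<^sup>2 * \<gamma> n w)"
      by (rule AE_I2) (auto simp: abs_mult \<gamma>_def intro!: mult_right_mono power_mono bound)
  qed (simp add: \<gamma>_def)
  have J_eq: "complex_of_real (J n)
      = (LINT r|lborel. std_normal_density r *\<^sub>R autocorr h (r / (2 * pi * real (Suc n))))" for n
  proof -
    define c where "c = 2 * pi * real (Suc n)"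
    have c: "c > 0"
      by (simp add: c_def)
    have "complex_of_real (J n) = (LINT w|lborel. fourier_L1 (autocorr h) w * complex_of_real (\<gamma> n w))"
      unfolding J_def integral_complex_of_real[symmetric] by (simp add: fourier_L1_autocorr[OF h])
    also have "\<dots> = (LINT t|lborel. autocorr h t * fourier_L1 (\<lambda>w. complex_of_real (\<gamma> n w)) t)"
      by (rule fourier_L1_exchange[OF fourier_L1_autocorr(1)[OF h] \<gamma>_int])
    also have "\<dots> = (LINT t|lborel. autocorr h t * complex_of_real (c * std_normal_density (c * t)))"
      unfolding \<gamma>_def c_def by (subst fourier_L1_gaussian) simp_all
    \<comment> \<open>Rescaling moves the dependence on \<open>n\<close> from the density into the
      argument of \<open>autocorr h\<close>, so that one fixed density dominates all the
      integrands.\<close>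
    also have "\<dots> = \<bar>1 / c\<bar> *\<^sub>R (LINT r|lborel. autocorr h (0 + 1 / c * r) *
        complex_of_real (c * std_normal_density (c * (0 + 1 / c * r))))"
      by (rule lborel_integral_real_affine) (use c in simp)
    also have "\<dots> = (LINT r|lborel. \<bar>1 / c\<bar> *\<^sub>R (autocorr h (0 + 1 / c * r) *
        complex_of_real (c * std_normal_density (c * (0 + 1 / c * r)))))"
      by (rule integral_scaleR_right[symmetric])
    also have "\<dots> = (LINT r|lborel. std_normal_density r *\<^sub>R autocorr h (r / c))"
      by (intro Bochner_Integration.integral_cong refl) (use c in \<open>simp add: scaleR_conv_of_real field_simps\<close>)
    finally show ?thesis
      by (simp only: c_def)
  qed
  have "(\<lambda>n. LINT r|lborel. std_normal_density r *\<^sub>R autocorr h (r / (2 * pi * real (Suc n))))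
      \<longlonglongrightarrow> (LINT r|lborel. std_normal_density r *\<^sub>R autocorr h 0)"
  proof (rule integral_dominated_convergence[where w = "\<lambda>r. std_normal_density r * (M * ?B)"])
    show "integrable lborel (\<lambda>r. std_normal_density r * (M * ?B))"
      by (intro integrable_mult_left integrable_normal_density) auto
    have "(\<lambda>n. autocorr h (r / (2 * pi * real (Suc n)))) \<longlonglongrightarrow> autocorr h 0" for r
    proof (rule autocorr_tendsto[OF assms(1) bd supp])
      show "(\<lambda>n. r / (2 * pi * real (Suc n))) \<longlonglongrightarrow> 0"
        by real_asymp
    qed
    then show "AE r in lborel. (\<lambda>n. std_normal_density r *\<^sub>R autocorr h (r / (2 * pi * real (Suc n))))
        \<longlonglongrightarrow> std_normal_density r *\<^sub>R autocorr h 0"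
      by (intro AE_I2 tendsto_intros)
    show "AE r in lborel. norm (std_normal_density r *\<^sub>R autocorr h (r / (2 * pi * real (Suc n))))
        \<le> std_normal_density r * (M * ?B)" for n
      by (rule AE_I2) (auto intro!: mult_left_mono norm_autocorr_le h bd)
  qed measurable
  also have "(LINT r|lborel. std_normal_density r *\<^sub>R autocorr h 0) = autocorr h 0"
  proof -
    have "(LINT r|lborel. std_normal_density r) = 1"
      by (rule integral_normal_density) simp
    then show ?thesis
      using integrable_normal_density[of 1 0] by (subst integral_scaleR_left) auto
  qed
  also have "autocorr h 0 = complex_of_real ((L2_norm h)\<^sup>2)"
    unfolding L2_inner_self[symmetric] by (simp add: autocorr_def L2_inner_def)
  finally have "(\<lambda>n. complex_of_real (J n)) \<longlonglongrightarrow> complex_of_real ((L2_norm h)\<^sup>2)"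
    unfolding J_eq .
  then have J_lim: "(\<lambda>n. ennreal (J n)) \<longlonglongrightarrow> ennreal ((L2_norm h)\<^sup>2)"
    unfolding tendsto_of_real_iff by (rule tendsto_ennrealI)
  \<comment> \<open>The Gaussians increase to 1. Working with the nonnegative integral yields the
    finiteness and the value of the limit together, without presupposing that the transform lies in
    L2.\<close>
  have "(\<lambda>n. \<integral>\<^sup>+w. ennreal ((cmod (fourier_L1 h w))\<^sup>2 * \<gamma> n w) \<partial>lborel)
      \<longlonglongrightarrow> (\<integral>\<^sup>+w. ennreal ((cmod (fourier_L1 h w))\<^sup>2) \<partial>lborel)"
  proof (rule nn_integral_LIMSEQ)
    show "incseq (\<lambda>n w. ennreal ((cmod (fourier_L1 h w))\<^sup>2 * \<gamma> n w))"
    proof (intro incseq_SucI le_funI ennreal_leI mult_left_mono)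
      fix n w
      have "(w / real (Suc (Suc n)))\<^sup>2 \<le> (w / real (Suc n))\<^sup>2"
        unfolding power_divide by (intro divide_left_mono power_mono) auto
      then show "\<gamma> n w \<le> \<gamma> (Suc n) w"
        by (simp add: \<gamma>_def)
    qed simp
    show "(\<lambda>n. ennreal ((cmod (fourier_L1 h w))\<^sup>2 * \<gamma> n w)) \<longlonglongrightarrow> ennreal ((cmod (fourier_L1 h w))\<^sup>2)" for w
    proof -
      have "(\<lambda>n. w / real (Suc n)) \<longlonglongrightarrow> 0"
        by real_asymp
      from tendsto_exp[OF tendsto_divide[OF tendsto_minus[OF tendsto_power[OF this, of 2]] tendsto_const[of 2]]]
      have "(\<lambda>n. exp (- (w / real (Suc n))\<^sup>2 / 2)) \<longlonglongrightarrow> 1"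
        by simp
      then have "(\<lambda>n. (cmod (fourier_L1 h w))\<^sup>2 * \<gamma> n w) \<longlonglongrightarrow> (cmod (fourier_L1 h w))\<^sup>2 * 1"
        unfolding \<gamma>_def by (intro tendsto_intros)
      then show ?thesis
        by (intro tendsto_ennrealI) simp
    qed
  qed (simp add: \<gamma>_def)
  also have "(\<lambda>n. \<integral>\<^sup>+w. ennreal ((cmod (fourier_L1 h w))\<^sup>2 * \<gamma> n w) \<partial>lborel) = (\<lambda>n. ennreal (J n))"
    unfolding J_def by (intro ext nn_integral_eq_integral int AE_I2) (simp add: \<gamma>_def)
  finally have eq: "(\<integral>\<^sup>+w. ennreal ((cmod (fourier_L1 h w))\<^sup>2) \<partial>lborel) = ennreal ((L2_norm h)\<^sup>2)"
    using J_lim LIMSEQ_unique by blast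
  then have mem: "fourier_L1 h \<in> L2"
    by (intro L2I_nn_integral) auto
  with eq show ?thesis
    by (simp add: L2_nn_integral)
qed

lemma L2_Fatou:
  assumes g: "\<And>n. g n \<in> L2" and lim: "AE x in lborel. (\<lambda>n. g n x) \<longlonglongrightarrow> F x"
    and F [measurable]: "F \<in> borel_measurable borel" and c: "(\<lambda>n. L2_norm (g n)) \<longlonglongrightarrow> c"
  shows "F \<in> L2" "L2_norm F \<le> c"
proof -
  have c0: "0 \<le> c"
    using c by (rule LIMSEQ_le_const) simp
  note [measurable] = L2_borel[OF g]
  have "(\<integral>\<^sup>+x. ennreal ((cmod (F x))\<^sup>2) \<partial>lborel) = (\<integral>\<^sup>+x. liminf (\<lambda>n. ennreal ((cmod (g n x))\<^sup>2)) \<partial>lborel)"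
  proof (rule nn_integral_cong_AE)
    show "AE x in lborel. ennreal ((cmod (F x))\<^sup>2) = liminf (\<lambda>n. ennreal ((cmod (g n x))\<^sup>2))"
      using lim
    proof eventually_elim
      case (elim x)
      have "(\<lambda>n. ennreal ((cmod (g n x))\<^sup>2)) \<longlonglongrightarrow> ennreal ((cmod (F x))\<^sup>2)"
        by (intro tendsto_intros elim)
      then show ?case
        by (rule lim_imp_Liminf[OF trivial_limit_sequentially, symmetric])
    qed
  qed
  also have "\<dots> \<le> liminf (\<lambda>n. \<integral>\<^sup>+x. ennreal ((cmod (g n x))\<^sup>2) \<partial>lborel)"
    by (rule nn_integral_liminf) measurable
  also have "\<dots> = ennreal (c\<^sup>2)"
    unfolding L2_nn_integral[OF g]
    by (intro lim_imp_Liminf trivial_limit_sequentially tendsto_intros c)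
  finally have le: "(\<integral>\<^sup>+x. ennreal ((cmod (F x))\<^sup>2) \<partial>lborel) \<le> ennreal (c\<^sup>2)" .
  then show mem: "F \<in> L2"
    by (intro L2I_nn_integral) (auto simp: le_less_trans)
  have "(L2_norm F)\<^sup>2 \<le> c\<^sup>2"
    using le by (simp add: L2_nn_integral[OF mem])
  then show "L2_norm F \<le> c"
    by (rule power2_le_imp_le) (rule c0)
qed

text \<open>Integrability of \<open>h\<close> identifies the pointwise limit of the transforms of
  the truncations as \<open>fourier_L1 h\<close>; the isometry for bounded functions and Fatou's
  lemma turn this into convergence in L2.\<close>

lemma plancherel:
  assumes h: "integrable lborel h" "h \<in> L2"
  shows "fourier_L1 h \<in> L2" "L2_norm (fourier_L1 h) = L2_norm h"
proof -
  note [measurable] = L2_borel[OF h(2)]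
  define t where "t = L2_trunc h"
  note t = L2_truncation[OF h(2), folded t_def]
  have four: "fourier_L1 (t n) \<in> L2" "L2_norm (fourier_L1 (t n)) = L2_norm (t n)" for n
    using plancherel_bounded[of "t n" "real n" "real n"] t(3)[of n] by (auto simp: t_def L2_trunc_def)
  have four_diff: "L2_norm (\<lambda>w. fourier_L1 (t n) w - fourier_L1 (t m) w) = L2_norm (\<lambda>x. t n x - t m x)" for n m
  proof -
    have "L2_norm (fourier_L1 (\<lambda>x. t n x - t m x)) = L2_norm (\<lambda>x. t n x - t m x)"
    proof (rule conjunct2[OF plancherel_bounded[where M = "real n + real m" and N = "max (real n) (real m)"]])
      show "cmod (t n x - t m x) \<le> real n + real m" for x
        using norm_triangle_ineq4[of "t n x" "t m x"] by (auto simp: t_def L2_trunc_def split: if_splits)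
    qed (use t(3)[of n] t(3)[of m] in \<open>auto simp: t_def L2_trunc_def\<close>)
    then show ?thesis
      by (simp add: fourier_L1_diff[OF t(2) t(2), abs_def])
  qed
  have t_lim: "(\<lambda>n. t n x) \<longlonglongrightarrow> h x" for x
  proof -
    obtain N where N: "max (cmod (h x)) \<bar>x\<bar> \<le> real N"
      using real_arch_simple by blast
    have "\<forall>\<^sub>F n in sequentially. t n x = h x"
      using eventually_ge_at_top[of N] by eventually_elim (use N in \<open>auto simp: t_def L2_trunc_def\<close>)
    then show ?thesis
      by (rule tendsto_eventually)
  qed
  have four_lim: "(\<lambda>n. fourier_L1 (t n) w) \<longlonglongrightarrow> fourier_L1 h w" for w
    unfolding fourier_L1_unit_exp
  proof (rule integral_dominated_convergence[where w = "\<lambda>x. cmod (h x)"])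
    show "AE x in lborel. (\<lambda>n. t n x * unit_exp (- (x * w))) \<longlonglongrightarrow> h x * unit_exp (- (x * w))"
      by (intro AE_I2 tendsto_intros t_lim)
    show "AE x in lborel. norm (t n x * unit_exp (- (x * w))) \<le> cmod (h x)" for n
      by (auto simp: norm_mult t_def L2_trunc_def)
  qed (use h t(3) in auto)
  \<comment> \<open>Here \<open>n\<close> is fixed and Fatou's lemma is applied as the second index
    \<open>m\<close> tends to infinity.\<close>
  have diff: "(\<lambda>w. fourier_L1 (t n) w - fourier_L1 h w) \<in> L2"
    "L2_norm (\<lambda>w. fourier_L1 (t n) w - fourier_L1 h w) \<le> L2_norm (\<lambda>x. t n x - h x)" for n
  proof -
    have conv: "L2_converges (\<lambda>m x. t n x - t m x) (\<lambda>x. t n x - h x)"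
      using t(4) by (simp add: L2_converges_def norm_minus_commute)
    have c: "(\<lambda>m. L2_norm (\<lambda>w. fourier_L1 (t n) w - fourier_L1 (t m) w)) \<longlonglongrightarrow> L2_norm (\<lambda>x. t n x - h x)"
      unfolding four_diff by (intro L2_converges_norm L2_diff t h conv)
    have ae: "AE w in lborel. (\<lambda>m. fourier_L1 (t n) w - fourier_L1 (t m) w) \<longlonglongrightarrow> fourier_L1 (t n) w - fourier_L1 h w"
      by (intro AE_I2 tendsto_intros four_lim)
    have mem: "(\<lambda>w. fourier_L1 (t n) w - fourier_L1 (t m) w) \<in> L2" for m
      by (intro L2_diff four)
    have "(\<lambda>w. fourier_L1 (t n) w - fourier_L1 h w) \<in> borel_measurable borel"
      using t(3)[of n] by measurable
    note F = L2_Fatou[OF mem ae this c]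
    show "(\<lambda>w. fourier_L1 (t n) w - fourier_L1 h w) \<in> L2"
      "L2_norm (\<lambda>w. fourier_L1 (t n) w - fourier_L1 h w) \<le> L2_norm (\<lambda>x. t n x - h x)"
      by (rule F)+
  qed
  show mem: "fourier_L1 h \<in> L2"
    using L2_diff[OF four(1)[of 0] diff(1)[of 0]] by simp
  have lim: "(\<lambda>n. L2_norm (\<lambda>x. t n x - h x)) \<longlonglongrightarrow> 0"
    using t h by (simp add: L2_converges_iff)
  have "(\<lambda>n. L2_norm (\<lambda>w. fourier_L1 (t n) w - fourier_L1 h w)) \<longlonglongrightarrow> 0"
    by (rule real_tendsto_sandwich[where f = "\<lambda>_. 0", OF _ _ tendsto_const lim]) (simp_all add: diff)
  then have "L2_converges (\<lambda>n. fourier_L1 (t n)) (fourier_L1 h)"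
    by (simp add: L2_converges_iff four mem)
  from L2_converges_norm[OF four(1) mem this] have "(\<lambda>n. L2_norm (t n)) \<longlonglongrightarrow> L2_norm (fourier_L1 h)"
    by (simp add: four)
  moreover have "(\<lambda>n. L2_norm (t n)) \<longlonglongrightarrow> L2_norm h"
    by (rule L2_converges_norm[OF t(1) h(2) t(4)])
  ultimately show "L2_norm (fourier_L1 h) = L2_norm h"
    by (rule LIMSEQ_unique)
qed

lemma plancherel_diff:
  assumes "integrable lborel f" "f \<in> L2" "integrable lborel g" "g \<in> L2"
  shows "L2_norm (\<lambda>w. fourier_L1 f w - fourier_L1 g w) = L2_norm (\<lambda>x. f x - g x)"
  using plancherel(2)[of "\<lambda>x. f x - g x"] assms
  by (simp add: L2_diff fourier_L1_diff[OF assms(1,3), abs_def])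

lemma is_fourier_L2_exists:
  assumes f: "f \<in> L2"
  shows "\<exists>F. is_fourier_L2 f F"
proof -
  define t where "t = L2_trunc f"
  note t = L2_truncation[OF f, folded t_def]
  note four = plancherel[OF t(2) t(1)]
  have "\<exists>F\<in>L2. L2_converges (\<lambda>n. fourier_L1 (t n)) F"
  proof (rule L2_complete[OF four(1)])
    fix e :: real assume e: "0 < e"
    have "(\<lambda>n. L2_norm (\<lambda>x. t n x - f x)) \<longlonglongrightarrow> 0"
      using t f by (simp add: L2_converges_iff)
    from LIMSEQ_D[OF this, of "e / 2"] e obtain N
      where N: "\<And>n. n \<ge> N \<Longrightarrow> L2_norm (\<lambda>x. t n x - f x) < e / 2"
      by auto
    have "L2_norm (\<lambda>w. fourier_L1 (t m) w - fourier_L1 (t n) w) < e" if "m \<ge> N" "n \<ge> N" for m n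
      using plancherel_diff[OF t(2,1) t(2,1), of m n] L2_norm_triangle_diff[OF t(1) f t(1), of m n]
        N[OF that(1)] N[OF that(2)] L2_norm_minus[of f "t n"] by linarith
    then show "\<exists>N. \<forall>m\<ge>N. \<forall>n\<ge>N. L2_norm (\<lambda>w. fourier_L1 (t m) w - fourier_L1 (t n) w) < e"
      by blast
  qed
  then obtain F where F: "F \<in> L2" "L2_converges (\<lambda>n. fourier_L1 (t n)) F"
    by blast
  \<comment> \<open>\<open>is_fourier_L2\<close> quantifies over all approximating sequences. An
    arbitrary one is compared with the truncations, whose transforms are equally close to its own by
    the isometry.\<close>
  have "L2_converges (\<lambda>n. fourier_L1 (h n)) F"
    if h: "\<And>n. h n \<in> L2" "\<And>n. integrable lborel (h n)" "L2_converges h f" for h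
  proof -
    have lim: "(\<lambda>n. L2_norm (\<lambda>x. h n x - f x) + L2_norm (\<lambda>x. t n x - f x)
        + L2_norm (\<lambda>w. fourier_L1 (t n) w - F w)) \<longlonglongrightarrow> 0 + 0 + 0"
      using h t f F four by (intro tendsto_add) (simp_all add: L2_converges_iff)
    have le: "L2_norm (\<lambda>w. fourier_L1 (h n) w - F w)
        \<le> L2_norm (\<lambda>x. h n x - f x) + L2_norm (\<lambda>x. t n x - f x) + L2_norm (\<lambda>w. fourier_L1 (t n) w - F w)" for n
      using L2_norm_triangle_diff[OF plancherel(1)[OF h(2,1)] four(1) F(1), of n n]
        plancherel_diff[OF h(2,1) t(2,1), of n n] L2_norm_triangle_diff[OF h(1) f t(1), of n n]
        L2_norm_minus[of f "t n"] by linarith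
    have "(\<lambda>n. L2_norm (\<lambda>w. fourier_L1 (h n) w - F w)) \<longlonglongrightarrow> 0"
      by (rule real_tendsto_sandwich[where f = "\<lambda>_. 0", OF _ _ tendsto_const lim[simplified]]) (simp_all add: le)
    then show ?thesis
      using h F plancherel by (simp add: L2_converges_iff)
  qed
  then show ?thesis
    using F by (auto simp: is_fourier_L2_def)
qed

lemma is_fourier_L2_fourier_L2: "f \<in> L2 \<Longrightarrow> is_fourier_L2 f (fourier_L2 f)"
  unfolding fourier_L2_def by (rule someI_ex[OF is_fourier_L2_exists])

lemma fourier_L2_in_L2: "f \<in> L2 \<Longrightarrow> fourier_L2 f \<in> L2"
  using is_fourier_L2_fourier_L2 by (auto simp: is_fourier_L2_def)

lemma fourier_L2_converges:
  "f \<in> L2 \<Longrightarrow> (\<And>n. h n \<in> L2) \<Longrightarrow> (\<And>n. integrable lborel (h n)) \<Longrightarrow> L2_converges h f \<Longrightarrow>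
    L2_converges (\<lambda>n. fourier_L1 (h n)) (fourier_L2 f)"
  using is_fourier_L2_fourier_L2 by (auto simp: is_fourier_L2_def)

lemma L2_norm_fourier_L2:
  assumes f: "f \<in> L2"
  shows "L2_norm (fourier_L2 f) = L2_norm f"
proof -
  define t where "t = L2_trunc f"
  note t = L2_truncation[OF f, folded t_def]
  note four = plancherel[OF t(2) t(1)]
  have "(\<lambda>n. L2_norm (fourier_L1 (t n))) \<longlonglongrightarrow> L2_norm (fourier_L2 f)"
    by (intro L2_converges_norm four fourier_L2_in_L2 f fourier_L2_converges t)
  then have "(\<lambda>n. L2_norm (t n)) \<longlonglongrightarrow> L2_norm (fourier_L2 f)"
    by (simp add: four)
  then show ?thesis
    using L2_converges_norm[OF t(1) f t(4)] LIMSEQ_unique by blast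
qed

section \<open>The inverse transform as an adjoint\<close>

definition inv_fourier :: "(real \<Rightarrow> complex) \<Rightarrow> real \<Rightarrow> complex" where
  "inv_fourier h x = fourier_L1 h (- x)"

lemma inv_fourier_unit_exp: "inv_fourier h x = (LINT w|lborel. h w * unit_exp (w * x))"
  by (simp add: inv_fourier_def fourier_L1_unit_exp)

lemma inv_fourier_in_L2: "integrable lborel h \<Longrightarrow> h \<in> L2 \<Longrightarrow> inv_fourier h \<in> L2"
  using L2_affine[OF plancherel(1), of h "-1" 0] by (simp add: inv_fourier_def[abs_def])

lemma L2_norm_inv_fourier:
  assumes "integrable lborel h" "h \<in> L2"
  shows "L2_norm (inv_fourier h) = L2_norm h"
proof -
  have "(LINT x|lborel. (cmod (fourier_L1 h (- x)))\<^sup>2) = (LINT x|lborel. (cmod (fourier_L1 h x))\<^sup>2)"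
    using lborel_integral_real_affine[of "-1" "\<lambda>x. (cmod (fourier_L1 h x))\<^sup>2" 0] by simp
  then show ?thesis
    using plancherel(2)[OF assms] by (simp add: L2_norm_def inv_fourier_def)
qed

text \<open>The multiplication formula for truncations of \<open>f\<close>, followed by a limit on
  both sides. With the isometry it gives inversion in the mean, and it moves Gabor coefficients to
  the frequency side.\<close>

lemma inv_fourier_adjoint:
  assumes h: "integrable lborel h" "h \<in> L2" and f: "f \<in> L2"
  shows "L2_inner (inv_fourier h) f = L2_inner h (fourier_L2 f)"
proof -
  define t where "t = L2_trunc f"
  note t = L2_truncation[OF f, folded t_def]
  have step: "L2_inner (inv_fourier h) (t n) = L2_inner h (fourier_L1 (t n))" for n
  proof -
    have i: "integrable lborel (\<lambda>x. cnj (t n (- x)))"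
      using lborel_integrable_real_affine[OF t(2)[of n], of "-1" 0] by simp
    have "L2_inner (inv_fourier h) (t n) = (LINT x|lborel. fourier_L1 h x * cnj (t n (- x)))"
      unfolding L2_inner_def inv_fourier_def
      using lborel_integral_real_affine[of "-1" "\<lambda>x. fourier_L1 h x * cnj (t n (- x))" 0] by simp
    also have "\<dots> = (LINT w|lborel. h w * fourier_L1 (\<lambda>x. cnj (t n (- x))) w)"
      by (rule fourier_L1_exchange[OF h(1) i])
    also have "\<dots> = (LINT w|lborel. h w * cnj (fourier_L1 (t n) w))"
    proof (intro Bochner_Integration.integral_cong refl arg_cong2[where f = times])
      fix w
      have "fourier_L1 (\<lambda>x. cnj (t n (- x))) w = (LINT x|lborel. cnj (t n x * unit_exp (- (x * w))))"
        unfolding fourier_L1_unit_exp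
        using lborel_integral_real_affine[of "-1" "\<lambda>x. cnj (t n (- x)) * unit_exp (- (x * w))" 0]
        by (simp add: cnj_unit_exp)
      then show "fourier_L1 (\<lambda>x. cnj (t n (- x))) w = cnj (fourier_L1 (t n) w)"
        by (simp only: Bochner_Integration.integral_cnj fourier_L1_unit_exp)
    qed
    finally show ?thesis
      by (simp add: L2_inner_def)
  qed
  have "(\<lambda>n. L2_inner (t n) (inv_fourier h)) \<longlonglongrightarrow> L2_inner f (inv_fourier h)"
    by (intro L2_converges_inner t f inv_fourier_in_L2 h)
  from tendsto_cnj[OF this] have 1: "(\<lambda>n. L2_inner (inv_fourier h) (t n)) \<longlonglongrightarrow> L2_inner (inv_fourier h) f"
    by (simp flip: L2_inner_commute)
  have "(\<lambda>n. L2_inner (fourier_L1 (t n)) h) \<longlonglongrightarrow> L2_inner (fourier_L2 f) h"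
    by (intro L2_converges_inner plancherel t fourier_L2_in_L2 f fourier_L2_converges h)
  from tendsto_cnj[OF this] have 2: "(\<lambda>n. L2_inner (inv_fourier h) (t n)) \<longlonglongrightarrow> L2_inner h (fourier_L2 f)"
    by (simp add: step flip: L2_inner_commute)
  show ?thesis
    by (rule LIMSEQ_unique[OF 1 2])
qed

text \<open>Expanding the squared distance, norms are preserved and the cross term is carried over
  by the adjoint relation; hence the distance to \<open>f\<close> equals the distance of the
  truncation to the transform of \<open>f\<close>.\<close>

lemma inv_fourier_dense:
  assumes f: "f \<in> L2"
  shows "L2_converges (\<lambda>n. inv_fourier (L2_trunc (fourier_L2 f) n)) f"
proof -
  define t where "t = L2_trunc (fourier_L2 f)"
  have F: "fourier_L2 f \<in> L2"
    by (rule fourier_L2_in_L2[OF f])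
  note t = L2_truncation[OF F, folded t_def]
  have mem: "inv_fourier (t n) \<in> L2" for n
    by (intro inv_fourier_in_L2 t)
  have "(L2_norm (\<lambda>x. inv_fourier (t n) x - f x))\<^sup>2 = (L2_norm (\<lambda>w. t n w - fourier_L2 f w))\<^sup>2" for n
    unfolding L2_norm_diff_sq[OF mem f] L2_norm_diff_sq[OF t(1) F]
    by (simp add: L2_norm_inv_fourier t L2_norm_fourier_L2 f inv_fourier_adjoint)
  then have "L2_norm (\<lambda>x. inv_fourier (t n) x - f x) = L2_norm (\<lambda>w. t n w - fourier_L2 f w)" for n
    by (simp add: power2_eq_iff_nonneg)
  then show ?thesis
    using t(4) by (simp add: L2_converges_iff mem f t(1) F flip: t_def)
qed

section \<open>Periodization and Bessel's inequality\<close>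

lemma sigma_finite_count_space_int: "sigma_finite_measure (count_space (UNIV :: int set))"
  by (rule sigma_finite_measure_count_space_countable) simp

lemma nn_integral_count_space_swap:
  fixes F :: "int \<Rightarrow> real \<Rightarrow> ennreal"
  assumes [measurable]: "\<And>m. F m \<in> borel_measurable borel"
  shows "(\<integral>\<^sup>+m. (\<integral>\<^sup>+w. F m w \<partial>lborel) \<partial>count_space UNIV) = (\<integral>\<^sup>+w. (\<integral>\<^sup>+m. F m w \<partial>count_space UNIV) \<partial>lborel)"
proof -
  interpret pair_sigma_finite lborel "count_space (UNIV :: int set)"
    by (intro pair_sigma_finite.intro sigma_finite_count_space_int lborel.sigma_finite_measure_axioms)
  have "(\<lambda>z. F (snd z) (fst z)) \<in> borel_measurable (lborel \<Otimes>\<^sub>M count_space (UNIV :: int set))"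
    by measurable
  from Fubini[OF this] show ?thesis
    by simp
qed

text \<open>Each \<open>y\<close> is counted once for every translate of \<open>S\<close> that
  contains it. For \<open>S\<close> a half-open period this number is 1; for a bounded interval it
  is bounded.\<close>

lemma nn_integral_periodize:
  fixes g :: "real \<Rightarrow> ennreal"
  assumes [measurable]: "g \<in> borel_measurable borel" "S \<in> sets borel"
  shows "(\<integral>\<^sup>+m. (\<integral>\<^sup>+w. g (w + c * of_int m) * indicator S w \<partial>lborel) \<partial>count_space (UNIV :: int set))
    = (\<integral>\<^sup>+y. g y * emeasure (count_space UNIV) {m :: int. y - c * of_int m \<in> S} \<partial>lborel)"
proof -
  have "(\<integral>\<^sup>+w. g (w + c * of_int m) * indicator S w \<partial>lborel) = (\<integral>\<^sup>+y. g y * indicator S (y - c * of_int m) \<partial>lborel)" for m :: int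
    using nn_integral_real_affine[of "\<lambda>y. g y * indicator S (y - c * of_int m)" 1 "c * of_int m"]
    by (simp add: add.commute)
  then have "(\<integral>\<^sup>+m. (\<integral>\<^sup>+w. g (w + c * of_int m) * indicator S w \<partial>lborel) \<partial>count_space (UNIV :: int set))
      = (\<integral>\<^sup>+m. (\<integral>\<^sup>+y. g y * indicator S (y - c * of_int m) \<partial>lborel) \<partial>count_space (UNIV :: int set))"
    by simp
  also have "\<dots> = (\<integral>\<^sup>+y. (\<integral>\<^sup>+m. g y * indicator S (y - c * of_int m) \<partial>count_space (UNIV :: int set)) \<partial>lborel)"
    by (rule nn_integral_count_space_swap) measurable
  also have "\<dots> = (\<integral>\<^sup>+y. g y * emeasure (count_space UNIV) {m :: int. y - c * of_int m \<in> S} \<partial>lborel)"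
  proof (rule nn_integral_cong)
    fix y
    have "(\<integral>\<^sup>+m. g y * indicator S (y - c * of_int m) \<partial>count_space (UNIV :: int set))
        = (\<integral>\<^sup>+m. g y * indicator {m. y - c * of_int m \<in> S} m \<partial>count_space (UNIV :: int set))"
      by (intro nn_integral_cong) (auto simp: indicator_def)
    then show "(\<integral>\<^sup>+m. g y * indicator S (y - c * of_int m) \<partial>count_space (UNIV :: int set))
        = g y * emeasure (count_space UNIV) {m :: int. y - c * of_int m \<in> S}"
      by (simp add: nn_integral_cmult_indicator)
  qed
  finally show ?thesis .
qed

lemma nn_integral_periodize_period:
  fixes g :: "real \<Rightarrow> ennreal"
  assumes "g \<in> borel_measurable borel" "c > 0"
  shows "(\<integral>\<^sup>+m. (\<integral>\<^sup>+w. g (w + c * of_int m) * indicator {0..<c} w \<partial>lborel) \<partial>count_space (UNIV :: int set))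
    = (\<integral>\<^sup>+y. g y \<partial>lborel)"
proof -
  have "{m :: int. y - c * of_int m \<in> {0..<c}} = {\<lfloor>y / c\<rfloor>}" for y
  proof -
    have "y - c * of_int m \<in> {0..<c} \<longleftrightarrow> of_int m \<le> y / c \<and> y / c < of_int m + 1" for m
      using assms(2) by (auto simp: field_simps)
    then have "y - c * of_int m \<in> {0..<c} \<longleftrightarrow> m = \<lfloor>y / c\<rfloor>" for m
      using floor_eq_iff[of "y / c" m] by blast
    then show ?thesis
      by blast
  qed
  then show ?thesis
    using nn_integral_periodize[of g "{0..<c}" c] assms by simp
qed

lemma card_translates_bounded:
  fixes a b c :: real
  assumes c: "c > 0"
  shows "\<exists>K :: nat. \<forall>y. emeasure (count_space UNIV) {m :: int. y - c * of_int m \<in> {a..b}} \<le> of_nat K"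
proof (intro exI allI)
  fix y
  let ?N = "nat \<lceil>(b - a) / c\<rceil> + 2"
  have sub: "{m :: int. y - c * of_int m \<in> {a..b}} \<subseteq> {\<lfloor>(y - b) / c\<rfloor>..<\<lfloor>(y - b) / c\<rfloor> + int ?N}"
  proof
    fix m assume "m \<in> {m :: int. y - c * of_int m \<in> {a..b}}"
    then have 1: "(y - b) / c \<le> of_int m" and 2: "of_int m \<le> (y - a) / c"
      using c by (auto simp: field_simps)
    have "(y - a) / c = (y - b) / c + (b - a) / c"
      by (simp add: diff_divide_distrib)
    then have "of_int m \<le> (y - b) / c + (b - a) / c"
      using 2 by simp
    also have "\<dots> < of_int \<lfloor>(y - b) / c\<rfloor> + 1 + of_int (int (nat \<lceil>(b - a) / c\<rceil>))"
      using real_of_int_floor_add_one_gt[of "(y - b) / c"] real_nat_ceiling_ge[of "(b - a) / c"] by linarith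
    finally have "m < \<lfloor>(y - b) / c\<rfloor> + int ?N"
      by linarith
    then show "m \<in> {\<lfloor>(y - b) / c\<rfloor>..<\<lfloor>(y - b) / c\<rfloor> + int ?N}"
      using 1 by (auto simp: floor_le_iff)
  qed
  have "emeasure (count_space UNIV) {m :: int. y - c * of_int m \<in> {a..b}}
      \<le> emeasure (count_space UNIV) {\<lfloor>(y - b) / c\<rfloor>..<\<lfloor>(y - b) / c\<rfloor> + int ?N}"
    by (rule emeasure_mono[OF sub]) simp
  also have "\<dots> = of_nat ?N"
    by (subst emeasure_count_space_finite) (simp_all only: finite_atLeastLessThan_int card_atLeastLessThan_int
        subset_UNIV add_diff_cancel_left' nat_int)
  finally show "emeasure (count_space UNIV) {m :: int. y - c * of_int m \<in> {a..b}} \<le> of_nat ?N" .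
qed

lemma integral_unit_exp_period:
  assumes L: "L > 0" and n: "n \<noteq> 0"
  shows "(LINT w|lborel. indicator {a..a + L} w *\<^sub>R unit_exp (of_int n * w / L)) = 0"
proof -
  let ?c = "2 * pi * of_int n / L"
  have c: "?c \<noteq> 0"
    using L n by simp
  let ?F = "\<lambda>w. (- \<i> / complex_of_real ?c) * cis (?c * w)"
  have d: "(?F has_vector_derivative unit_exp (of_int n * w / L)) (at w within {a..a + L})" for w
  proof -
    have "((\<lambda>z. exp (\<i> * complex_of_real ?c * z)) has_field_derivative
        exp (\<i> * complex_of_real ?c * complex_of_real w) * (\<i> * complex_of_real ?c)) (at (complex_of_real w))"
      using L by (auto intro!: derivative_eq_intros)
    from has_vector_derivative_real_field[OF this]
    have "((\<lambda>w. cis (?c * w)) has_vector_derivative (cis (?c * w) * (\<i> * complex_of_real ?c))) (at w within {a..a + L})"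
      by (simp only: cis_conv_exp of_real_mult mult.assoc)
    from has_vector_derivative_mult_right[OF this, of "- \<i> / complex_of_real ?c"]
    show ?thesis
      using c L n by (simp add: unit_exp_def mult_ac)
  qed
  have "(LINT w|lborel. indicator {a..a + L} w *\<^sub>R unit_exp (of_int n * w / L)) = ?F (a + L) - ?F a"
    by (rule integral_FTC_Icc[OF _ d]) (use L in \<open>auto intro!: continuous_intros\<close>)
  also have "cis (?c * (a + L)) = cis (?c * a)"
  proof -
    have "?c * (a + L) = ?c * a + 2 * pi * of_int n"
      using L by (simp add: field_simps)
    then show ?thesis
      by (simp add: cis_mult[symmetric] cis_multiple_2pi)
  qed
  finally show ?thesis
    by simp
qed

lemma L2_inner_sum_right:
  assumes "finite A" "f \<in> L2" "\<And>a. a \<in> A \<Longrightarrow> g a \<in> L2"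
  shows "L2_inner f (\<lambda>x. \<Sum>a\<in>A. g a x) = (\<Sum>a\<in>A. L2_inner f (g a))"
  using assms
proof (induction A rule: finite_induct)
  case empty
  then show ?case
    by (simp add: L2_inner_def)
next
  case (insert a A)
  then show ?case
    by (simp add: L2_inner_add_right L2_sum)
qed

text \<open>The samples are the inner products of \<open>u\<close> with exponentials restricted to
  an interval of length \<open>L\<close>, which are orthogonal with squared norm
  \<open>L\<close>.\<close>

lemma inv_fourier_bessel:
  assumes u: "u \<in> L2" and supp: "\<And>x. x \<notin> {a..a + L} \<Longrightarrow> u x = 0" and L: "L > 0" and J: "finite J"
  shows "(\<Sum>j\<in>J. (cmod (inv_fourier u (of_int j / L)))\<^sup>2) \<le> L * (L2_norm u)\<^sup>2"
proof -
  note [measurable] = L2_borel[OF u]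
  define e where "e j w = indicator {a..a + L} w * unit_exp (- (of_int j * w / L))" for j :: int and w
  define b where "b j = inv_fourier u (of_int j / L)" for j :: int
  \<comment> \<open>The orthogonal projection of \<open>u\<close> onto the chosen exponentials; the
    inequality is nonnegativity of the squared norm of \<open>u - p\<close>.\<close>
  define p where "p w = (\<Sum>j\<in>J. b j / L * e j w)" for w
  have e: "e j \<in> L2" for j
    by (rule L2_bounded_support[where M = 1 and a = a and b = "a + L"])
      (auto simp: e_def[abs_def] norm_mult indicator_def)
  have p: "p \<in> L2"
    unfolding p_def[abs_def] by (intro L2_sum J L2_cmult e)
  have ue: "L2_inner u (e j) = b j" for j
    unfolding L2_inner_def b_def inv_fourier_unit_exp
    by (intro Bochner_Integration.integral_cong refl)
      (use supp in \<open>auto simp: e_def cnj_unit_exp indicator_def mult_ac\<close>)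
  have ee: "L2_inner (e k) (e j) = (if j = k then of_real L else 0)" for j k
  proof -
    have "L2_inner (e k) (e j) = (LINT w|lborel. indicator {a..a + L} w *\<^sub>R unit_exp (of_int (j - k) * w / L))"
      unfolding L2_inner_def
      by (intro Bochner_Integration.integral_cong refl)
        (auto simp: e_def cnj_unit_exp indicator_def unit_exp_add[symmetric] diff_divide_distrib algebra_simps)
    then show ?thesis
      using integral_unit_exp_period[OF L, of "j - k" a] L by (auto simp: scaleR_conv_of_real)
  qed
  have sq: "cnj (x / complex_of_real L) * x = of_real ((cmod x)\<^sup>2 / L)" for x
  proof -
    have "cnj (x / complex_of_real L) * x = x * cnj x / complex_of_real L"
      by simp
    then show ?thesis
      by (simp only: complex_norm_square of_real_divide)
  qed
  have up: "L2_inner u p = of_real ((\<Sum>j\<in>J. (cmod (b j))\<^sup>2) / L)"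
  proof -
    have "L2_inner u p = (\<Sum>j\<in>J. L2_inner u (\<lambda>w. b j / L * e j w))"
      unfolding p_def[abs_def] by (rule L2_inner_sum_right[OF J u]) (intro L2_cmult e)
    also have "\<dots> = (\<Sum>j\<in>J. of_real ((cmod (b j))\<^sup>2 / L))"
      by (intro sum.cong refl) (simp only: L2_inner_cmult_right ue sq)
    finally show ?thesis
      by (simp add: sum_divide_distrib)
  qed
  have pe: "L2_inner p (e k) = b k" if "k \<in> J" for k
  proof -
    have "L2_inner (e k) p = (\<Sum>j\<in>J. L2_inner (e k) (\<lambda>w. b j / L * e j w))"
      unfolding p_def[abs_def] by (rule L2_inner_sum_right[OF J e]) (intro L2_cmult e)
    also have "\<dots> = (\<Sum>j\<in>J. if j = k then cnj (b k) else 0)"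
      by (intro sum.cong refl, simp only: L2_inner_cmult_right ee) (use L in simp)
    finally have "L2_inner (e k) p = cnj (b k)"
      using J that by simp
    then show ?thesis
      by (subst L2_inner_commute) simp
  qed
  have "L2_inner p p = (\<Sum>j\<in>J. L2_inner p (\<lambda>w. b j / L * e j w))"
    by (subst (2) p_def[abs_def]) (rule L2_inner_sum_right[OF J p], intro L2_cmult e)
  also have "\<dots> = (\<Sum>j\<in>J. of_real ((cmod (b j))\<^sup>2 / L))"
    by (intro sum.cong refl) (simp only: L2_inner_cmult_right pe sq)
  finally have pp: "(L2_norm p)\<^sup>2 = (\<Sum>j\<in>J. (cmod (b j))\<^sup>2) / L"
    unfolding L2_inner_self of_real_sum[symmetric] of_real_eq_iff by (simp add: sum_divide_distrib)
  have "0 \<le> (L2_norm (\<lambda>x. u x - p x))\<^sup>2"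
    by simp
  also have "\<dots> = (L2_norm u)\<^sup>2 - (\<Sum>j\<in>J. (cmod (b j))\<^sup>2) / L"
    unfolding L2_norm_diff_sq[OF u p] up pp by simp
  finally show ?thesis
    using L by (simp add: field_simps b_def)
qed

lemma inv_fourier_bessel_summable:
  assumes u: "u \<in> L2" and supp: "\<And>x. x \<notin> {a..a + L} \<Longrightarrow> u x = 0" and L: "L > 0"
  defines "b \<equiv> \<lambda>j :: int. (cmod (inv_fourier u (of_int j / L)))\<^sup>2"
  shows "b summable_on UNIV" "infsum b UNIV \<le> L * (L2_norm u)\<^sup>2"
proof -
  have le: "sum b J \<le> L * (L2_norm u)\<^sup>2" if "finite J" for J
    unfolding b_def by (rule inv_fourier_bessel[OF u supp L that])
  show s: "b summable_on UNIV"
    by (rule nonneg_bdd_above_summable_on) (auto simp: b_def[abs_def] intro!: bdd_aboveI2 le[unfolded b_def])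
  show "infsum b UNIV \<le> L * (L2_norm u)\<^sup>2"
    by (rule infsum_le_finite_sums[OF s]) (use le in auto)
qed

lemma nn_integral_count_space_infsum:
  assumes "f summable_on A" "\<And>x. x \<in> A \<Longrightarrow> 0 \<le> f x"
  shows "(\<integral>\<^sup>+x. ennreal (f x) \<partial>count_space A) = ennreal (infsum f A)"
proof -
  have "Infinite_Set_Sum.abs_summable_on f A"
    using assms summable_on_iff_abs_summable_on_real abs_summable_equivalent by blast
  then show ?thesis
    using nn_integral_conv_infsetsum[of f A] infsetsum_infsum[of f A] assms(2) by simp
qed

section \<open>Parseval's identity for Fourier series\<close>

lemma inv_fourier_modulate:
  "inv_fourier (\<lambda>w. unit_exp (s * w) * u w) x = inv_fourier u (s + x)"
proof -
  have "unit_exp (s * w) * u w * unit_exp (w * x) = u w * unit_exp (w * (s + x))" for w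
    using unit_exp_add[of "s * w" "w * x"] by (simp add: algebra_simps)
  then show ?thesis
    unfolding inv_fourier_unit_exp by (intro Bochner_Integration.integral_cong refl)
qed

lemma inv_fourier_diff:
  "integrable lborel u \<Longrightarrow> integrable lborel v \<Longrightarrow>
    inv_fourier (\<lambda>w. u w - v w) x = inv_fourier u x - inv_fourier v x"
  by (simp add: inv_fourier_def fourier_L1_diff)

lemma inv_fourier_add:
  assumes "integrable lborel u" "integrable lborel v"
  shows "inv_fourier (\<lambda>w. u w + v w) x = inv_fourier u x + inv_fourier v x"
  unfolding inv_fourier_unit_exp distrib_right
  using assms by (intro Bochner_Integration.integral_add integrable_mult_unit_exp) auto

lemma inv_fourier_cmult: "inv_fourier (\<lambda>w. c * u w) x = c * inv_fourier u x"
  by (simp add: inv_fourier_unit_exp mult.assoc)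

lemma L2_norm_mono:
  assumes f: "f \<in> L2" and g: "g \<in> L2" and le: "\<And>x. cmod (f x) \<le> D * cmod (g x)" and D: "0 \<le> D"
  shows "L2_norm f \<le> D * L2_norm g"
proof (rule power2_le_imp_le)
  have "(LINT x|lborel. (cmod (f x))\<^sup>2) \<le> (LINT x|lborel. D\<^sup>2 * (cmod (g x))\<^sup>2)"
  proof (rule integral_mono)
    show "(cmod (f x))\<^sup>2 \<le> D\<^sup>2 * (cmod (g x))\<^sup>2" for x
      using power_mono[OF le[of x], of 2] by (simp add: power_mult_distrib)
  qed (use f g in \<open>simp_all add: L2_integrable_sq\<close>)
  then show "(L2_norm f)\<^sup>2 \<le> (D * L2_norm g)\<^sup>2"
    by (simp add: L2_norm_sq power_mult_distrib)
qed (use D in simp)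

lemma norm_unit_exp_diff_one: "cmod (unit_exp t - 1) \<le> 2 * pi * \<bar>t\<bar>"
  using iexp_approx1[of "2 * pi * t" 0] by (simp add: unit_exp_def cis_conv_exp abs_mult)

lemma L2_compact_support_integrable:
  assumes u: "u \<in> L2" and supp: "\<And>x. x \<notin> {a..b} \<Longrightarrow> u x = 0"
  shows "integrable lborel u"
proof -
  have "(\<lambda>x. indicator {a..b} x :: complex) \<in> L2"
    by (rule L2_bounded_support[where M = 1 and a = a and b = b]) (auto simp: indicator_def)
  from L2_integrable_mult[OF u this] have "integrable lborel (\<lambda>x. u x * indicator {a..b} x)" .
  also have "(\<lambda>x. u x * indicator {a..b} x) = u"
    using supp by (auto simp: indicator_def fun_eq_iff)
  finally show ?thesis .
qed

text \<open>
  Bessel's inequality holds for every modulation \<open>unit_exp (s * w) * u w\<close>, and integrating over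
  \<open>s \<in> [0, 1/L)\<close> gives equality in the mean by Plancherel's theorem. As the coefficient norm is
  continuous in \<open>s\<close>, equality holds at \<open>s = 0\<close>; no density of trigonometric polynomials is needed.
\<close>

lemma inv_fourier_parseval:
  assumes u: "u \<in> L2" and supp: "\<And>x. x \<notin> {a..a + L} \<Longrightarrow> u x = 0" and L: "L > 0"
  shows "((\<lambda>j :: int. (cmod (inv_fourier u (of_int j / L)))\<^sup>2) has_sum (L * (L2_norm u)\<^sup>2)) UNIV"
proof -
  have u1: "integrable lborel u"
    by (rule L2_compact_support_integrable[OF u supp])
  define C where "C = L * (L2_norm u)\<^sup>2"
  define us where "us s w = unit_exp (s * w) * u w" for s w
  have us: "us s \<in> L2" for s
    unfolding us_def[abs_def] by (rule L2_bounded_mult[OF u, where B = 1]) auto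
  have us_supp: "x \<notin> {a..a + L} \<Longrightarrow> us s x = 0" for s x
    using supp by (simp add: us_def)
  have us_norm: "L2_norm (us s) = L2_norm u" for s
    by (simp add: L2_norm_def us_def norm_mult)
  have us_inv: "inv_fourier (us s) x = inv_fourier u (s + x)" for s x
    unfolding us_def[abs_def] by (rule inv_fourier_modulate)
  define b where "b s = (\<Sum>\<^sub>\<infinity>j :: int. (cmod (inv_fourier u (s + of_int j / L)))\<^sup>2)" for s
  have b_summable: "(\<lambda>j :: int. (cmod (inv_fourier u (s + of_int j / L)))\<^sup>2) summable_on UNIV" for s
    using inv_fourier_bessel_summable(1)[of "us s" a L, OF us us_supp L] by (simp add: us_inv)
  have b_le: "b s \<le> C" for s
    using inv_fourier_bessel_summable(2)[of "us s" a L, OF us us_supp L] by (simp add: us_inv us_norm b_def C_def)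
  have b_nonneg: "0 \<le> b s" for s
    unfolding b_def by (rule infsum_nonneg) simp
  define R where "R = \<bar>a\<bar> + L"
  have R: "0 \<le> R"
    using L by (simp add: R_def)
  \<comment> \<open>\<open>K\<close> bounds the variation of the square root of \<open>b\<close>
    away from \<open>s = 0\<close>: \<open>R\<close> bounds the frequencies in the support,
    \<open>2 * pi * R\<close> the rate of change of the modulation, and \<open>sqrt L\<close> comes
    from Bessel's inequality.\<close>
  define K where "K = sqrt L * (2 * pi * R * L2_norm u)"
  have K: "0 \<le> K"
    using L R by (simp add: K_def)
  have us_close: "L2_norm (\<lambda>x. us s x - u x) \<le> 2 * pi * R * \<bar>s\<bar> * L2_norm u" for s
  proof (rule L2_norm_mono[OF L2_diff[OF us u] u])
    fix x
    show "cmod (us s x - u x) \<le> 2 * pi * R * \<bar>s\<bar> * cmod (u x)"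
    proof (cases "x \<in> {a..a + L}")
      case True
      then have "\<bar>x\<bar> \<le> R"
        using L by (auto simp: R_def)
      have "us s x - u x = (unit_exp (s * x) - 1) * u x"
        by (simp add: us_def algebra_simps)
      then have "cmod (us s x - u x) \<le> 2 * pi * \<bar>s * x\<bar> * cmod (u x)"
        using norm_unit_exp_diff_one[of "s * x"] by (simp add: norm_mult mult_right_mono)
      also have "\<dots> \<le> 2 * pi * (\<bar>s\<bar> * R) * cmod (u x)"
        using \<open>\<bar>x\<bar> \<le> R\<close> by (intro mult_right_mono mult_left_mono) (auto simp: abs_mult intro: mult_left_mono)
      finally show ?thesis
        by (simp add: mult_ac)
    qed (use supp us_supp in auto)
  qed (use R in simp)
  \<comment> \<open>Minkowski's inequality on finite sets of samples, with Bessel's inequality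
    applied to the difference \<open>us s - u\<close>.\<close>
  have b_close: "b s \<le> (sqrt (b 0) + K * \<bar>s\<bar>)\<^sup>2" for s
    unfolding b_def[of s]
  proof (rule infsum_le_finite_sums[OF b_summable])
    fix J :: "int set" assume J: "finite J"
    let ?x = "\<lambda>j :: int. inv_fourier u (of_int j / L)" and ?y = "\<lambda>j :: int. inv_fourier u (s + of_int j / L)"
    have "L2_set (\<lambda>j. cmod (?y j)) J \<le> L2_set (\<lambda>j. cmod (?x j) + cmod (?y j - ?x j)) J"
      by (rule L2_set_mono) (use norm_triangle_sub in auto)
    also have "\<dots> \<le> L2_set (\<lambda>j. cmod (?x j)) J + L2_set (\<lambda>j. cmod (?y j - ?x j)) J"
      by (rule L2_set_triangle_ineq)
    also have "L2_set (\<lambda>j. cmod (?x j)) J \<le> sqrt (b 0)"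
    proof -
      have "(\<Sum>j\<in>J. (cmod (?x j))\<^sup>2) \<le> b 0"
        unfolding b_def using finite_sum_le_infsum[OF b_summable[of 0] J] by simp
      then show ?thesis
        by (simp add: L2_set_def)
    qed
    also have "L2_set (\<lambda>j. cmod (?y j - ?x j)) J \<le> K * \<bar>s\<bar>"
    proof -
      have "inv_fourier (\<lambda>x. us s x - u x) (of_int j / L) = ?y j - ?x j" for j
        using L2_compact_support_integrable[OF us us_supp] u1 by (simp add: inv_fourier_diff us_inv)
      then have "(\<Sum>j\<in>J. (cmod (?y j - ?x j))\<^sup>2) \<le> L * (L2_norm (\<lambda>x. us s x - u x))\<^sup>2"
        using inv_fourier_bessel[of "\<lambda>x. us s x - u x" a L, OF L2_diff[OF us u] _ L J] supp us_supp by simp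
      from real_sqrt_le_mono[OF this]
      have "L2_set (\<lambda>j. cmod (?y j - ?x j)) J \<le> sqrt L * L2_norm (\<lambda>x. us s x - u x)"
        unfolding L2_set_def by (simp add: real_sqrt_mult)
      also have "\<dots> \<le> sqrt L * (2 * pi * R * \<bar>s\<bar> * L2_norm u)"
        using L by (intro mult_left_mono us_close) auto
      finally show ?thesis
        by (simp add: K_def mult_ac)
    qed
    finally have "sqrt (\<Sum>j\<in>J. (cmod (?y j))\<^sup>2) \<le> sqrt (b 0) + K * \<bar>s\<bar>"
      by (simp add: L2_set_def)
    then show "(\<Sum>j\<in>J. (cmod (?y j))\<^sup>2) \<le> (sqrt (b 0) + K * \<bar>s\<bar>)\<^sup>2"
      by (rule sqrt_le_D)
  qed
  have inv_L2: "inv_fourier u \<in> L2"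
    by (rule inv_fourier_in_L2[OF u1 u])
  note [measurable] = L2_borel[OF inv_L2]
  \<comment> \<open>The sample points shifted by \<open>s\<close> in one period sweep the line
    exactly once, so the integral is the squared norm of the inverse transform: on average
    \<open>b\<close> attains its upper bound \<open>C\<close>.\<close>
  have mean: "(\<integral>\<^sup>+s. ennreal (b s) * indicator {0..<1/L} s \<partial>lborel) = ennreal (C / L)"
  proof -
    let ?g = "\<lambda>y. ennreal ((cmod (inv_fourier u y))\<^sup>2)"
    have "(\<integral>\<^sup>+s. ennreal (b s) * indicator {0..<1/L} s \<partial>lborel)
        = (\<integral>\<^sup>+s. (\<integral>\<^sup>+j. ?g (s + 1 / L * of_int j) * indicator {0..<1/L} s \<partial>count_space (UNIV :: int set)) \<partial>lborel)"
    proof (rule nn_integral_cong)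
      fix s
      show "ennreal (b s) * indicator {0..<1/L} s
          = (\<integral>\<^sup>+j. ?g (s + 1 / L * of_int j) * indicator {0..<1/L} s \<partial>count_space (UNIV :: int set))"
        using nn_integral_count_space_infsum[OF b_summable[of s]] by (simp add: nn_integral_multc b_def)
    qed
    also have "\<dots> = (\<integral>\<^sup>+j. (\<integral>\<^sup>+s. ?g (s + 1 / L * of_int j) * indicator {0..<1/L} s \<partial>lborel) \<partial>count_space (UNIV :: int set))"
      by (rule nn_integral_count_space_swap[symmetric]) measurable
    also have "\<dots> = (\<integral>\<^sup>+y. ?g y \<partial>lborel)"
      by (rule nn_integral_periodize_period) (use L in auto)
    also have "\<dots> = ennreal (C / L)"
      using L by (simp add: L2_nn_integral[OF inv_L2] L2_norm_inv_fourier[OF u1 u] C_def)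
    finally show ?thesis .
  qed
  have "b 0 = C"
  proof (rule ccontr)
    assume "b 0 \<noteq> C"
    then have "b 0 < C"
      using b_le[of 0] by simp
    \<comment> \<open>Half the gap, so that \<open>\<rho>\<close> lies midway between
      \<open>sqrt (b 0)\<close> and \<open>sqrt C\<close>. A deficit at 0 then persists on
      \<open>[0, \<delta>)\<close> and pulls the mean strictly below \<open>C\<close>.\<close>
    define \<eta> where "\<eta> = (sqrt C - sqrt (b 0)) / 2"
    define \<rho> where "\<rho> = sqrt (b 0) + \<eta>"
    have \<eta>: "0 < \<eta>"
      using \<open>b 0 < C\<close> by (simp add: \<eta>_def)
    have "0 \<le> \<rho>" "\<rho> < sqrt C"
      using \<eta> b_nonneg[of 0] by (auto simp: \<rho>_def \<eta>_def field_simps)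
    then have \<rho>: "\<rho>\<^sup>2 < C"
      using real_less_rsqrt real_sqrt_less_iff[of "\<rho>\<^sup>2" C] by simp
    define \<delta> where "\<delta> = min (1 / L) (\<eta> / (K + 1))"
    have \<delta>: "0 < \<delta>" "\<delta> \<le> 1 / L"
      using L \<eta> K by (auto simp: \<delta>_def)
    have small: "b s \<le> \<rho>\<^sup>2" if "s \<in> {0..<\<delta>}" for s
    proof -
      have "K * \<bar>s\<bar> \<le> (K + 1) * (\<eta> / (K + 1))"
        using that K \<eta> by (intro mult_mono) (auto simp: \<delta>_def)
      then have "sqrt (b 0) + K * \<bar>s\<bar> \<le> \<rho>"
        using K by (simp add: \<rho>_def)
      then have "(sqrt (b 0) + K * \<bar>s\<bar>)\<^sup>2 \<le> \<rho>\<^sup>2"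
        using K b_nonneg[of 0] by (intro power_mono) auto
      then show ?thesis
        using b_close[of s] by simp
    qed
    have "ennreal (C / L) \<le> (\<integral>\<^sup>+s. ennreal (\<rho>\<^sup>2) * indicator {0..<\<delta>} s + ennreal C * indicator {\<delta>..<1/L} s \<partial>lborel)"
      unfolding mean[symmetric]
    proof (rule nn_integral_mono)
      fix s
      show "ennreal (b s) * indicator {0..<1/L} s \<le> ennreal (\<rho>\<^sup>2) * indicator {0..<\<delta>} s + ennreal C * indicator {\<delta>..<1/L} s"
        using \<delta> small[of s] b_le[of s] by (auto simp: indicator_def ennreal_leI)
    qed
    also have "\<dots> = ennreal (\<rho>\<^sup>2) * ennreal \<delta> + ennreal C * ennreal (1 / L - \<delta>)"
      using \<delta> by (simp add: nn_integral_add nn_integral_cmult_indicator)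
    also have "\<dots> = ennreal (\<rho>\<^sup>2 * \<delta> + C * (1 / L - \<delta>))"
      using \<delta> \<open>b 0 < C\<close> b_nonneg[of 0] by (simp add: ennreal_mult ennreal_plus)
    finally have "C / L \<le> \<rho>\<^sup>2 * \<delta> + C * (1 / L - \<delta>)"
      using \<delta> \<open>b 0 < C\<close> b_nonneg[of 0] by (subst (asm) ennreal_le_iff) auto
    then have "C * \<delta> \<le> \<rho>\<^sup>2 * \<delta>"
      by (simp add: right_diff_distrib)
    then show False
      using \<rho> \<delta> by simp
  qed
  then show ?thesis
    using has_sum_infsum[OF b_summable[of 0]] by (simp add: b_def C_def)
qed

text \<open>Polarization with a unimodular factor \<open>c\<close>: \<open>c = 1\<close> recovers
  the real part and \<open>c = \<i>\<close> the imaginary part.\<close>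

lemma inv_fourier_parseval_inner:
  assumes u: "u \<in> L2" and v: "v \<in> L2" and L: "L > 0"
    and supp: "\<And>x. x \<notin> {a..a + L} \<Longrightarrow> u x = 0" "\<And>x. x \<notin> {a..a + L} \<Longrightarrow> v x = 0"
  shows "((\<lambda>j :: int. inv_fourier u (of_int j / L) * cnj (inv_fourier v (of_int j / L)))
    has_sum (of_real L * L2_inner u v)) UNIV"
proof -
  let ?x = "\<lambda>j :: int. inv_fourier u (of_int j / L)" and ?y = "\<lambda>j :: int. inv_fourier v (of_int j / L)"
  note u1 = L2_compact_support_integrable[OF u supp(1)] and v1 = L2_compact_support_integrable[OF v supp(2)]
  have re: "((\<lambda>j. Re (cnj c * (?x j * cnj (?y j)))) has_sum L * Re (cnj c * L2_inner u v)) UNIV"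
    if c: "cmod c = 1" for c
  proof -
    have exp: "(cmod (p + c * q))\<^sup>2 = (cmod p)\<^sup>2 + (cmod q)\<^sup>2 + 2 * Re (cnj c * (p * cnj q))" for p q
    proof -
      have "(cmod (p + z))\<^sup>2 = (cmod p)\<^sup>2 + (cmod z)\<^sup>2 + 2 * Re (p * cnj z)" for z
        by (simp add: cmod_power2 power2_sum algebra_simps)
      from this[of "c * q"] show ?thesis
        using c by (simp add: norm_mult mult_ac)
    qed
    have "L2_norm (\<lambda>x. c * v x) = L2_norm v"
      by (simp add: L2_norm_cmult c)
    then have "(L2_norm (\<lambda>x. u x + c * v x))\<^sup>2 = (L2_norm u)\<^sup>2 + (L2_norm v)\<^sup>2 + 2 * Re (cnj c * L2_inner u v)"
      by (simp only: L2_norm_add_sq[OF u L2_cmult[OF v]] L2_inner_cmult_right)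
    moreover have "inv_fourier (\<lambda>x. u x + c * v x) t = inv_fourier u t + c * inv_fourier v t" for t
      using u1 v1 by (simp add: inv_fourier_add inv_fourier_cmult)
    ultimately have 1: "((\<lambda>j. (cmod (?x j))\<^sup>2 + (cmod (?y j))\<^sup>2 + 2 * Re (cnj c * (?x j * cnj (?y j))))
        has_sum L * ((L2_norm u)\<^sup>2 + (L2_norm v)\<^sup>2 + 2 * Re (cnj c * L2_inner u v))) UNIV"
      using inv_fourier_parseval[of "\<lambda>x. u x + c * v x" a L, OF L2_add[OF u L2_cmult[OF v]] _ L] supp by (simp add: exp)
    have 2: "((\<lambda>j. (cmod (?x j))\<^sup>2 + (cmod (?y j))\<^sup>2) has_sum L * (L2_norm u)\<^sup>2 + L * (L2_norm v)\<^sup>2) UNIV"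
      using has_sum_add[OF inv_fourier_parseval[of u a L, OF u supp(1) L] inv_fourier_parseval[of v a L, OF v supp(2) L]] .
    from has_sum_cmult_right[OF has_sum_add[OF 1 has_sum_uminusI[OF 2]], of "1/2"] show ?thesis
      by (simp add: algebra_simps)
  qed
  have "((\<lambda>j. complex_of_real (Re (?x j * cnj (?y j)))) has_sum complex_of_real (L * Re (L2_inner u v))) UNIV"
    using re[of 1] by (intro has_sum_of_real) simp
  moreover have "((\<lambda>j. \<i> * complex_of_real (Im (?x j * cnj (?y j)))) has_sum \<i> * complex_of_real (L * Im (L2_inner u v))) UNIV"
    using re[of \<i>] by (intro has_sum_cmult_right has_sum_of_real) simp
  ultimately have "((\<lambda>j. complex_of_real (Re (?x j * cnj (?y j))) + \<i> * complex_of_real (Im (?x j * cnj (?y j))))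
      has_sum complex_of_real (L * Re (L2_inner u v)) + \<i> * complex_of_real (L * Im (L2_inner u v))) UNIV"
    by (rule has_sum_add)
  moreover have "complex_of_real (L * Re (L2_inner u v)) + \<i> * complex_of_real (L * Im (L2_inner u v)) = of_real L * L2_inner u v"
    by (simp add: complex_eq_iff)
  ultimately show ?thesis
    by (simp only: complex_eq[symmetric])
qed

section \<open>Gabor coefficients and the Wilson form\<close>

text \<open>Complex families are summable exactly when they are absolutely summable, and both sides
  default to 0 otherwise. Fubini's theorem and measurability of parameter integrals thereby apply to
  the series in \<open>Delta\<close>.\<close>

lemma infsum_int_eq_integral:
  fixes f :: "int \<Rightarrow> complex"
  shows "infsum f UNIV = (LINT m|count_space UNIV. f m)"
proof (cases "f summable_on UNIV")
  case True
  then have "Infinite_Set_Sum.abs_summable_on f UNIV"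
    using summable_on_iff_abs_summable_on_complex abs_summable_equivalent by blast
  then show ?thesis
    using infsetsum_infsum[of f UNIV] unfolding infsetsum_def by simp
next
  case False
  then have "\<not> Infinite_Set_Sum.abs_summable_on f UNIV"
    using summable_on_iff_abs_summable_on_complex abs_summable_equivalent by blast
  then show ?thesis
    using False by (simp add: infsum_not_exists not_integrable_integral_eq Infinite_Set_Sum.abs_summable_on_def)
qed

lemma borel_measurable_infsum_int [measurable (raw)]:
  fixes F :: "int \<Rightarrow> real \<Rightarrow> complex"
  assumes [measurable]: "\<And>m. F m \<in> borel_measurable borel"
  shows "(\<lambda>w. \<Sum>\<^sub>\<infinity>m. F m w) \<in> borel_measurable borel"
proof -
  interpret sigma_finite_measure "count_space (UNIV :: int set)"
    by (rule sigma_finite_count_space_int)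
  have [measurable]: "(\<lambda>z. F (snd z) (fst z)) \<in> borel_measurable (borel \<Otimes>\<^sub>M count_space UNIV)"
    by measurable
  show ?thesis
    unfolding infsum_int_eq_integral
    using borel_measurable_lebesgue_integral[of "\<lambda>w m. F m w" borel] by (simp add: split_def)
qed

lemma integral_infsum_int:
  fixes F :: "int \<Rightarrow> real \<Rightarrow> complex"
  assumes [measurable]: "\<And>m. F m \<in> borel_measurable borel"
    and fin: "(\<integral>\<^sup>+m. (\<integral>\<^sup>+w. ennreal (cmod (F m w)) \<partial>lborel) \<partial>count_space UNIV) < \<infinity>"
  shows "integrable lborel (\<lambda>w. \<Sum>\<^sub>\<infinity>m. F m w)"
    "(LINT w|lborel. (\<Sum>\<^sub>\<infinity>m. F m w)) = (\<Sum>\<^sub>\<infinity>m. (LINT w|lborel. F m w))"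
proof -
  interpret pair_sigma_finite lborel "count_space (UNIV :: int set)"
    by (intro pair_sigma_finite.intro sigma_finite_count_space_int lborel.sigma_finite_measure_axioms)
  have m [measurable]: "(\<lambda>z. F (snd z) (fst z)) \<in> borel_measurable (lborel \<Otimes>\<^sub>M count_space UNIV)"
    by measurable
  have "(\<integral>\<^sup>+z. ennreal (cmod (F (snd z) (fst z))) \<partial>(lborel \<Otimes>\<^sub>M count_space UNIV))
      = (\<integral>\<^sup>+w. (\<integral>\<^sup>+m. ennreal (cmod (F m w)) \<partial>count_space UNIV) \<partial>lborel)"
    by (subst M2.nn_integral_fst[symmetric]) simp_all
  also have "\<dots> = (\<integral>\<^sup>+m. (\<integral>\<^sup>+w. ennreal (cmod (F m w)) \<partial>lborel) \<partial>count_space UNIV)"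
    by (rule nn_integral_count_space_swap[symmetric]) measurable
  finally have i: "integrable (lborel \<Otimes>\<^sub>M count_space UNIV) (\<lambda>(w, m). F m w)"
    using fin m by (simp add: integrable_iff_bounded split_def)
  show "integrable lborel (\<lambda>w. \<Sum>\<^sub>\<infinity>m. F m w)"
    unfolding infsum_int_eq_integral using integrable_fst'[OF i] by simp
  show "(LINT w|lborel. (\<Sum>\<^sub>\<infinity>m. F m w)) = (\<Sum>\<^sub>\<infinity>m. (LINT w|lborel. F m w))"
    unfolding infsum_int_eq_integral using Fubini_integral[OF i] by simp
qed

text \<open>A bounded interval meets boundedly many translates of each point. Both signs of
  \<open>c\<close> occur, because the two windows in \<open>Delta\<close> move in opposite
  directions; a negative step is reflected to a positive one.\<close>

lemma nn_integral_translates_finite: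
  fixes f :: "real \<Rightarrow> complex"
  assumes f: "f \<in> L2" and c: "c \<noteq> 0"
  shows "(\<integral>\<^sup>+m. (\<integral>\<^sup>+w. ennreal ((cmod (f (w + t + c * of_int m)))\<^sup>2) * indicator {a..b} w \<partial>lborel)
    \<partial>count_space (UNIV :: int set)) < \<infinity>"
proof -
  note [measurable] = L2_borel[OF f]
  have "\<exists>K :: nat. \<forall>y. emeasure (count_space UNIV) {m :: int. y - c * of_int m \<in> {a..b}} \<le> of_nat K"
  proof (cases "c > 0")
    case True
    then show ?thesis by (rule card_translates_bounded)
  next
    case False
    then obtain K where K: "\<And>y. emeasure (count_space UNIV) {m :: int. y - (- c) * of_int m \<in> {- b..- a}} \<le> of_nat K"
      using card_translates_bounded[of "- c" "- b" "- a"] c by auto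
    have eq: "{m :: int. y - c * of_int m \<in> {a..b}} = {m :: int. - y - (- c) * of_int m \<in> {- b..- a}}" for y
      by auto
    show ?thesis
    proof (intro exI allI)
      fix y
      show "emeasure (count_space UNIV) {m :: int. y - c * of_int m \<in> {a..b}} \<le> of_nat K"
        unfolding eq[of y] by (rule K)
    qed
  qed
  then obtain K :: nat where K: "\<And>y. emeasure (count_space UNIV) {m :: int. y - c * of_int m \<in> {a..b}} \<le> of_nat K"
    by blast
  let ?g = "\<lambda>y. ennreal ((cmod (f (y + t)))\<^sup>2)"
  have "(\<integral>\<^sup>+m. (\<integral>\<^sup>+w. ennreal ((cmod (f (w + t + c * of_int m)))\<^sup>2) * indicator {a..b} w \<partial>lborel) \<partial>count_space (UNIV :: int set))
      = (\<integral>\<^sup>+y. ?g y * emeasure (count_space UNIV) {m :: int. y - c * of_int m \<in> {a..b}} \<partial>lborel)"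
    using nn_integral_periodize[of ?g "{a..b}" c] by (simp add: add_ac)
  also have "\<dots> \<le> (\<integral>\<^sup>+y. ?g y * of_nat K \<partial>lborel)"
    by (intro nn_integral_mono mult_left_mono K) auto
  also have "\<dots> = ennreal ((L2_norm (\<lambda>y. f (y + t)))\<^sup>2) * of_nat K"
    by (subst nn_integral_multc) (simp_all add: L2_nn_integral[OF L2_translate[OF f]])
  also have "\<dots> < \<infinity>"
    by (simp add: ennreal_mult_less_top of_nat_less_top)
  finally show ?thesis .
qed

text \<open>Writing the sign as a character with frequency 1/2 is what lets it be traded for a
  translation on the frequency side.\<close>

lemma minus_one_powi: "(- 1 :: complex) powi k = unit_exp (of_int k / 2)"
  using cis_power_int[of pi k] by (simp add: unit_exp_def mult.commute)

lemma minus_one_powi_diff: "(- 1 :: complex) powi (j - m) = (- 1) powi (j + m)"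
proof -
  have "of_int (j - m) / 2 = of_int (j + m) / 2 + (of_int (- m) :: real)"
    by (simp add: field_simps)
  then show ?thesis
    by (simp only: minus_one_powi unit_exp_add unit_exp_int mult_1_right)
qed

lemma minus_one_powi_minus: "(- 1 :: complex) powi (- k) = (- 1) powi k"
  using minus_one_powi_diff[of 0 k] by simp

lemma cnj_minus_one_powi: "cnj ((- 1) powi k) = (- 1) powi k"
  using minus_one_powi_minus[of k] by (simp add: minus_one_powi cnj_unit_exp)

lemma gabor_eq: "gabor \<phi> \<alpha> \<beta> (j, m) x = \<phi> (x - \<beta> * of_int j) * unit_exp (\<alpha> * of_int m * x)"
  by (simp only: gabor_def prod.case exp_conv_unit_exp)

lemma gabor_in_L2: "\<phi> \<in> L2 \<Longrightarrow> gabor \<phi> \<alpha> \<beta> p \<in> L2"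
proof (cases p)
  case (Pair j m)
  assume "\<phi> \<in> L2"
  then have "(\<lambda>x. \<phi> (x - \<beta> * of_int j)) \<in> L2"
    using L2_translate[of \<phi> "- \<beta> * of_int j"] by simp
  from L2_bounded_mult[OF this, of "\<lambda>x. unit_exp (\<alpha> * of_int m * x)" 1]
  show ?thesis
    by (simp add: Pair gabor_eq[abs_def] mult.commute)
qed

text \<open>
  With the phase factor, \<open>gabor_coeff\<close> of \<open>inv_fourier h\<close> is, for fixed \<open>m\<close>, the sequence of Fourier
  coefficients of \<open>h\<close> times a translate of the conjugated transform of the window.
\<close>

definition gabor_coeff ::
  "(real \<Rightarrow> complex) \<Rightarrow> real \<Rightarrow> real \<Rightarrow> (real \<Rightarrow> complex) \<Rightarrow> int \<Rightarrow> int \<Rightarrow> complex" where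
  "gabor_coeff \<phi> \<alpha> \<beta> f j m = unit_exp (\<alpha> * \<beta> * of_int j * of_int m) * L2_inner f (gabor \<phi> \<alpha> \<beta> (j, m))"

text \<open>Time shift and modulation are moved from the window onto \<open>f\<close> and become
  modulation and translation of \<open>h\<close>; the phase in \<open>gabor_coeff\<close> cancels
  the factor produced when they are commuted.\<close>

lemma gabor_coeff_inv_fourier:
  assumes h: "integrable lborel h" "h \<in> L2" and \<phi>: "\<phi> \<in> L2"
  shows "gabor_coeff \<phi> \<alpha> \<beta> (inv_fourier h) j m
    = inv_fourier (\<lambda>w. h w * cnj (fourier_L2 \<phi> (w - \<alpha> * of_int m))) (\<beta> * of_int j)"
proof -
  let ?s = "\<alpha> * of_int m" and ?t = "\<beta> * of_int j"
  \<comment> \<open>Its inverse transform is \<open>inv_fourier h\<close>, translated by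
    \<open>?t\<close> and demodulated by \<open>?s\<close>, which is then paired with the bare
    window.\<close>
  define k where "k w = unit_exp (?t * w) * h (w + ?s)" for w
  have "integrable lborel (\<lambda>w. h (w + ?s))"
    using lborel_integrable_real_affine[OF h(1), of 1 ?s] by (simp add: add.commute)
  then have k1: "integrable lborel k"
    unfolding k_def using integrable_mult_unit_exp[of "\<lambda>w. h (w + ?s)" "\<lambda>w. ?t * w"] by (simp add: mult.commute)
  have k2: "k \<in> L2"
    unfolding k_def[abs_def] by (rule L2_bounded_mult[OF L2_translate[OF h(2)], where B = 1]) auto
  have inv_k: "inv_fourier k y = unit_exp (- (?s * (?t + y))) * inv_fourier h (?t + y)" for y
  proof -
    have "inv_fourier k y = (LINT w|lborel. unit_exp (- (?s * (?t + y))) * (h (?s + 1 * w) * unit_exp ((?s + 1 * w) * (?t + y))))"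
      unfolding inv_fourier_unit_exp
    proof (rule Bochner_Integration.integral_cong[OF refl])
      fix w
      have "unit_exp (?t * w) * unit_exp (w * y) = unit_exp (- (?s * (?t + y))) * unit_exp ((?s + 1 * w) * (?t + y))"
        unfolding unit_exp_add[symmetric] by (simp add: algebra_simps)
      then show "k w * unit_exp (w * y) = unit_exp (- (?s * (?t + y))) * (h (?s + 1 * w) * unit_exp ((?s + 1 * w) * (?t + y)))"
        by (simp add: k_def add.commute mult_ac)
    qed
    also have "\<dots> = unit_exp (- (?s * (?t + y))) * (LINT w|lborel. h (?s + 1 * w) * unit_exp ((?s + 1 * w) * (?t + y)))"
      by (rule integral_mult_right_zero)
    also have "(LINT w|lborel. h (?s + 1 * w) * unit_exp ((?s + 1 * w) * (?t + y))) = inv_fourier h (?t + y)"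
      unfolding inv_fourier_unit_exp
      using lborel_integral_real_affine[of 1 "\<lambda>w. h w * unit_exp (w * (?t + y))" ?s] by simp
    finally show ?thesis .
  qed
  have "L2_inner (inv_fourier h) (gabor \<phi> \<alpha> \<beta> (j, m))
      = (LINT x|lborel. inv_fourier h (?t + 1 * x) * cnj (gabor \<phi> \<alpha> \<beta> (j, m) (?t + 1 * x)))"
    unfolding L2_inner_def
    using lborel_integral_real_affine[of 1 "\<lambda>x. inv_fourier h x * cnj (gabor \<phi> \<alpha> \<beta> (j, m) x)" ?t] by simp
  also have "\<dots> = L2_inner (inv_fourier k) \<phi>"
    unfolding L2_inner_def by (simp add: inv_k gabor_eq cnj_unit_exp mult_ac)
  also have "\<dots> = L2_inner k (fourier_L2 \<phi>)"
    by (rule inv_fourier_adjoint[OF k1 k2 \<phi>])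
  also have "\<dots> = (LINT w|lborel. k (- ?s + 1 * w) * cnj (fourier_L2 \<phi> (- ?s + 1 * w)))"
    unfolding L2_inner_def
    using lborel_integral_real_affine[of 1 "\<lambda>w. k w * cnj (fourier_L2 \<phi> w)" "- ?s"] by simp
  finally have "gabor_coeff \<phi> \<alpha> \<beta> (inv_fourier h) j m
      = (LINT w|lborel. unit_exp (\<alpha> * \<beta> * of_int j * of_int m) * (k (- ?s + 1 * w) * cnj (fourier_L2 \<phi> (- ?s + 1 * w))))"
    by (simp add: gabor_coeff_def)
  also have "\<dots> = inv_fourier (\<lambda>w. h w * cnj (fourier_L2 \<phi> (w - ?s))) ?t"
    unfolding inv_fourier_unit_exp
  proof (rule Bochner_Integration.integral_cong[OF refl])
    fix w
    have "unit_exp (\<alpha> * \<beta> * of_int j * of_int m) * unit_exp (?t * (w - ?s)) = unit_exp (w * ?t)"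
      unfolding unit_exp_add[symmetric] by (simp add: algebra_simps)
    then show "unit_exp (\<alpha> * \<beta> * of_int j * of_int m) * (k (- ?s + 1 * w) * cnj (fourier_L2 \<phi> (- ?s + 1 * w)))
        = h w * cnj (fourier_L2 \<phi> (w - ?s)) * unit_exp (w * ?t)"
      by (simp add: k_def mult_ac)
  qed
  finally show ?thesis .
qed

lemma gabor_coeff_add:
  "f \<in> L2 \<Longrightarrow> g \<in> L2 \<Longrightarrow> \<phi> \<in> L2 \<Longrightarrow>
    gabor_coeff \<phi> \<alpha> \<beta> (\<lambda>x. f x + g x) j m = gabor_coeff \<phi> \<alpha> \<beta> f j m + gabor_coeff \<phi> \<alpha> \<beta> g j m"
  by (simp add: gabor_coeff_def L2_inner_add_left gabor_in_L2 distrib_left)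

lemma gabor_coeff_cmult: "gabor_coeff \<phi> \<alpha> \<beta> (\<lambda>x. c * f x) j m = c * gabor_coeff \<phi> \<alpha> \<beta> f j m"
  by (simp add: gabor_coeff_def L2_inner_cmult_left)

lemma norm_gabor_coeff: "cmod (gabor_coeff \<phi> \<alpha> \<beta> f j m) = cmod (L2_inner f (gabor \<phi> \<alpha> \<beta> (j, m)))"
  by (simp add: gabor_coeff_def norm_mult)

text \<open>Taking \<open>m\<close> over all integers makes the sum Hermitian, since
  \<open>m\<close> and \<open>-m\<close> exchange roles. At \<open>m = 0\<close> the diagonal term
  is a signed square: it doubles the coefficients with even \<open>j\<close> and cancels those with
  odd \<open>j\<close>, in agreement with the elements \<open>sqrt (2 * \<beta>)\<close> times
  \<open>gabor (2 * j, 0)\<close> of the Wilson system.\<close>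

definition wilson_term ::
  "(real \<Rightarrow> complex) \<Rightarrow> real \<Rightarrow> real \<Rightarrow> (real \<Rightarrow> complex) \<Rightarrow> (real \<Rightarrow> complex) \<Rightarrow> int \<times> int \<Rightarrow> complex" where
  "wilson_term \<phi> \<alpha> \<beta> f g = (\<lambda>(j, m). (- 1) powi (j + m) * gabor_coeff \<phi> \<alpha> \<beta> f j m * cnj (gabor_coeff \<phi> \<alpha> \<beta> g j (- m)))"

definition wilson_form ::
  "(real \<Rightarrow> complex) \<Rightarrow> real \<Rightarrow> real \<Rightarrow> (real \<Rightarrow> complex) \<Rightarrow> (real \<Rightarrow> complex) \<Rightarrow> complex" where
  "wilson_form \<phi> \<alpha> \<beta> f g = infsum (wilson_term \<phi> \<alpha> \<beta> f g) UNIV"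

text \<open>The common ground of both implications: tightness is a hypothesis in one and is derived
  beforehand in the other. It gives absolute convergence and boundedness of the form.\<close>

locale tight_gabor =
  fixes \<phi> :: "real \<Rightarrow> complex" and \<alpha> \<beta> :: real
  assumes window: "\<phi> \<in> L2" and \<alpha>_pos: "\<alpha> > 0" and \<beta>_pos: "\<beta> > 0"
    and tight: "\<And>f. f \<in> L2 \<Longrightarrow>
      ((\<lambda>(j, m). (cmod (gabor_coeff \<phi> \<alpha> \<beta> f j m))\<^sup>2) has_sum (inverse \<beta> * (L2_norm f)\<^sup>2)) UNIV"
begin

abbreviation coeff where "coeff \<equiv> gabor_coeff \<phi> \<alpha> \<beta>"
abbreviation wterm where "wterm \<equiv> wilson_term \<phi> \<alpha> \<beta>"
abbreviation wform where "wform \<equiv> wilson_form \<phi> \<alpha> \<beta>"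

lemma tight_reflected:
  assumes "f \<in> L2"
  shows "((\<lambda>(j, m). (cmod (coeff f j (- m)))\<^sup>2) has_sum (inverse \<beta> * (L2_norm f)\<^sup>2)) UNIV"
proof -
  have "bij_betw (\<lambda>(j :: int, m :: int). (j, - m)) UNIV UNIV"
    by (rule bij_betwI[where g = "\<lambda>(j, m). (j, - m)"]) auto
  from has_sum_reindex_bij_betw[OF this, of "\<lambda>(j, m). (cmod (coeff f j m))\<^sup>2"] tight[OF assms]
  show ?thesis
    by (simp add: split_def)
qed

lemma norm_term: "cmod (wterm f g (j, m)) = cmod (coeff f j m) * cmod (coeff g j (- m))"
  by (simp add: wilson_term_def norm_mult norm_power_int minus_one_powi)

text \<open>Cauchy-Schwarz on finite index sets; the second factor runs through the reflected
  coefficients, which satisfy the same identity.\<close>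

lemma sum_norm_term_le:
  assumes f: "f \<in> L2" and g: "g \<in> L2" and J: "finite J"
  shows "(\<Sum>p\<in>J. cmod (wterm f g p)) \<le> inverse \<beta> * L2_norm f * L2_norm g"
proof -
  let ?x = "\<lambda>p. cmod (coeff f (fst p) (snd p))" and ?y = "\<lambda>p. cmod (coeff g (fst p) (- snd p))"
  have "(\<Sum>p\<in>J. cmod (wterm f g p)) = (\<Sum>p\<in>J. \<bar>?x p\<bar> * \<bar>?y p\<bar>)"
    by (intro sum.cong refl) (auto simp: norm_term)
  also have "\<dots> \<le> L2_set ?x J * L2_set ?y J"
    by (rule L2_set_mult_ineq)
  also have "\<dots> \<le> sqrt (inverse \<beta> * (L2_norm f)\<^sup>2) * sqrt (inverse \<beta> * (L2_norm g)\<^sup>2)"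
  proof (rule mult_mono)
    have "(\<Sum>p\<in>J. (?x p)\<^sup>2) \<le> inverse \<beta> * (L2_norm f)\<^sup>2"
      by (rule finite_sum_le_has_sum[OF tight[OF f, unfolded split_def] J]) auto
    then show "L2_set ?x J \<le> sqrt (inverse \<beta> * (L2_norm f)\<^sup>2)"
      by (simp add: L2_set_def)
    have "(\<Sum>p\<in>J. (?y p)\<^sup>2) \<le> inverse \<beta> * (L2_norm g)\<^sup>2"
      by (rule finite_sum_le_has_sum[OF tight_reflected[OF g, unfolded split_def] J]) auto
    then show "L2_set ?y J \<le> sqrt (inverse \<beta> * (L2_norm g)\<^sup>2)"
      by (simp add: L2_set_def)
  qed (use \<beta>_pos in \<open>auto simp: L2_set_def sum_nonneg\<close>)
  also have "\<dots> = inverse \<beta> * L2_norm f * L2_norm g"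
    using \<beta>_pos real_sqrt_mult_self[of "inverse \<beta>"] by (simp add: real_sqrt_mult mult.assoc[symmetric])
  finally show ?thesis .
qed

lemma term_abs_summable:
  assumes f: "f \<in> L2" and g: "g \<in> L2"
  shows "(\<lambda>p. cmod (wterm f g p)) summable_on UNIV"
  by (rule nonneg_bdd_above_summable_on) (auto intro!: bdd_aboveI2 sum_norm_term_le f g)

lemma term_summable: "f \<in> L2 \<Longrightarrow> g \<in> L2 \<Longrightarrow> wterm f g summable_on UNIV"
  using term_abs_summable abs_summable_summable by blast

lemma norm_form_le:
  assumes f: "f \<in> L2" and g: "g \<in> L2"
  shows "cmod (wform f g) \<le> inverse \<beta> * L2_norm f * L2_norm g"
proof -
  have "cmod (wform f g) \<le> (\<Sum>\<^sub>\<infinity>p. cmod (wterm f g p))"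
    unfolding wilson_form_def by (rule norm_infsum_bound[OF term_abs_summable[OF f g]])
  also have "\<dots> \<le> inverse \<beta> * L2_norm f * L2_norm g"
    by (rule infsum_le_finite_sums[OF term_abs_summable[OF f g]]) (simp add: sum_norm_term_le f g)
  finally show ?thesis .
qed

lemma form_add_left:
  assumes "f \<in> L2" "g \<in> L2" "k \<in> L2"
  shows "wform (\<lambda>x. f x + g x) k = wform f k + wform g k"
proof -
  have "wterm (\<lambda>x. f x + g x) k = (\<lambda>p. wterm f k p + wterm g k p)"
    using assms window by (auto simp: wilson_term_def gabor_coeff_add algebra_simps fun_eq_iff)
  then show ?thesis
    unfolding wilson_form_def using assms by (simp add: infsum_add term_summable)
qed

lemma form_cmult_left: "wform (\<lambda>x. c * f x) k = c * wform f k"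
proof -
  have "wterm (\<lambda>x. c * f x) k = (\<lambda>p. c * wterm f k p)"
    by (auto simp: wilson_term_def gabor_coeff_cmult fun_eq_iff mult_ac)
  then show ?thesis
    unfolding wilson_form_def by (simp add: infsum_cmult_right')
qed

text \<open>Reflection in \<open>m\<close> swaps the two coefficients and leaves the sign
  \<open>(- 1) powi (j + m)\<close> unchanged. In particular the diagonal values are real.\<close>

lemma form_commute: "wform g f = cnj (wform f g)"
proof -
  have "bij_betw (\<lambda>(j :: int, m :: int). (j, - m)) UNIV UNIV"
    by (rule bij_betwI[where g = "\<lambda>(j, m). (j, - m)"]) auto
  from infsum_reindex_bij_betw[OF this, of "wterm g f"]
  have "wform g f = (\<Sum>\<^sub>\<infinity>p. wterm g f (fst p, - snd p))"
    by (simp add: wilson_form_def split_def)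
  also have "(\<lambda>p. wterm g f (fst p, - snd p)) = (\<lambda>p. cnj (wterm f g p))"
    by (auto simp: wilson_term_def fun_eq_iff cnj_minus_one_powi minus_one_powi_diff mult_ac)
  also have "(\<Sum>\<^sub>\<infinity>p. cnj (wterm f g p)) = cnj (wform f g)"
    by (simp add: wilson_form_def infsum_cnj)
  finally show ?thesis .
qed

lemma form_add_right:
  assumes "f \<in> L2" "g \<in> L2" "k \<in> L2"
  shows "wform k (\<lambda>x. f x + g x) = wform k f + wform k g"
  using assms by (subst (1 2 3) form_commute) (simp add: form_add_left)

lemma form_cmult_right: "wform k (\<lambda>x. c * f x) = cnj c * wform k f"
  by (subst (1 2) form_commute) (simp add: form_cmult_left)

lemma form_zero_left: "wform (\<lambda>x. 0) k = 0"
  using form_cmult_left[of 0 "\<lambda>x. 0" k] by simp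

lemma form_sum_left:
  assumes "finite A" "\<And>a. a \<in> A \<Longrightarrow> f a \<in> L2" "k \<in> L2"
  shows "wform (\<lambda>x. \<Sum>a\<in>A. f a x) k = (\<Sum>a\<in>A. wform (f a) k)"
  using assms by (induction A rule: finite_induct) (auto simp: form_zero_left form_add_left L2_sum)

lemma form_sum_right:
  assumes "finite A" "\<And>a. a \<in> A \<Longrightarrow> f a \<in> L2" "k \<in> L2"
  shows "wform k (\<lambda>x. \<Sum>a\<in>A. f a x) = (\<Sum>a\<in>A. wform k (f a))"
  using assms by (subst form_commute) (simp add: form_sum_left cnj_sum form_commute[of k])

lemma form_polarization:
  assumes zero: "\<And>f. f \<in> L2 \<Longrightarrow> wform f f = 0" and f: "f \<in> L2" and g: "g \<in> L2"
  shows "wform f g = 0"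
proof -
  \<comment> \<open>Only the cross terms of \<open>f + c * g\<close> survive; \<open>c = 1\<close>
    and \<open>c = \<i>\<close> make them vanish separately.\<close>
  have *: "cnj c * wform f g + c * wform g f = 0" for c
    using zero[OF L2_add[OF f L2_cmult[OF g, of c]]] zero[OF f] zero[OF g] f g
    by (simp add: form_add_left form_add_right form_cmult_left form_cmult_right L2_add L2_cmult)
  from *[of 1] *[of \<i>] show ?thesis
    by (simp add: algebra_simps)
qed

end

section \<open>The Wilson form on the Fourier side\<close>

lemma inv_fourier_translate:
  "inv_fourier (\<lambda>w. v (w + s)) x = unit_exp (- (s * x)) * inv_fourier v x"
proof -
  have "inv_fourier v x = (LINT w|lborel. v (s + 1 * w) * unit_exp ((s + 1 * w) * x))"
    unfolding inv_fourier_unit_exp using lborel_integral_real_affine[of 1 "\<lambda>w. v w * unit_exp (w * x)" s] by simp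
  also have "\<dots> = (LINT w|lborel. unit_exp (s * x) * (v (w + s) * unit_exp (w * x)))"
  proof (intro Bochner_Integration.integral_cong refl)
    fix w
    have "unit_exp ((s + 1 * w) * x) = unit_exp (s * x) * unit_exp (w * x)"
      unfolding unit_exp_add[symmetric] by (simp add: algebra_simps)
    then show "v (s + 1 * w) * unit_exp ((s + 1 * w) * x) = unit_exp (s * x) * (v (w + s) * unit_exp (w * x))"
      by (simp add: add.commute)
  qed
  also have "\<dots> = unit_exp (s * x) * inv_fourier (\<lambda>w. v (w + s)) x"
    unfolding inv_fourier_unit_exp by (rule integral_mult_right_zero)
  finally have "unit_exp (- (s * x)) * inv_fourier v x
      = unit_exp (- (s * x)) * unit_exp (s * x) * inv_fourier (\<lambda>w. v (w + s)) x"
    by simp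
  then show ?thesis
    by (simp flip: unit_exp_add)
qed

lemma inv_fourier_sum:
  assumes "finite A" "\<And>a. a \<in> A \<Longrightarrow> integrable lborel (u a)"
  shows "inv_fourier (\<lambda>w. \<Sum>a\<in>A. u a w) x = (\<Sum>a\<in>A. inv_fourier (u a) x)"
  unfolding inv_fourier_unit_exp sum_distrib_right
  using assms by (intro Bochner_Integration.integral_sum integrable_mult_unit_exp) auto

lemma Delta_measurable [measurable]:
  assumes "\<phi> \<in> L2"
  shows "Delta \<phi> \<alpha> \<beta> k \<in> borel_measurable borel"
proof -
  note [measurable] = L2_borel[OF fourier_L2_in_L2[OF assms]]
  show ?thesis
    unfolding Delta_def[abs_def] by measurable
qed

context tight_gabor
begin

text \<open>For fixed \<open>m\<close> the sign \<open>(-1) ^ j\<close> turns into a translation of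
  the second factor by \<open>s\<close>. Both factors are then supported in the same interval of
  length \<open>1 / \<beta>\<close>, so Parseval's identity sums over \<open>j\<close>; the
  remaining sum over \<open>m\<close> is the series of \<open>Delta\<close>.\<close>

lemma form_inv_fourier:
  fixes k :: int
  defines "s \<equiv> inverse \<beta> * (of_int k + 1 / 2)"
  assumes h: "h \<in> borel_measurable borel" "\<And>x. cmod (h x) \<le> M" "\<And>x. x \<notin> {a..a + inverse \<beta>} \<Longrightarrow> h x = 0"
    and g: "g \<in> borel_measurable borel" "\<And>x. cmod (g x) \<le> M'" "\<And>x. x \<notin> {a..a + inverse \<beta>} \<Longrightarrow> g (x + s) = 0"
  shows "integrable lborel (\<lambda>w. h w * cnj (g (w + s)) * cnj (Delta \<phi> \<alpha> \<beta> k w))"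
    "wform (inv_fourier h) (inv_fourier g)
      = of_real (inverse \<beta>) * (LINT w|lborel. h w * cnj (g (w + s)) * cnj (Delta \<phi> \<alpha> \<beta> k w))"
proof -
  note [measurable] = h(1) g(1)
  define \<Phi> where "\<Phi> = fourier_L2 \<phi>"
  have \<Phi>: "\<Phi> \<in> L2"
    unfolding \<Phi>_def by (rule fourier_L2_in_L2[OF window])
  note [measurable] = L2_borel[OF \<Phi>]
  have M: "0 \<le> M" "0 \<le> M'"
    using h(2)[of 0] g(2)[of 0] norm_ge_zero order_trans by blast+
  have h': "h \<in> L2" "integrable lborel h"
    using L2_bounded_support[OF h] by blast+
  have "x \<notin> {a + s..a + inverse \<beta> + s} \<Longrightarrow> g x = 0" for x
    using g(3)[of "x - s"] by auto
  then have g': "g \<in> L2" "integrable lborel g"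
    using L2_bounded_support[OF g(1,2)] by blast+
  have \<Phi>_translate: "(\<lambda>w. cnj (\<Phi> (w + t))) \<in> L2" for t
    by (intro L2_cnj L2_translate \<Phi>)
  define u where "u m w = h w * cnj (\<Phi> (w - \<alpha> * of_int m))" for m :: int and w
  define v where "v m w = g w * cnj (\<Phi> (w + \<alpha> * of_int m))" for m :: int and w
  have u: "u m \<in> L2" for m
    unfolding u_def[abs_def] using L2_bounded_mult[OF \<Phi>_translate[of "- \<alpha> * of_int m"] h(1,2)] by simp
  have v: "(\<lambda>w. v m (w + s)) \<in> L2" for m
    unfolding v_def[abs_def]
    by (rule L2_translate[OF L2_bounded_mult[OF \<Phi>_translate g(1,2)]])
  have term_eq: "wterm (inv_fourier h) (inv_fourier g) (j, m)
      = (- 1) powi m * (inv_fourier (u m) (of_int j / inverse \<beta>) * cnj (inv_fourier (\<lambda>w. v m (w + s)) (of_int j / inverse \<beta>)))" for j m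
  proof -
    \<comment> \<open>The integer \<open>k * j\<close> is invisible to the character, which is why
      every \<open>k\<close> is admissible for the same form.\<close>
    have "s * (\<beta> * of_int j) = of_int (k * j) + of_int j / 2"
      using \<beta>_pos by (simp add: s_def field_simps)
    then have "unit_exp (s * (\<beta> * of_int j)) = (- 1) powi j"
      by (simp only: unit_exp_add unit_exp_int minus_one_powi) simp
    then have "cnj (inv_fourier (\<lambda>w. v m (w + s)) (\<beta> * of_int j)) = (- 1) powi j * cnj (inv_fourier (v m) (\<beta> * of_int j))"
      by (simp add: inv_fourier_translate cnj_unit_exp)
    moreover have "coeff (inv_fourier h) j m = inv_fourier (u m) (\<beta> * of_int j)"
      unfolding u_def[abs_def] \<Phi>_def by (rule gabor_coeff_inv_fourier[OF h'(2,1) window])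
    moreover have "coeff (inv_fourier g) j (- m) = inv_fourier (v m) (\<beta> * of_int j)"
      unfolding v_def[abs_def] \<Phi>_def using gabor_coeff_inv_fourier[OF g'(2,1) window, of \<alpha> \<beta> j "- m"] by simp
    moreover have "of_int j / inverse \<beta> = \<beta> * of_int j"
      using \<beta>_pos by (simp add: field_simps)
    ultimately show ?thesis
      by (simp add: wilson_term_def power_int_add mult_ac)
  qed
  define F where "F m w = (- 1) powi m * (u m w * cnj (v m (w + s)))" for m w
  have [measurable]: "F m \<in> borel_measurable borel" for m
    unfolding F_def[abs_def] u_def v_def by measurable
  have inner: "(\<Sum>\<^sub>\<infinity>j. wterm (inv_fourier h) (inv_fourier g) (j, m)) = of_real (inverse \<beta>) * (LINT w|lborel. F m w)" for m
  proof -
    have "((\<lambda>j. wterm (inv_fourier h) (inv_fourier g) (j, m)) has_sum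
        (- 1) powi m * (of_real (inverse \<beta>) * L2_inner (u m) (\<lambda>w. v m (w + s)))) UNIV"
      unfolding term_eq
      by (intro has_sum_cmult_right inv_fourier_parseval_inner[where a = a] u v)
        (use \<beta>_pos h g in \<open>auto simp: u_def v_def\<close>)
    moreover have "(LINT w|lborel. F m w) = (- 1) powi m * L2_inner (u m) (\<lambda>w. v m (w + s))"
      unfolding F_def L2_inner_def by (rule integral_mult_right_zero)
    ultimately show ?thesis
      by (simp add: infsumI mult_ac)
  qed
  \<comment> \<open>Absolute convergence for exchanging sum and integral: the product of two windows
    is at most the sum of their squares, and over a bounded interval the translates of each square
    have finite total mass.\<close>
  have fin: "(\<integral>\<^sup>+m. (\<integral>\<^sup>+w. ennreal (cmod (F m w)) \<partial>lborel) \<partial>count_space UNIV) < \<infinity>"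
  proof -
    let ?A = "\<lambda>m :: int. \<lambda>w. ennreal ((cmod (\<Phi> (w + 0 + - \<alpha> * of_int m)))\<^sup>2) * indicator {a..a + inverse \<beta>} w"
    let ?B = "\<lambda>m :: int. \<lambda>w. ennreal ((cmod (\<Phi> (w + s + \<alpha> * of_int m)))\<^sup>2) * indicator {a..a + inverse \<beta>} w"
    have le: "ennreal (cmod (F m w)) \<le> ennreal (M * M') * (?A m w + ?B m w)" for m w
    proof (cases "w \<in> {a..a + inverse \<beta>}")
      case True
      let ?x = "cmod (\<Phi> (w - \<alpha> * of_int m))" and ?y = "cmod (\<Phi> (w + s + \<alpha> * of_int m))"
      have "cmod (F m w) = (cmod (h w) * cmod (g (w + s))) * (?x * ?y)"
        by (simp add: F_def u_def v_def norm_mult minus_one_powi)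
      also have "\<dots> \<le> (M * M') * (?x\<^sup>2 + ?y\<^sup>2)"
      proof (rule mult_mono)
        show "cmod (h w) * cmod (g (w + s)) \<le> M * M'"
          by (intro mult_mono h g M) simp
        have "2 * ?x * ?y \<le> ?x\<^sup>2 + ?y\<^sup>2" "0 \<le> ?x * ?y"
          by (simp_all add: sum_squares_bound)
        then show "?x * ?y \<le> ?x\<^sup>2 + ?y\<^sup>2"
          by linarith
      qed (use M in auto)
      finally show ?thesis
        using True M by (simp add: ennreal_leI flip: ennreal_mult ennreal_plus)
    qed (simp add: F_def u_def h)
    have "(\<integral>\<^sup>+m. (\<integral>\<^sup>+w. ennreal (cmod (F m w)) \<partial>lborel) \<partial>count_space UNIV)
        \<le> (\<integral>\<^sup>+m. (\<integral>\<^sup>+w. ennreal (M * M') * (?A m w + ?B m w) \<partial>lborel) \<partial>count_space UNIV)"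
      by (intro nn_integral_mono le)
    also have "\<dots> = ennreal (M * M') * ((\<integral>\<^sup>+m. (\<integral>\<^sup>+w. ?A m w \<partial>lborel) \<partial>count_space UNIV)
        + (\<integral>\<^sup>+m. (\<integral>\<^sup>+w. ?B m w \<partial>lborel) \<partial>count_space UNIV))"
      by (simp add: nn_integral_cmult nn_integral_add)
    also have "\<dots> < \<infinity>"
      using nn_integral_translates_finite[OF \<Phi>, of "- \<alpha>" 0 a "a + inverse \<beta>"]
        nn_integral_translates_finite[OF \<Phi>, of \<alpha> s a "a + inverse \<beta>"] \<alpha>_pos
      by (simp add: ennreal_mult_less_top)
    finally show ?thesis .
  qed
  have sum_F: "(\<Sum>\<^sub>\<infinity>m. F m w) = h w * cnj (g (w + s)) * cnj (Delta \<phi> \<alpha> \<beta> k w)" for w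
  proof -
    let ?D = "\<lambda>m :: int. (- 1) powi m * \<Phi> (w + \<alpha> * of_int m) * cnj (\<Phi> (w + s - \<alpha> * of_int m))"
    \<comment> \<open>The windows enter conjugated and with \<open>m\<close> reflected relative to
      \<open>Delta\<close>; the reindexing by \<open>-m\<close> repairs the latter.\<close>
    have "F m w = h w * cnj (g (w + s)) * cnj (?D (- m))" for m
      by (simp add: F_def u_def v_def minus_one_powi_minus cnj_minus_one_powi mult_ac add_ac)
    then have "(\<Sum>\<^sub>\<infinity>m. F m w) = h w * cnj (g (w + s)) * (\<Sum>\<^sub>\<infinity>m. cnj (?D (- m)))"
      by (simp add: infsum_cmult_right')
    also have "(\<Sum>\<^sub>\<infinity>m. cnj (?D (- m))) = (\<Sum>\<^sub>\<infinity>m. cnj (?D m))"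
      by (rule infsum_reindex_bij_betw[of uminus]) (rule bij_uminus)
    also have "\<dots> = cnj (Delta \<phi> \<alpha> \<beta> k w)"
      by (simp only: infsum_cnj Delta_def \<Phi>_def s_def)
    finally show ?thesis .
  qed
  note swap = integral_infsum_int[of F, OF _ fin, unfolded sum_F]
  show "integrable lborel (\<lambda>w. h w * cnj (g (w + s)) * cnj (Delta \<phi> \<alpha> \<beta> k w))"
    by (rule swap) measurable
  have summ: "wterm (inv_fourier h) (inv_fourier g) summable_on UNIV \<times> UNIV"
    using term_summable[OF inv_fourier_in_L2[OF h'(2,1)] inv_fourier_in_L2[OF g'(2,1)]] by simp
  have "wform (inv_fourier h) (inv_fourier g) = (\<Sum>\<^sub>\<infinity>j. \<Sum>\<^sub>\<infinity>m. wterm (inv_fourier h) (inv_fourier g) (j, m))"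
    unfolding wilson_form_def using infsum_Sigma_banach[OF summ] by simp
  also have "\<dots> = (\<Sum>\<^sub>\<infinity>m. \<Sum>\<^sub>\<infinity>j. wterm (inv_fourier h) (inv_fourier g) (j, m))"
    by (rule infsum_swap_banach) (use summ in \<open>simp add: split_def\<close>)
  also have "\<dots> = of_real (inverse \<beta>) * (\<Sum>\<^sub>\<infinity>m. (LINT w|lborel. F m w))"
    unfolding inner by (rule infsum_cmult_right')
  also have "(\<Sum>\<^sub>\<infinity>m. (LINT w|lborel. F m w)) = (LINT w|lborel. h w * cnj (g (w + s)) * cnj (Delta \<phi> \<alpha> \<beta> k w))"
    by (rule swap(2)[symmetric]) measurable
  finally show "wform (inv_fourier h) (inv_fourier g)
      = of_real (inverse \<beta>) * (LINT w|lborel. h w * cnj (g (w + s)) * cnj (Delta \<phi> \<alpha> \<beta> k w))" .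
qed

text \<open>Choosing \<open>h\<close> as the phase of \<open>Delta\<close> on an interval and
  \<open>g\<close> as the indicator of its translate makes the form a positive multiple of the
  integral of \<open>cmod (D w)\<close> over that interval.\<close>

lemma Delta_AE_zero:
  assumes zero: "\<And>f. f \<in> L2 \<Longrightarrow> wform f f = 0"
  shows "AE \<xi> in lborel. Delta \<phi> \<alpha> \<beta> k \<xi> = 0"
proof -
  note [measurable] = Delta_measurable[OF window]
  define D where "D = Delta \<phi> \<alpha> \<beta> k"
  have [measurable]: "D \<in> borel_measurable borel"
    unfolding D_def by measurable
  define s where "s = inverse \<beta> * (of_int k + 1 / 2)"
  have "AE \<xi> in lborel. \<xi> \<in> {a..a + inverse \<beta>} \<longrightarrow> D \<xi> = 0" for a
  proof -
    let ?I = "{a..a + inverse \<beta>}"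
    \<comment> \<open>At zeros of \<open>D\<close> the quotient is 0, so \<open>h\<close> remains
      bounded by 1.\<close>
    define h where "h w = (if w \<in> ?I then D w / of_real (cmod (D w)) else 0)" for w
    define g :: "real \<Rightarrow> complex" where "g w = indicator {a + s..a + inverse \<beta> + s} w" for w
    have h: "h \<in> borel_measurable borel" "\<And>x. cmod (h x) \<le> 1" "\<And>x. x \<notin> ?I \<Longrightarrow> h x = 0"
      unfolding h_def[abs_def] by (measurable, auto simp: norm_divide)
    have g: "g \<in> borel_measurable borel" "\<And>x. cmod (g x) \<le> 1" "\<And>x. x \<notin> ?I \<Longrightarrow> g (x + s) = 0"
      unfolding g_def[abs_def] by (measurable, auto simp: indicator_def)
    have hL2: "h \<in> L2" "integrable lborel h"
      using L2_bounded_support[OF h] by blast+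
    have gL2: "g \<in> L2" "integrable lborel g"
      by (rule L2_bounded_support[OF g(1,2), of "a + s" "a + inverse \<beta> + s"]; simp add: g_def)+
    have hgD: "h w * cnj (g (w + s)) * cnj (D w) = of_real (indicator ?I w * cmod (D w))" for w
    proof (cases "w \<in> ?I \<and> D w \<noteq> 0")
      case True
      then have "h w * cnj (g (w + s)) * cnj (D w) = D w * cnj (D w) / of_real (cmod (D w))"
        by (simp add: h_def g_def)
      also have "\<dots> = of_real ((cmod (D w))\<^sup>2 / cmod (D w))"
        by (simp only: of_real_divide complex_norm_square)
      finally show ?thesis
        using True by (simp add: power2_eq_square)
    qed (auto simp: h_def)
    note key = form_inv_fourier[of h 1 a g 1 k, folded s_def D_def, OF h g, unfolded hgD]
    have int: "integrable lborel (\<lambda>w. indicator ?I w * cmod (D w))"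
      using integrable_Re[OF key(1)] by simp
    have form0: "wform (inv_fourier h) (inv_fourier g) = 0"
      by (rule form_polarization[OF zero inv_fourier_in_L2[OF hL2(2,1)] inv_fourier_in_L2[OF gL2(2,1)]])
    have "complex_of_real (inverse \<beta>) * complex_of_real (LINT w|lborel. indicator ?I w * cmod (D w)) = 0"
      using key(2) unfolding form0 integral_complex_of_real by (rule sym)
    then have "(LINT w|lborel. indicator ?I w * cmod (D w)) = 0"
      using \<beta>_pos by simp
    then have "AE w in lborel. indicator ?I w * cmod (D w) = 0"
      using integral_nonneg_eq_0_iff_AE[OF int] by simp
    then show ?thesis
      by eventually_elim (auto simp: indicator_def)
  qed
  then have "AE \<xi> in lborel. \<forall>n :: int. \<xi> \<in> {of_int n * inverse \<beta>..of_int n * inverse \<beta> + inverse \<beta>} \<longrightarrow> D \<xi> = 0"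
    by (intro AE_all_countable[THEN iffD2] allI)
  then show ?thesis
  proof eventually_elim
    case (elim \<xi>)
    have "of_int \<lfloor>\<xi> * \<beta>\<rfloor> \<le> \<xi> * \<beta>" "\<xi> * \<beta> \<le> of_int \<lfloor>\<xi> * \<beta>\<rfloor> + 1"
      by linarith+
    then have "\<xi> \<in> {of_int \<lfloor>\<xi> * \<beta>\<rfloor> * inverse \<beta>..of_int \<lfloor>\<xi> * \<beta>\<rfloor> * inverse \<beta> + inverse \<beta>}"
      using \<beta>_pos by (simp add: field_simps)
    then show ?case
      using elim by (auto simp: D_def)
  qed
qed

text \<open>The admissible shifts are the odd multiples of the cell length \<open>l\<close>. An
  interval of two cells absorbs the parity: after a suitable shift, cell \<open>b\<close> lands on
  cell \<open>a\<close> or on its right neighbour.\<close>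

lemma form_zero_cells:
  fixes a b :: int
  defines "l \<equiv> inverse \<beta> / 2"
  assumes D: "\<And>k. AE \<xi> in lborel. Delta \<phi> \<alpha> \<beta> k \<xi> = 0"
    and h: "h \<in> borel_measurable borel" "\<And>x. cmod (h x) \<le> M" "\<And>x. x \<notin> {of_int a * l..of_int (a + 1) * l} \<Longrightarrow> h x = 0"
    and g: "g \<in> borel_measurable borel" "\<And>x. cmod (g x) \<le> M'" "\<And>x. x \<notin> {of_int b * l..of_int (b + 1) * l} \<Longrightarrow> g x = 0"
  shows "wform (inv_fourier h) (inv_fourier g) = 0"
proof -
  have l: "l > 0" "inverse \<beta> = 2 * l"
    using \<beta>_pos by (auto simp: l_def)
  \<comment> \<open>The remainder \<open>r\<close> tells on which of the two cells the translate of
    \<open>g\<close> falls, since \<open>b - (2 * k + 1) = a + r\<close>.\<close>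
  define k where "k = (b - 1 - a) div 2"
  define r where "r = (b - 1 - a) mod 2"
  have r: "b = 2 * k + 1 + a + r" "r = 0 \<or> r = 1"
    unfolding k_def r_def by presburger+
  define s where "s = inverse \<beta> * (of_int k + 1 / 2)"
  have s: "s = of_int (2 * k + 1) * l"
    by (simp add: s_def l algebra_simps)
  have h0: "h x = 0" if "x \<notin> {of_int a * l..of_int a * l + inverse \<beta>}" for x
    by (rule h(3)) (use that l in \<open>auto simp: algebra_simps\<close>)
  have g0: "g (x + s) = 0" if "x \<notin> {of_int a * l..of_int a * l + inverse \<beta>}" for x
  proof (rule g(3))
    show "x + s \<notin> {of_int b * l..of_int (b + 1) * l}"
      using that r(2) l unfolding s r(1) by (auto simp: algebra_simps)
  qed
  have "wform (inv_fourier h) (inv_fourier g) = of_real (inverse \<beta>)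
      * (LINT w|lborel. h w * cnj (g (w + s)) * cnj (Delta \<phi> \<alpha> \<beta> k w))"
    using form_inv_fourier(2)[of h M "of_int a * l" g M' k, folded s_def, OF h(1,2) h0 g(1,2) g0] .
  also have "(LINT w|lborel. h w * cnj (g (w + s)) * cnj (Delta \<phi> \<alpha> \<beta> k w)) = 0"
    by (rule integral_eq_zero_AE) (use D[of k] in eventually_elim, simp)
  finally show ?thesis
    by simp
qed

lemma form_zero_bounded:
  assumes D: "\<And>k. AE \<xi> in lborel. Delta \<phi> \<alpha> \<beta> k \<xi> = 0"
    and h: "h \<in> borel_measurable borel" "\<And>x. cmod (h x) \<le> M" "\<And>x. \<bar>x\<bar> > N \<Longrightarrow> h x = 0"
  shows "wform (inv_fourier h) (inv_fourier h) = 0"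
proof -
  note [measurable] = h(1)
  define l where "l = inverse \<beta> / 2"
  have l: "l > 0"
    using \<beta>_pos by (simp add: l_def)
  define A where "A = {\<lfloor>- N / l\<rfloor>..\<lfloor>N / l\<rfloor>}"
  have A: "finite A"
    by (simp add: A_def)
  \<comment> \<open>Half-open cells make the decomposition of \<open>h\<close> exact at every point;
    the closed cells in \<open>form_zero_cells\<close> contain them.\<close>
  define p where "p a w = (if \<lfloor>w / l\<rfloor> = a then h w else 0)" for a :: int and w
  have p: "p a \<in> borel_measurable borel" "cmod (p a x) \<le> M" for a x
    unfolding p_def[abs_def] using h(2)[of x] norm_ge_zero[of "h x"] by (measurable, auto simp del: norm_ge_zero)
  have p0: "p a x = 0" if "x \<notin> {of_int a * l..of_int (a + 1) * l}" for a x
  proof (rule ccontr)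
    assume "p a x \<noteq> 0"
    then have "\<lfloor>x / l\<rfloor> = a"
      by (auto simp: p_def split: if_splits)
    then have "of_int a \<le> x / l" "x / l \<le> of_int (a + 1)"
      by linarith+
    then show False
      using that l by (simp add: field_simps)
  qed
  have pL2: "p a \<in> L2" "integrable lborel (p a)" for a
    using L2_bounded_support[OF p p0] by blast+
  have h_eq: "h = (\<lambda>w. \<Sum>a\<in>A. p a w)"
  proof
    fix w
    show "h w = (\<Sum>a\<in>A. p a w)"
    proof (cases "\<bar>w\<bar> > N")
      case False
      then have "- N / l \<le> w / l" "w / l \<le> N / l"
        using l by (auto intro!: divide_right_mono simp del: divide_minus_left)
      then have "\<lfloor>w / l\<rfloor> \<in> A"
        by (auto simp: A_def intro!: floor_mono simp del: divide_minus_left)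
      then show ?thesis
        using A by (simp add: p_def)
    next
      case True
      then have "h w = 0"
        by (rule h(3))
      then have "p a w = 0" for a
        by (simp add: p_def)
      with \<open>h w = 0\<close> show ?thesis
        by simp
    qed
  qed
  have "inv_fourier h = (\<lambda>x. \<Sum>a\<in>A. inv_fourier (p a) x)"
    by (subst h_eq) (rule ext, rule inv_fourier_sum[OF A pL2(2)])
  moreover have "wform (inv_fourier (p a)) (inv_fourier (p b)) = 0" for a b
    using form_zero_cells[of "p a" M a "p b" M b, folded l_def, OF D p p0 p p0] .
  ultimately show ?thesis
    using A by (simp add: form_sum_left form_sum_right L2_sum inv_fourier_in_L2 pL2)
qed

text \<open>The form is bounded on L2 and vanishes on the diagonal at the dense inverse transforms
  of truncations; replacing one argument at a time controls the error.\<close>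

lemma form_zero:
  assumes D: "\<And>k. AE \<xi> in lborel. Delta \<phi> \<alpha> \<beta> k \<xi> = 0" and f: "f \<in> L2"
  shows "wform f f = 0"
proof -
  define t where "t = L2_trunc (fourier_L2 f)"
  note t = L2_truncation[OF fourier_L2_in_L2[OF f], folded t_def]
  define q where "q n = inv_fourier (t n)" for n
  have q: "q n \<in> L2" for n
    unfolding q_def by (intro inv_fourier_in_L2 t)
  have conv: "L2_converges q f"
    using inv_fourier_dense[OF f] by (simp add: q_def[abs_def] t_def)
  have qq: "wform (q n) (q n) = 0" for n
    unfolding q_def by (rule form_zero_bounded[OF D t(3), of n "real n" "real n"]) (auto simp: t_def L2_trunc_def)
  let ?d = "\<lambda>n x. f x - q n x"
  have le: "cmod (wform f f) \<le> inverse \<beta> * (L2_norm (\<lambda>x. q n x - f x) * L2_norm f + L2_norm (q n) * L2_norm (\<lambda>x. q n x - f x))" for n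
  proof -
    have d: "?d n \<in> L2"
      by (intro L2_diff f q)
    have f_eq: "f = (\<lambda>x. ?d n x + q n x)"
      by simp
    have "wform f f = wform (?d n) f + wform (q n) f"
      by (subst (1) f_eq) (rule form_add_left[OF d q f])
    also have "wform (q n) f = wform (q n) (?d n) + wform (q n) (q n)"
      by (subst (1) f_eq) (rule form_add_right[OF d q q])
    finally have "cmod (wform f f) \<le> cmod (wform (?d n) f) + cmod (wform (q n) (?d n))"
      using norm_triangle_ineq[of "wform (?d n) f" "wform (q n) (?d n)"] by (simp add: qq)
    also have "\<dots> \<le> inverse \<beta> * L2_norm (?d n) * L2_norm f + inverse \<beta> * L2_norm (q n) * L2_norm (?d n)"
      by (intro add_mono norm_form_le d f q)
    finally show ?thesis
      by (simp add: L2_norm_minus[of f] algebra_simps)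
  qed
  have "(\<lambda>n. inverse \<beta> * (L2_norm (\<lambda>x. q n x - f x) * L2_norm f + L2_norm (q n) * L2_norm (\<lambda>x. q n x - f x)))
      \<longlonglongrightarrow> inverse \<beta> * (0 * L2_norm f + L2_norm f * 0)"
    by (intro tendsto_intros L2_converges_norm[OF q f conv])
      (use conv in \<open>simp_all add: L2_converges_iff[OF q f]\<close>)
  then have "cmod (wform f f) \<le> inverse \<beta> * (0 * L2_norm f + L2_norm f * 0)"
    by (rule LIMSEQ_le_const) (use le in blast)
  then show ?thesis
    by simp
qed

lemma Delta_AE_zero_iff:
  "(\<forall>k. AE \<xi> in lborel. Delta \<phi> \<alpha> \<beta> k \<xi> = 0) \<longleftrightarrow> (\<forall>f\<in>L2. wform f f = 0)"
  using Delta_AE_zero form_zero by blast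

end

section \<open>Wilson systems\<close>

text \<open>The summand \<open>t (2 * j - 1, 0)\<close> belongs to the Wilson system of the translate by \<open>\<beta>\<close>; it vanishes
  for the Wilson sum of a single function.\<close>

definition wilson_fold :: "(int \<times> int \<Rightarrow> real) \<Rightarrow> int \<times> nat \<Rightarrow> real" where
  "wilson_fold t = (\<lambda>(j, m). if m = 0 then t (2 * j, 0) + t (2 * j - 1, 0) else t (j, int m) + t (j, - int m))"

lemma wilson_fold_bij:
  "bij_betw (\<lambda>(j, m). (j, int m)) (UNIV \<times> {1..}) (UNIV \<times> {1..} :: (int \<times> int) set)"
  "bij_betw (\<lambda>(j, m). (j, - int m)) (UNIV \<times> {1..}) (UNIV \<times> {..-1} :: (int \<times> int) set)"
  "bij_betw (\<lambda>(j, m). (2 * j, 0)) (UNIV \<times> {0 :: nat}) ({j. even j} \<times> {0} :: (int \<times> int) set)"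
  "bij_betw (\<lambda>(j, m). (2 * j - 1, 0)) (UNIV \<times> {0 :: nat}) ({j. odd j} \<times> {0} :: (int \<times> int) set)"
proof -
  show "bij_betw (\<lambda>(j, m). (j, int m)) (UNIV \<times> {1..}) (UNIV \<times> {1..} :: (int \<times> int) set)"
    by (rule bij_betwI[where g = "\<lambda>(j, m). (j, nat m)"]) auto
  show "bij_betw (\<lambda>(j, m). (j, - int m)) (UNIV \<times> {1..}) (UNIV \<times> {..-1} :: (int \<times> int) set)"
    by (rule bij_betwI[where g = "\<lambda>(j, m). (j, nat (- m))"]) auto
  show "bij_betw (\<lambda>(j, m). (2 * j, 0)) (UNIV \<times> {0 :: nat}) ({j. even j} \<times> {0} :: (int \<times> int) set)"
    by (rule bij_betwI[where g = "\<lambda>(j, m). (j div 2, 0)"]) auto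
  show "bij_betw (\<lambda>(j, m). (2 * j - 1, 0)) (UNIV \<times> {0 :: nat}) ({j. odd j} \<times> {0} :: (int \<times> int) set)"
    by (rule bij_betwI[where g = "\<lambda>(j, m). ((j + 1) div 2, 0)"]) (auto, presburger)
qed

text \<open>The index plane splits into \<open>m > 0\<close>, \<open>m < 0\<close>, and the row
  \<open>m = 0\<close> with \<open>j\<close> even or odd. Folding merely adds two pieces at a time
  along bijections.\<close>

lemma has_sum_wilson_fold:
  assumes t: "(t has_sum S) UNIV"
  shows "(wilson_fold t has_sum S) UNIV"
proof -
  let ?P = "UNIV \<times> {1..} :: (int \<times> int) set" and ?N = "UNIV \<times> {..-1} :: (int \<times> int) set"
  let ?E = "{j. even j} \<times> {0} :: (int \<times> int) set" and ?O = "{j. odd j} \<times> {0} :: (int \<times> int) set"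
  have sub: "(t has_sum infsum t X) X" for X
    by (rule has_sum_infsum, rule summable_on_subset_banach[OF has_sum_imp_summable[OF t]]) simp
  have PN: "((\<lambda>(j, m). t (j, int m) + t (j, - int m)) has_sum infsum t ?P + infsum t ?N) (UNIV \<times> {1..})"
    using has_sum_add[OF has_sum_reindex_bij_betw[OF wilson_fold_bij(1), THEN iffD2, OF sub]
        has_sum_reindex_bij_betw[OF wilson_fold_bij(2), THEN iffD2, OF sub]] by (simp add: split_def)
  have EO: "((\<lambda>(j, m). t (2 * j, 0) + t (2 * j - 1, 0)) has_sum infsum t ?E + infsum t ?O) (UNIV \<times> {0 :: nat})"
    using has_sum_add[OF has_sum_reindex_bij_betw[OF wilson_fold_bij(3), THEN iffD2, OF sub]
        has_sum_reindex_bij_betw[OF wilson_fold_bij(4), THEN iffD2, OF sub]] by (simp add: split_def)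
  have 1: "(wilson_fold t has_sum infsum t ?P + infsum t ?N) (UNIV \<times> {1..})"
    using PN by (rule has_sum_cong[THEN iffD1, rotated]) (auto simp: wilson_fold_def)
  have 2: "(wilson_fold t has_sum infsum t ?E + infsum t ?O) (UNIV \<times> {0})"
    using EO by (rule has_sum_cong[THEN iffD1, rotated]) (auto simp: wilson_fold_def)
  have "(wilson_fold t has_sum (infsum t ?P + infsum t ?N) + (infsum t ?E + infsum t ?O)) (UNIV \<times> {1..} \<union> UNIV \<times> {0})"
    by (rule has_sum_Un_disjoint[OF 1 2]) auto
  also have "UNIV \<times> {1..} \<union> UNIV \<times> {0} = (UNIV :: (int \<times> nat) set)"
    by (auto simp: Suc_le_eq)
  finally have fold: "(wilson_fold t has_sum (infsum t ?P + infsum t ?N) + (infsum t ?E + infsum t ?O)) UNIV" .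
  have "(t has_sum (infsum t ?P + infsum t ?N) + (infsum t ?E + infsum t ?O)) ((?P \<union> ?N) \<union> (?E \<union> ?O))"
    by (intro has_sum_Un_disjoint sub) auto
  also have "(?P \<union> ?N) \<union> (?E \<union> ?O) = UNIV"
    by auto
  finally have "S = (infsum t ?P + infsum t ?N) + (infsum t ?E + infsum t ?O)"
    using t has_sum_unique by blast
  then show ?thesis
    using fold by simp
qed

text \<open>Coming from the Wilson side, only the folded family is known to be summable.
  Nonnegativity excludes cancellation, so each of the four pieces is dominated by the fold.\<close>

lemma summable_on_wilson_unfold:
  assumes nonneg: "\<And>p. 0 \<le> t p" and sum: "wilson_fold t summable_on UNIV"
  shows "t summable_on UNIV"
proof -
  let ?P = "UNIV \<times> {1..} :: (int \<times> int) set" and ?N = "UNIV \<times> {..-1} :: (int \<times> int) set"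
  let ?E = "{j. even j} \<times> {0} :: (int \<times> int) set" and ?O = "{j. odd j} \<times> {0} :: (int \<times> int) set"
  have comp: "g summable_on A" if "\<And>p. p \<in> A \<Longrightarrow> 0 \<le> g p" "\<And>p. p \<in> A \<Longrightarrow> g p \<le> wilson_fold t p" for g A
    by (rule summable_on_comparison_test[OF summable_on_subset_banach[OF sum]]) (use that in auto)
  have "t summable_on ?P"
    by (rule summable_on_reindex_bij_betw[OF wilson_fold_bij(1), THEN iffD1], rule comp)
      (auto simp: nonneg wilson_fold_def)
  moreover have "t summable_on ?N"
    by (rule summable_on_reindex_bij_betw[OF wilson_fold_bij(2), THEN iffD1], rule comp)
      (auto simp: nonneg wilson_fold_def)
  moreover have "t summable_on ?E"
    by (rule summable_on_reindex_bij_betw[OF wilson_fold_bij(3), THEN iffD1], rule comp)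
      (auto simp: nonneg wilson_fold_def)
  moreover have "t summable_on ?O"
    by (rule summable_on_reindex_bij_betw[OF wilson_fold_bij(4), THEN iffD1], rule comp)
      (auto simp: nonneg wilson_fold_def)
  ultimately have "t summable_on ((?P \<union> ?N) \<union> (?E \<union> ?O))"
    by (intro summable_on_Un_disjoint) auto
  also have "(?P \<union> ?N) \<union> (?E \<union> ?O) = UNIV"
    by auto
  finally show ?thesis .
qed

section \<open>Wilson coefficients in terms of Gabor coefficients\<close>

lemma wilson_eq:
  "wilson \<phi> \<alpha> \<beta> (j, 0) = (\<lambda>x. of_real (sqrt (2 * \<beta>)) * gabor \<phi> \<alpha> \<beta> (2 * j, 0) x)"
  "m > 0 \<Longrightarrow> wilson \<phi> \<alpha> \<beta> (j, m) = (\<lambda>x. of_real (sqrt \<beta>) *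
     (unit_exp (- (\<alpha> * \<beta> * of_int j * of_nat m)) * gabor \<phi> \<alpha> \<beta> (j, int m) x
      + (- 1) powi (j + int m) * unit_exp (\<alpha> * \<beta> * of_int j * of_nat m) * gabor \<phi> \<alpha> \<beta> (j, - int m) x))"
proof -
  show "wilson \<phi> \<alpha> \<beta> (j, 0) = (\<lambda>x. of_real (sqrt (2 * \<beta>)) * gabor \<phi> \<alpha> \<beta> (2 * j, 0) x)"
    by (simp add: wilson_def)
  have "exp (2 * complex_of_real pi * \<i> * complex_of_real (\<beta> * of_int j * \<alpha> * of_nat m)) = unit_exp (\<alpha> * \<beta> * of_int j * of_nat m)"
    unfolding exp_conv_unit_exp by (simp add: mult_ac)
  moreover have "exp (- 2 * complex_of_real pi * \<i> * complex_of_real (\<beta> * of_int j * \<alpha> * of_nat m)) = unit_exp (- (\<alpha> * \<beta> * of_int j * of_nat m))"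
    using exp_conv_unit_exp[of "- (\<alpha> * \<beta> * of_int j * of_nat m)"] by (simp add: mult_ac)
  moreover assume "m > 0"
  ultimately show "wilson \<phi> \<alpha> \<beta> (j, m) = (\<lambda>x. of_real (sqrt \<beta>) *
     (unit_exp (- (\<alpha> * \<beta> * of_int j * of_nat m)) * gabor \<phi> \<alpha> \<beta> (j, int m) x
      + (- 1) powi (j + int m) * unit_exp (\<alpha> * \<beta> * of_int j * of_nat m) * gabor \<phi> \<alpha> \<beta> (j, - int m) x))"
    by (simp only: wilson_def prod.case) simp
qed

lemma wilson_in_L2:
  assumes "\<phi> \<in> L2"
  shows "wilson \<phi> \<alpha> \<beta> p \<in> L2"
proof (cases p)
  case (Pair j m)
  show ?thesis
    unfolding Pair by (cases "m = 0") (simp_all only: wilson_eq neq0_conv, auto intro!: L2_cmult L2_add gabor_in_L2 assms)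
qed

lemma wilson_inner_zero: "L2_inner f (wilson \<phi> \<alpha> \<beta> (j, 0)) = of_real (sqrt (2 * \<beta>)) * gabor_coeff \<phi> \<alpha> \<beta> f (2 * j) 0"
  unfolding wilson_eq(1) L2_inner_cmult_right by (simp add: gabor_coeff_def)

lemma wilson_inner_pos:
  assumes "m > 0" "f \<in> L2" "\<phi> \<in> L2"
  shows "L2_inner f (wilson \<phi> \<alpha> \<beta> (j, m))
    = of_real (sqrt \<beta>) * (gabor_coeff \<phi> \<alpha> \<beta> f j (int m) + (- 1) powi (j + int m) * gabor_coeff \<phi> \<alpha> \<beta> f j (- int m))"
  unfolding wilson_eq(2)[OF assms(1)] L2_inner_cmult_right
  using assms
  by (simp only: L2_inner_add_right L2_cmult gabor_in_L2 L2_inner_cmult_right)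
    (simp add: gabor_coeff_def cnj_unit_exp cnj_minus_one_powi mult.assoc)

text \<open>The phase in \<open>gabor_coeff\<close> exactly compensates the factor from translating
  the modulation. The pure shift of \<open>j\<close> by one leaves the moduli alone and flips the
  sign between frequencies \<open>m\<close> and \<open>-m\<close>.\<close>

lemma gabor_coeff_translate:
  "gabor_coeff \<phi> \<alpha> \<beta> (\<lambda>x. f (x - \<beta>)) j m = gabor_coeff \<phi> \<alpha> \<beta> f (j - 1) m"
proof -
  have "L2_inner (\<lambda>x. f (x - \<beta>)) (gabor \<phi> \<alpha> \<beta> (j, m)) = (LINT x|lborel. f (\<beta> + 1 * x - \<beta>) * cnj (gabor \<phi> \<alpha> \<beta> (j, m) (\<beta> + 1 * x)))"
    unfolding L2_inner_def
    using lborel_integral_real_affine[of 1 "\<lambda>x. f (x - \<beta>) * cnj (gabor \<phi> \<alpha> \<beta> (j, m) x)" \<beta>] by simp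
  also have "\<dots> = (LINT x|lborel. unit_exp (- (\<alpha> * \<beta> * of_int m)) * (f x * cnj (gabor \<phi> \<alpha> \<beta> (j - 1, m) x)))"
  proof (intro Bochner_Integration.integral_cong refl)
    fix x
    have "unit_exp (- (\<alpha> * of_int m * (\<beta> + x))) = unit_exp (- (\<alpha> * \<beta> * of_int m)) * unit_exp (- (\<alpha> * of_int m * x))"
      unfolding unit_exp_add[symmetric] by (simp add: algebra_simps)
    then show "f (\<beta> + 1 * x - \<beta>) * cnj (gabor \<phi> \<alpha> \<beta> (j, m) (\<beta> + 1 * x))
        = unit_exp (- (\<alpha> * \<beta> * of_int m)) * (f x * cnj (gabor \<phi> \<alpha> \<beta> (j - 1, m) x))"
      by (simp add: gabor_eq cnj_unit_exp algebra_simps)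
  qed
  also have "\<dots> = unit_exp (- (\<alpha> * \<beta> * of_int m)) * L2_inner f (gabor \<phi> \<alpha> \<beta> (j - 1, m))"
    unfolding L2_inner_def by (rule integral_mult_right_zero)
  finally show ?thesis
    unfolding gabor_coeff_def mult.assoc[symmetric]
    by (simp add: unit_exp_add[symmetric] algebra_simps)
qed

lemma tight_frame_gabor_iff:
  assumes "\<phi> \<in> L2" "\<beta> > 0"
  shows "tight_frame (inverse \<beta>) UNIV (gabor \<phi> \<alpha> \<beta>) \<longleftrightarrow>
    (\<forall>f\<in>L2. ((\<lambda>(j, m). (cmod (gabor_coeff \<phi> \<alpha> \<beta> f j m))\<^sup>2) has_sum (inverse \<beta> * (L2_norm f)\<^sup>2)) UNIV)"
  using assms by (simp add: tight_frame_def gabor_in_L2 norm_gabor_coeff split_def)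

lemma parseval_frame_wilson_iff:
  assumes "\<phi> \<in> L2"
  shows "parseval_frame UNIV (wilson \<phi> \<alpha> \<beta>) \<longleftrightarrow>
    (\<forall>f\<in>L2. ((\<lambda>p. (cmod (L2_inner f (wilson \<phi> \<alpha> \<beta> p)))\<^sup>2) has_sum (L2_norm f)\<^sup>2) UNIV)"
  using assms by (simp add: parseval_frame_def tight_frame_def wilson_in_L2)

text \<open>Squared Wilson coefficients are the fold of \<open>\<beta>\<close> times squared Gabor
  coefficient plus cross term, so their sum is obtained from absolutely convergent sums over the
  whole index plane.\<close>

lemma (in tight_gabor) wilson_has_sum:
  assumes f: "f \<in> L2"
  shows "((\<lambda>p. (cmod (L2_inner f (wilson \<phi> \<alpha> \<beta> p)))\<^sup>2) has_sum ((L2_norm f)\<^sup>2 + \<beta> * Re (wform f f))) UNIV"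
proof -
  define t where "t = (\<lambda>p. \<beta> * ((\<lambda>(j, m). (cmod (coeff f j m))\<^sup>2) p + Re (wterm f f p)))"
  have "(wterm f f has_sum wform f f) UNIV"
    unfolding wilson_form_def by (rule has_sum_infsum[OF term_summable[OF f f]])
  from has_sum_Re[OF this] have "(t has_sum (\<beta> * (inverse \<beta> * (L2_norm f)\<^sup>2 + Re (wform f f)))) UNIV"
    unfolding t_def by (intro has_sum_cmult_right has_sum_add tight f)
  from has_sum_wilson_fold[OF this]
  have "(wilson_fold t has_sum ((L2_norm f)\<^sup>2 + \<beta> * Re (wform f f))) UNIV"
    using \<beta>_pos by (simp add: distrib_left mult.assoc[symmetric])
  moreover have "wilson_fold t (j, m) = (cmod (L2_inner f (wilson \<phi> \<alpha> \<beta> (j, m))))\<^sup>2" for j m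
  proof (cases "m = 0")
    case True
    have self: "Re (z * cnj z) = (cmod z)\<^sup>2" for z
      by (simp add: cmod_power2) (simp add: power2_eq_square)
    have "Re (wterm f f (2 * j, 0)) = (cmod (coeff f (2 * j) 0))\<^sup>2"
      using self[of "coeff f (2 * j) 0"] by (simp add: wilson_term_def power_int_mult)
    \<comment> \<open>For odd \<open>j\<close> the cross term cancels the square; for even
      \<open>j\<close> it doubles it, which accounts for the normalization by
      \<open>sqrt (2 * \<beta>)\<close>.\<close>
    moreover have "Re (wterm f f (2 * j - 1, 0)) = - (cmod (coeff f (2 * j - 1) 0))\<^sup>2"
      using self[of "coeff f (2 * j - 1) 0"] by (simp add: wilson_term_def power_int_diff power_int_mult)
    ultimately show ?thesis
      using True \<beta>_pos by (simp add: wilson_fold_def t_def wilson_inner_zero norm_mult power_mult_distrib)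
  next
    case False
    define e :: complex where "e = (- 1) powi (j + int m)"
    let ?x = "coeff f j (int m)" and ?y = "coeff f j (- int m)"
    have e: "e = 1 \<or> e = - 1"
      using power_int_minus_one_minus[of "j + int m"] unfolding e_def by (cases "even (j + int m)") auto
    \<comment> \<open>The terms at \<open>m\<close> and \<open>-m\<close> carry the same sign and
      conjugate products, hence together form twice the real part in the expanded square.\<close>
    have "(- 1 :: complex) powi (j - int m) = e"
      unfolding e_def by (rule minus_one_powi_diff)
    then have "wilson_fold t (j, m) = \<beta> * ((cmod ?x)\<^sup>2 + Re (e * ?x * cnj ?y) + ((cmod ?y)\<^sup>2 + Re (e * ?y * cnj ?x)))"
      using False by (simp add: wilson_fold_def t_def wilson_term_def e_def distrib_left)
    also have "\<dots> = \<beta> * (cmod (?x + e * ?y))\<^sup>2"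
      using e by (auto simp: cmod_power2 power2_sum power2_diff algebra_simps)
    also have "\<dots> = (cmod (L2_inner f (wilson \<phi> \<alpha> \<beta> (j, m))))\<^sup>2"
      using False f window \<beta>_pos by (simp add: wilson_inner_pos norm_mult power_mult_distrib e_def)
    finally show ?thesis .
  qed
  ultimately show ?thesis
    by (auto elim!: has_sum_cong[THEN iffD1, rotated])
qed

text \<open>
  Translating \<open>f\<close> by \<open>\<beta>\<close> changes the sign of the cross terms of the Wilson coefficients, so averaging
  the two Parseval identities leaves only the Gabor coefficients.
\<close>

lemma parseval_wilson_imp_tight_gabor:
  assumes \<phi>: "\<phi> \<in> L2" and \<beta>: "\<beta> > 0" and f: "f \<in> L2"
    and wilson: "\<And>f. f \<in> L2 \<Longrightarrow>
      ((\<lambda>p. (cmod (L2_inner f (wilson \<phi> \<alpha> \<beta> p)))\<^sup>2) has_sum (L2_norm f)\<^sup>2) UNIV"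
  shows "((\<lambda>(j, m). (cmod (gabor_coeff \<phi> \<alpha> \<beta> f j m))\<^sup>2) has_sum (inverse \<beta> * (L2_norm f)\<^sup>2)) UNIV"
proof -
  let ?c = "gabor_coeff \<phi> \<alpha> \<beta> f"
  define g where "g x = f (x - \<beta>)" for x
  have g: "g \<in> L2"
    using L2_translate[OF f, of "- \<beta>"] by (simp add: g_def[abs_def])
  have g_norm: "L2_norm g = L2_norm f"
    using lborel_integral_real_affine[of 1 "\<lambda>x. (cmod (f x))\<^sup>2" "- \<beta>"] by (simp add: L2_norm_def g_def)
  have g_coeff: "gabor_coeff \<phi> \<alpha> \<beta> g j m = ?c (j - 1) m" for j m
    unfolding g_def[abs_def] by (rule gabor_coeff_translate)
  define t where "t = (\<lambda>(j, m). (cmod (?c j m))\<^sup>2)"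
  \<comment> \<open>For \<open>m > 0\<close> the shift by one brings the coefficients of the
    translate back to index \<open>j\<close> with opposite sign. For \<open>m = 0\<close> the index
    stays, because the translate contributes the missing odd coefficient
    \<open>2 * j - 1\<close>.\<close>
  have bij: "bij_betw (\<lambda>(j, m). (if m = 0 then j else j + 1, m)) UNIV (UNIV :: (int \<times> nat) set)"
    by (rule bij_betwI[where g = "\<lambda>(j, m). (if m = 0 then j else j - 1, m)"]) auto
  define u where "u = (\<lambda>p :: int \<times> nat. (cmod (L2_inner f (wilson \<phi> \<alpha> \<beta> p)))\<^sup>2)"
  define v where "v = (\<lambda>(j, m :: nat). (cmod (L2_inner g (wilson \<phi> \<alpha> \<beta> (if m = 0 then j else j + 1, m))))\<^sup>2)"
  have "(u has_sum (L2_norm f)\<^sup>2) UNIV"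
    unfolding u_def by (rule wilson[OF f])
  moreover have "(v has_sum (L2_norm f)\<^sup>2) UNIV"
    using wilson[OF g] has_sum_reindex_bij_betw[OF bij, of "\<lambda>p. (cmod (L2_inner g (wilson \<phi> \<alpha> \<beta> p)))\<^sup>2"]
    by (simp add: v_def g_norm split_def)
  ultimately have "((\<lambda>p. inverse (2 * \<beta>) * (u p + v p)) has_sum (inverse (2 * \<beta>) * ((L2_norm f)\<^sup>2 + (L2_norm f)\<^sup>2))) UNIV"
    by (intro has_sum_cmult_right has_sum_add)
  moreover have "inverse (2 * \<beta>) * (u (j, m) + v (j, m)) = wilson_fold t (j, m)" for j m
  proof (cases "m = 0")
    case True
    then show ?thesis
      using \<beta> by (simp add: u_def v_def wilson_fold_def t_def wilson_inner_zero g_coeff norm_mult power_mult_distrib field_simps)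
  next
    case False
    define e :: complex where "e = (- 1) powi (j + int m)"
    let ?x = "?c j (int m)" and ?y = "?c j (- int m)"
    have e: "e = 1 \<or> e = - 1"
      using power_int_minus_one_minus[of "j + int m"] unfolding e_def by (cases "even (j + int m)") auto
    have "(- 1) powi (j + 1 + int m) = - e"
      by (simp add: e_def power_int_add)
    then have "v (j, m) = \<beta> * (cmod (?x - e * ?y))\<^sup>2"
      using False g \<phi> \<beta> by (simp add: v_def wilson_inner_pos g_coeff norm_mult power_mult_distrib)
    moreover have "u (j, m) = \<beta> * (cmod (?x + e * ?y))\<^sup>2"
      using False f \<phi> \<beta> by (simp add: u_def wilson_inner_pos norm_mult power_mult_distrib e_def)
    ultimately have "u (j, m) + v (j, m) = \<beta> * ((cmod (?x + e * ?y))\<^sup>2 + (cmod (?x - e * ?y))\<^sup>2)"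
      by (simp add: distrib_left)
    \<comment> \<open>Parallelogram law; its factor 2 is the origin of
      \<open>inverse (2 * \<beta>)\<close>.\<close>
    also have "(cmod (?x + e * ?y))\<^sup>2 + (cmod (?x - e * ?y))\<^sup>2 = 2 * (wilson_fold t (j, m))"
      using e False by (auto simp: wilson_fold_def t_def cmod_power2 power2_sum power2_diff algebra_simps)
    finally show ?thesis
      using \<beta> by simp
  qed
  ultimately have fold: "(wilson_fold t has_sum (inverse \<beta> * (L2_norm f)\<^sup>2)) UNIV"
    using \<beta> by (auto simp: field_simps elim!: has_sum_cong[THEN iffD1, rotated])
  \<comment> \<open>Summability has to come first: the folding identity can identify the value only
    for a family that has a sum.\<close>
  have "t summable_on UNIV"
    by (rule summable_on_wilson_unfold[OF _ has_sum_imp_summable[OF fold]]) (auto simp: t_def)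
  then have "(t has_sum infsum t UNIV) UNIV"
    by (rule has_sum_infsum)
  moreover have "infsum t UNIV = inverse \<beta> * (L2_norm f)\<^sup>2"
    using has_sum_unique[OF has_sum_wilson_fold[OF calculation] fold] .
  ultimately show ?thesis
    by (simp add: t_def)
qed

theorem theorem3p1:
  fixes \<phi> :: "real \<Rightarrow> complex" and \<alpha> \<beta> :: real
  assumes "\<phi> \<in> L2" and "\<alpha> > 0" and "\<beta> > 0"
  shows "(tight_frame (inverse \<beta>) UNIV (gabor \<phi> \<alpha> \<beta>) \<and>
          (\<forall>k::int. AE \<xi> in lborel. Delta \<phi> \<alpha> \<beta> k \<xi> = 0))
         \<longleftrightarrow> parseval_frame UNIV (wilson \<phi> \<alpha> \<beta>)"
proof
  assume a: "tight_frame (inverse \<beta>) UNIV (gabor \<phi> \<alpha> \<beta>) \<and> (\<forall>k::int. AE \<xi> in lborel. Delta \<phi> \<alpha> \<beta> k \<xi> = 0)"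
  then interpret tight_gabor \<phi> \<alpha> \<beta>
    using assms by unfold_locales (auto simp: tight_frame_gabor_iff)
  show "parseval_frame UNIV (wilson \<phi> \<alpha> \<beta>)"
    unfolding parseval_frame_wilson_iff[OF assms(1)]
    using wilson_has_sum Delta_AE_zero_iff a by auto
next
  assume "parseval_frame UNIV (wilson \<phi> \<alpha> \<beta>)"
  then have wilson: "f \<in> L2 \<Longrightarrow>
      ((\<lambda>p. (cmod (L2_inner f (wilson \<phi> \<alpha> \<beta> p)))\<^sup>2) has_sum (L2_norm f)\<^sup>2) UNIV" for f
    unfolding parseval_frame_wilson_iff[OF assms(1)] by blast
  interpret tight_gabor \<phi> \<alpha> \<beta>
    by unfold_locales (use assms parseval_wilson_imp_tight_gabor[OF assms(1,3) _ wilson] in auto)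
  have "wform f f = 0" if f: "f \<in> L2" for f
  proof -
    have "Re (wform f f) = 0"
      using has_sum_unique[OF wilson[OF f] wilson_has_sum[OF f]] \<beta>_pos by simp
    \<comment> \<open>The Wilson sum sees only the real part of the diagonal; Hermitian symmetry
      supplies the rest.\<close>
    moreover have "Im (wform f f) = 0"
      using arg_cong[OF form_commute[of f f], of Im] by simp
    ultimately show ?thesis
      by (simp add: complex_eq_iff)
  qed
  then show "tight_frame (inverse \<beta>) UNIV (gabor \<phi> \<alpha> \<beta>) \<and> (\<forall>k::int. AE \<xi> in lborel. Delta \<phi> \<alpha> \<beta> k \<xi> = 0)"
    using assms tight Delta_AE_zero_iff by (simp add: tight_frame_gabor_iff)
qed

end
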